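(* (i) The category of finite sets and functions has alternation diameter $3$. (ii) The category of countable sets and functions has alternation diameter $4$. (iii) For every field $k$, the category of finite-dimensional vector spaces over $k$ and linear maps has alternation diameter $3$.
   Context: Countable sets include finite sets. Let $\mathcal{C}$ be a category and let $A \times B$ be a category-theoretic product of two objects of $\mathcal{C}$, with defining projections $\pi_A : A \times B \to A$ and $\pi_B : A \times B \to B$. Let $G = \mathrm{Aut}(A \times B)$, and let $G_L = \{ g \in G : \pi_B \circ g = \pi_B \}$ (automorphisms modifying only the left coordinate) and $G_R = \{ g \in G : \pi_A \circ g = \pi_A \}$ (automorphisms modifying only the right coordinate); these are subgroups of $G$. If $G_L \cup G_R$ generates $G$, the alternation diameter of $A \times B$ is the diameter of $G$ with respect to the generating set $G_L \cup G_R$, i.e. the least $d \in \mathbb{N}$ such that every element of $G$ is a product of at most $d$ elements of $G_L \cup G_R$ (and $\infty$ if no such $d$ exists). If $G_L \cup G_R$ does not generate $G$, the alternation diameter of $A\times B$ is undefined. The alternation diameter of the category $\mathcal{C}$ is the least upper bound of the alternation diameters of all products $A \times B$ in $\mathcal{C}$ (undefined if some product in $\mathcal{C}$ has undefined alternation diameter). *)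

theory Defs
  imports
    "HOL-Library.Extended_Nat"
    "HOL-Library.Countable_Set"
    "HOL-Algebra.Generated_Groups"
    "Jordan_Normal_Form.Missing_VectorSpace"
begin

section \<open>Categories and products\<close>

text \<open>
  \<open>Hom C X Y\<close> is the set of morphisms from \<open>X\<close> to \<open>Y\<close>, and \<open>Comp C X Y Z g f\<close> is \<open>g \<circ> f\<close> for
  \<open>f : X \<rightarrow> Y\<close> and \<open>g : Y \<rightarrow> Z\<close>. As everything is indexed by objects, hom-sets of different
  pairs of objects need not be disjoint.
\<close>

record ('o, 'm) category_data =
  Ob :: "'o set"
  Hom :: "'o \<Rightarrow> 'o \<Rightarrow> 'm set"
  Comp :: "'o \<Rightarrow> 'o \<Rightarrow> 'o \<Rightarrow> 'm \<Rightarrow> 'm \<Rightarrow> 'm"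
  Ident :: "'o \<Rightarrow> 'm"

locale category =
  fixes C :: "('o, 'm) category_data"
  assumes Comp_closed: "\<lbrakk>X \<in> Ob C; Y \<in> Ob C; Z \<in> Ob C; f \<in> Hom C X Y; g \<in> Hom C Y Z\<rbrakk>
      \<Longrightarrow> Comp C X Y Z g f \<in> Hom C X Z"
    and Ident_closed: "X \<in> Ob C \<Longrightarrow> Ident C X \<in> Hom C X X"
    and Comp_assoc: "\<lbrakk>W \<in> Ob C; X \<in> Ob C; Y \<in> Ob C; Z \<in> Ob C;
      f \<in> Hom C W X; g \<in> Hom C X Y; h \<in> Hom C Y Z\<rbrakk>
      \<Longrightarrow> Comp C W Y Z h (Comp C W X Y g f) = Comp C W X Z (Comp C X Y Z h g) f"
    and Ident_left: "\<lbrakk>X \<in> Ob C; Y \<in> Ob C; f \<in> Hom C X Y\<rbrakk> \<Longrightarrow> Comp C X Y Y (Ident C Y) f = f"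
    and Ident_right: "\<lbrakk>X \<in> Ob C; Y \<in> Ob C; f \<in> Hom C X Y\<rbrakk> \<Longrightarrow> Comp C X X Y f (Ident C X) = f"

definition is_product ::
    "('o, 'm) category_data \<Rightarrow> 'o \<Rightarrow> 'o \<Rightarrow> 'o \<Rightarrow> 'm \<Rightarrow> 'm \<Rightarrow> bool" where
  "is_product C A B P \<pi>\<^sub>A \<pi>\<^sub>B \<longleftrightarrow>
     A \<in> Ob C \<and> B \<in> Ob C \<and> P \<in> Ob C \<and> \<pi>\<^sub>A \<in> Hom C P A \<and> \<pi>\<^sub>B \<in> Hom C P B \<and>
     (\<forall>X\<in>Ob C. \<forall>f\<in>Hom C X A. \<forall>g\<in>Hom C X B.
        \<exists>!h. h \<in> Hom C X P \<and> Comp C X P A \<pi>\<^sub>A h = f \<and> Comp C X P B \<pi>\<^sub>B h = g)"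

definition Aut :: "('o, 'm) category_data \<Rightarrow> 'o \<Rightarrow> 'm monoid" where
  "Aut C X =
     \<lparr>carrier = {g \<in> Hom C X X. \<exists>h\<in>Hom C X X.
        Comp C X X X g h = Ident C X \<and> Comp C X X X h g = Ident C X},
      monoid.mult = Comp C X X X,
      one = Ident C X\<rparr>"

lemma (in category) group_Aut:
  assumes X: "X \<in> Ob C"
  shows "group (Aut C X)"
proof (rule groupI)
  note cl = Comp_closed[OF X X X] and as = Comp_assoc[OF X X X X]
    and il = Ident_left[OF X X] and ir = Ident_right[OF X X] and ic = Ident_closed[OF X]
  show "\<one>\<^bsub>Aut C X\<^esub> \<in> carrier (Aut C X)"
    using ic il by (auto simp: Aut_def)
  show "g \<otimes>\<^bsub>Aut C X\<^esub> h \<in> carrier (Aut C X)"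
    if gh: "g \<in> carrier (Aut C X)" "h \<in> carrier (Aut C X)" for g h
  proof -
    let ?c = "Comp C X X X"
    obtain g' h' where g': "g' \<in> Hom C X X" "?c g g' = Ident C X" "?c g' g = Ident C X"
      and h': "h' \<in> Hom C X X" "?c h h' = Ident C X" "?c h' h = Ident C X"
      and mem: "g \<in> Hom C X X" "h \<in> Hom C X X"
      using gh by (auto simp: Aut_def)
    have "?c (?c g h) (?c h' g') = ?c g (?c (?c h h') g')"
      using mem g'(1) h'(1) cl as by metis
    then have "?c (?c g h) (?c h' g') = Ident C X"
      using g' h' il by simp
    moreover have "?c (?c h' g') (?c g h) = ?c h' (?c (?c g' g) h)"
      using mem g'(1) h'(1) cl as by metis
    then have "?c (?c h' g') (?c g h) = Ident C X"
      using g' h' il mem by simp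
    ultimately show ?thesis
      using mem g'(1) h'(1) cl by (auto simp: Aut_def)
  qed
  show "f \<otimes>\<^bsub>Aut C X\<^esub> g \<otimes>\<^bsub>Aut C X\<^esub> h = f \<otimes>\<^bsub>Aut C X\<^esub> (g \<otimes>\<^bsub>Aut C X\<^esub> h)"
    if "f \<in> carrier (Aut C X)" "g \<in> carrier (Aut C X)" "h \<in> carrier (Aut C X)" for f g h
    using that as by (simp add: Aut_def)
  show "\<one>\<^bsub>Aut C X\<^esub> \<otimes>\<^bsub>Aut C X\<^esub> g = g" if "g \<in> carrier (Aut C X)" for g
    using that il by (simp add: Aut_def)
  show "\<exists>h\<in>carrier (Aut C X). h \<otimes>\<^bsub>Aut C X\<^esub> g = \<one>\<^bsub>Aut C X\<^esub>" if "g \<in> carrier (Aut C X)" for g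
    using that by (auto simp: Aut_def)
qed

section \<open>Alternation diameter\<close>

text \<open>
  The infimum is the least such \<open>d\<close>, or \<open>\<infinity>\<close> if there is none. Inverses of elements of \<open>S\<close> do not
  occur in the words; below, \<open>S\<close> is always closed under inverses.
\<close>

definition word_diameter :: "('m, 'b) monoid_scheme \<Rightarrow> 'm set \<Rightarrow> enat" where
  "word_diameter G S =
     Inf {enat d | d. \<forall>g\<in>carrier G. \<exists>xs. set xs \<subseteq> S \<and> length xs \<le> d \<and>
                        g = foldr (mult G) xs \<one>\<^bsub>G\<^esub>}"

definition left_auts :: "('o, 'm) category_data \<Rightarrow> 'o \<Rightarrow> 'o \<Rightarrow> 'm \<Rightarrow> 'm set" where
  "left_auts C P B \<pi>\<^sub>B = {g \<in> carrier (Aut C P). Comp C P P B \<pi>\<^sub>B g = \<pi>\<^sub>B}"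

definition right_auts :: "('o, 'm) category_data \<Rightarrow> 'o \<Rightarrow> 'o \<Rightarrow> 'm \<Rightarrow> 'm set" where
  "right_auts C P A \<pi>\<^sub>A = {g \<in> carrier (Aut C P). Comp C P P A \<pi>\<^sub>A g = \<pi>\<^sub>A}"

text \<open>Here and below, the value \<^const>\<open>None\<close> stands for ``undefined''.\<close>

definition product_alternation_diameter ::
    "('o, 'm) category_data \<Rightarrow> 'o \<Rightarrow> 'o \<Rightarrow> 'o \<Rightarrow> 'm \<Rightarrow> 'm \<Rightarrow> enat option" where
  "product_alternation_diameter C A B P \<pi>\<^sub>A \<pi>\<^sub>B =
     (let S = left_auts C P B \<pi>\<^sub>B \<union> right_auts C P A \<pi>\<^sub>A
      in if generate (Aut C P) S = carrier (Aut C P)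
         then Some (word_diameter (Aut C P) S) else None)"

definition alternation_diameter :: "('o, 'm) category_data \<Rightarrow> enat option" where
  "alternation_diameter C =
     (let D = {product_alternation_diameter C A B P \<pi>\<^sub>A \<pi>\<^sub>B | A B P \<pi>\<^sub>A \<pi>\<^sub>B.
                 is_product C A B P \<pi>\<^sub>A \<pi>\<^sub>B}
      in if None \<in> D then None else Some (Sup (the ` D)))"

section \<open>The three categories\<close>

text \<open>
  The underlying sets of objects are subsets of a type of atoms \<open>'a\<close> (or \<open>'v\<close>). If this type is
  large enough, every finite set (countable set, finite-dimensional vector space) is isomorphic to
  an object, so the category is equivalent to the full one. A function \<open>X \<rightarrow> Y\<close> is represented by a
  HOL function that is \<^const>\<open>undefined\<close> outside \<open>X\<close>.
\<close>

definition sets_category :: "'a set set \<Rightarrow> ('a set, 'a \<Rightarrow> 'a) category_data" where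
  "sets_category U =
     \<lparr>Ob = U,
      Hom = (\<lambda>X Y. X \<rightarrow>\<^sub>E Y),
      Comp = (\<lambda>X Y Z g f. compose X g f),
      Ident = (\<lambda>X. \<lambda>x\<in>X. x)\<rparr>"

definition finite_sets :: "('a set, 'a \<Rightarrow> 'a) category_data" where
  "finite_sets = sets_category {X. finite X}"

definition countable_sets :: "('a set, 'a \<Rightarrow> 'a) category_data" where
  "countable_sets = sets_category {X. countable X}"

text \<open>
  The record type \<^typ>\<open>('k, 'v) module\<close> also has fields for a multiplication and a unit of the
  module. The vector space structure does not involve them; they only give rise to further
  isomorphic copies of objects.
\<close>

definition fin_dim_vector_spaces ::
    "('k, 'r) ring_scheme \<Rightarrow> (('k, 'v) module, 'v \<Rightarrow> 'v) category_data" where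
  "fin_dim_vector_spaces K =
     \<lparr>Ob = {V. vectorspace K V \<and> vectorspace.fin_dim K V},
      Hom = (\<lambda>V W. module_hom K V W \<inter> extensional (carrier V)),
      Comp = (\<lambda>V W X g f. compose (carrier V) g f),
      Ident = (\<lambda>V. \<lambda>v\<in>carrier V. v)\<rparr>"

lemma category_sets_category: "category (sets_category U)"
  by unfold_locales
    (auto simp: sets_category_def compose_def PiE_iff extensional_def fun_eq_iff restrict_def)

lemma category_finite_sets: "category finite_sets"
  and category_countable_sets: "category countable_sets"
  by (simp_all add: finite_sets_def countable_sets_def category_sets_category)

lemma category_fin_dim_vector_spaces: "category (fin_dim_vector_spaces K)"
proof
  fix X assume "X \<in> Ob (fin_dim_vector_spaces K)"
  then interpret vectorspace K X by (simp add: fin_dim_vector_spaces_def)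
  show "Ident (fin_dim_vector_spaces K) X \<in> Hom (fin_dim_vector_spaces K) X X"
    by (auto simp: fin_dim_vector_spaces_def module_hom_def)
next
  fix X Y Z f g
  assume "X \<in> Ob (fin_dim_vector_spaces K)"
    and fg: "f \<in> Hom (fin_dim_vector_spaces K) X Y" "g \<in> Hom (fin_dim_vector_spaces K) Y Z"
  then interpret vectorspace K X by (simp add: fin_dim_vector_spaces_def)
  show "Comp (fin_dim_vector_spaces K) X Y Z g f \<in> Hom (fin_dim_vector_spaces K) X Z"
    using fg by (auto simp: fin_dim_vector_spaces_def module_hom_def compose_eq Pi_iff)
qed (auto simp: fin_dim_vector_spaces_def module_hom_def compose_def Pi_iff extensional_def
  fun_eq_iff restrict_def)

end

theory Submission
  imports Defs "HOL-Combinatorics.Transposition"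
begin

text \<open>
  An automorphism \<open>g\<close> of \<open>A \<times> B\<close> is determined by its two coordinates \<open>\<pi>\<^sub>A \<circ> g\<close>, \<open>\<pi>\<^sub>B \<circ> g\<close>, and words in
  \<open>G\<^sub>L \<union> G\<^sub>R\<close> are chains of automorphisms starting at the identity in which consecutive members share
  a coordinate. So \<open>g\<close> is a product of three factors if some \<open>s\<close> makes both \<open>(s, \<pi>\<^sub>B)\<close> and
  \<open>(s, \<pi>\<^sub>B \<circ> g)\<close> invertible. For finite sets \<open>s\<close> is an edge colouring of a regular bipartite
  multigraph (Hall's theorem); for vector spaces it is \<open>\<pi>\<^sub>A + \<beta> \<circ> \<pi>\<^sub>B\<close> with \<open>\<beta>\<close> provided by the stable
  range condition. For countable sets one more intermediate coordinate makes a back-and-forth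
  construction possible, starting with \<open>G\<^sub>L\<close> or with \<open>G\<^sub>R\<close>. If only one factor is infinite, the
  intermediate coordinates come from distinct representatives and a Latin square.

  The swap of \<open>A \<times> A\<close> is not a product of two factors. On \<open>\<nat> \<times> \<nat>\<close>, a permutation that maps a row
  plus one point onto a row, and a column plus one point onto a column, is not a product of three.
\<close>

section \<open>Words in the left and right automorphisms\<close>

text \<open>With three factors a single coordinate \<open>s\<close> must complement two maps at
  once. For infinite sets this can be impossible: a fibre of \<open>\<pi>\<^sub>B\<close> may be a
  proper subset of a fibre of \<open>\<pi>\<^sub>B \<circ> g\<close>, and \<open>s\<close> cannot
  map both bijectively onto \<open>A\<close>. A second new coordinate removes this obstruction. Such
  points may be missing, namely when outside finitely many rows
  \<open>\<pi>\<^sub>B \<circ> g\<close> takes only finitely many values. The same construction with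
  the factors exchanged has its own exceptional case, and the two exclude each other. Hence the
  order of the four factors depends on \<open>g\<close>. For vector spaces, a linear
  \<open>s\<close> with \<open>(s, \<pi>\<^sub>B)\<close> invertible is an invertible map after
  \<open>\<pi>\<^sub>A\<close> plus a linear map after \<open>\<pi>\<^sub>B\<close>. Normalising the
  first map to the identity leaves one unknown \<open>\<beta>\<close>.\<close>

definition alternation_words ::
    "('o, 'm) category_data \<Rightarrow> 'o \<Rightarrow> 'o \<Rightarrow> 'o \<Rightarrow> 'm \<Rightarrow> 'm \<Rightarrow> nat \<Rightarrow> 'm set" where
  "alternation_words C A B P \<pi>\<^sub>A \<pi>\<^sub>B n =
     {foldr (mult (Aut C P)) xs \<one>\<^bsub>Aut C P\<^esub> | xs.
        set xs \<subseteq> left_auts C P B \<pi>\<^sub>B \<union> right_auts C P A \<pi>\<^sub>A \<and> length xs \<le> n}"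

lemma (in group) foldr_mult_generate:
  "set xs \<subseteq> H \<Longrightarrow> H \<subseteq> carrier G \<Longrightarrow> foldr (mult G) xs \<one> \<in> generate G H"
  by (induction xs) (auto intro: generate.one generate.incl generate.eng)

lemma word_diameter_le:
  assumes "carrier (Aut C P) \<subseteq> alternation_words C A B P \<pi>\<^sub>A \<pi>\<^sub>B n"
  shows "word_diameter (Aut C P) (left_auts C P B \<pi>\<^sub>B \<union> right_auts C P A \<pi>\<^sub>A) \<le> enat n"
proof -
  have "\<exists>xs. set xs \<subseteq> left_auts C P B \<pi>\<^sub>B \<union> right_auts C P A \<pi>\<^sub>A \<and> length xs \<le> n \<and>
      g = foldr (mult (Aut C P)) xs \<one>\<^bsub>Aut C P\<^esub>" if "g \<in> carrier (Aut C P)" for g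
    using assms that unfolding alternation_words_def by blast
  then show ?thesis
    unfolding word_diameter_def by (intro Inf_lower) blast
qed

text \<open>Admissible lengths are upward closed, because words are bounded in length rather than of
  exact length; so failure at \<open>n\<close> rules out every \<open>d \<le> n\<close>.\<close>

lemma word_diameter_ge:
  assumes "\<not> carrier (Aut C P) \<subseteq> alternation_words C A B P \<pi>\<^sub>A \<pi>\<^sub>B n"
  shows "enat (Suc n) \<le> word_diameter (Aut C P) (left_auts C P B \<pi>\<^sub>B \<union> right_auts C P A \<pi>\<^sub>A)"
  unfolding word_diameter_def
proof (rule Inf_greatest)
  let ?S = "left_auts C P B \<pi>\<^sub>B \<union> right_auts C P A \<pi>\<^sub>A"
  let ?Q = "\<lambda>d g xs. set xs \<subseteq> ?S \<and> length xs \<le> d \<and> g = foldr (mult (Aut C P)) xs \<one>\<^bsub>Aut C P\<^esub>"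
  fix x
  assume "x \<in> {enat d | d. \<forall>g\<in>carrier (Aut C P). \<exists>xs. ?Q d g xs}"
  then obtain d where d: "x = enat d" "\<forall>g\<in>carrier (Aut C P). \<exists>xs. ?Q d g xs"
    by blast
  have "\<not> d \<le> n"
  proof
    assume "d \<le> n"
    then have "\<forall>g\<in>carrier (Aut C P). \<exists>xs. ?Q n g xs"
      using d(2) by (meson le_trans)
    then show False
      using assms unfolding alternation_words_def by blast
  qed
  then show "enat (Suc n) \<le> x"
    using d(1) by simp
qed

text \<open>Definedness comes with the upper bound: if bounded words exhaust the automorphism group,
  the two subgroups generate it, so \<open>None\<close> does not occur. One product on which
  \<open>n\<close> fails then makes the supremum equal to the bound.\<close>

lemma alternation_diameter_eqI:
  assumes C: "category C"
    and upper: "\<And>A B P \<pi>\<^sub>A \<pi>\<^sub>B. is_product C A B P \<pi>\<^sub>A \<pi>\<^sub>B \<Longrightarrow>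
      carrier (Aut C P) \<subseteq> alternation_words C A B P \<pi>\<^sub>A \<pi>\<^sub>B (Suc n)"
    and prod: "is_product C A B P \<pi>\<^sub>A \<pi>\<^sub>B"
    and lower: "\<not> carrier (Aut C P) \<subseteq> alternation_words C A B P \<pi>\<^sub>A \<pi>\<^sub>B n"
  shows "alternation_diameter C = Some (enat (Suc n))"
proof -
  let ?D = "{product_alternation_diameter C A B P \<pi>\<^sub>A \<pi>\<^sub>B | A B P \<pi>\<^sub>A \<pi>\<^sub>B.
                 is_product C A B P \<pi>\<^sub>A \<pi>\<^sub>B}"
  let ?w = "\<lambda>A B P \<pi>\<^sub>A \<pi>\<^sub>B. word_diameter (Aut C P) (left_auts C P B \<pi>\<^sub>B \<union> right_auts C P A \<pi>\<^sub>A)"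
  have pad: "product_alternation_diameter C A B P \<pi>\<^sub>A \<pi>\<^sub>B = Some (?w A B P \<pi>\<^sub>A \<pi>\<^sub>B)"
    if p: "is_product C A B P \<pi>\<^sub>A \<pi>\<^sub>B" for A B P \<pi>\<^sub>A \<pi>\<^sub>B
  proof -
    let ?S = "left_auts C P B \<pi>\<^sub>B \<union> right_auts C P A \<pi>\<^sub>A"
    interpret group "Aut C P"
      using category.group_Aut[OF C] p by (simp add: is_product_def)
    have S: "?S \<subseteq> carrier (Aut C P)"
      by (auto simp: left_auts_def right_auts_def)
    have "carrier (Aut C P) \<subseteq> generate (Aut C P) ?S"
      using upper[OF p] foldr_mult_generate[OF _ S] unfolding alternation_words_def by blast
    then have "generate (Aut C P) ?S = carrier (Aut C P)"
      using generate_incl[OF S] by blast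
    then show ?thesis
      by (simp add: product_alternation_diameter_def Let_def)
  qed
  have "None \<notin> ?D"
    using pad by force
  moreover have "Sup (the ` ?D) = enat (Suc n)"
  proof (rule antisym)
    show "Sup (the ` ?D) \<le> enat (Suc n)"
    proof (rule Sup_least)
      fix d assume "d \<in> the ` ?D"
      then obtain A B P \<pi>\<^sub>A \<pi>\<^sub>B where p: "is_product C A B P \<pi>\<^sub>A \<pi>\<^sub>B" and d: "d = ?w A B P \<pi>\<^sub>A \<pi>\<^sub>B"
        using pad by auto
      show "d \<le> enat (Suc n)"
        unfolding d by (rule word_diameter_le[OF upper[OF p]])
    qed
    have "?w A B P \<pi>\<^sub>A \<pi>\<^sub>B \<in> the ` ?D"
      using pad[OF prod] prod by (metis (mono_tags, lifting) CollectI image_eqI option.sel)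
    then show "enat (Suc n) \<le> Sup (the ` ?D)"
      using word_diameter_ge[OF lower] by (meson Sup_upper order_trans)
  qed
  ultimately show ?thesis
    unfolding alternation_diameter_def by (simp add: Let_def)
qed

locale product_object = category C
  for C :: "('o, 'm) category_data" +
  fixes A B P :: 'o and \<pi>\<^sub>A \<pi>\<^sub>B :: 'm
  assumes is_product: "is_product C A B P \<pi>\<^sub>A \<pi>\<^sub>B"
begin

abbreviation left_coord :: "'m \<Rightarrow> 'm" where
  "left_coord \<equiv> Comp C P P A \<pi>\<^sub>A"

abbreviation right_coord :: "'m \<Rightarrow> 'm" where
  "right_coord \<equiv> Comp C P P B \<pi>\<^sub>B"

abbreviation words :: "nat \<Rightarrow> 'm set" where
  "words \<equiv> alternation_words C A B P \<pi>\<^sub>A \<pi>\<^sub>B"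

lemma objects: "A \<in> Ob C" "B \<in> Ob C" "P \<in> Ob C"
  and projections: "\<pi>\<^sub>A \<in> Hom C P A" "\<pi>\<^sub>B \<in> Hom C P B"
  using is_product by (auto simp: is_product_def)

lemma pairing_exists:
  "\<lbrakk>X \<in> Ob C; f \<in> Hom C X A; h \<in> Hom C X B\<rbrakk> \<Longrightarrow>
    \<exists>u\<in>Hom C X P. Comp C X P A \<pi>\<^sub>A u = f \<and> Comp C X P B \<pi>\<^sub>B u = h"
  using is_product unfolding is_product_def by blast

lemma pairing_unique:
  assumes "X \<in> Ob C" "u \<in> Hom C X P" "v \<in> Hom C X P"
    and "Comp C X P A \<pi>\<^sub>A u = Comp C X P A \<pi>\<^sub>A v" "Comp C X P B \<pi>\<^sub>B u = Comp C X P B \<pi>\<^sub>B v"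
  shows "u = v"
proof -
  have "Comp C X P A \<pi>\<^sub>A v \<in> Hom C X A" "Comp C X P B \<pi>\<^sub>B v \<in> Hom C X B"
    using assms Comp_closed objects projections by metis+
  then show ?thesis
    using is_product assms unfolding is_product_def by blast
qed

sublocale Aut: group "Aut C P"
  using group_Aut objects by simp

lemma Aut_mult: "u \<otimes>\<^bsub>Aut C P\<^esub> v = Comp C P P P u v"
  and Aut_one: "\<one>\<^bsub>Aut C P\<^esub> = Ident C P"
  by (simp_all add: Aut_def)

lemma Aut_hom: "u \<in> carrier (Aut C P) \<Longrightarrow> u \<in> Hom C P P"
  by (simp add: Aut_def)

lemma coord_one: "left_coord \<one>\<^bsub>Aut C P\<^esub> = \<pi>\<^sub>A" "right_coord \<one>\<^bsub>Aut C P\<^esub> = \<pi>\<^sub>B"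
  using Ident_right objects projections by (simp_all add: Aut_one)

text \<open>Right multiplication acts on both coordinates by precomposition, so a coordinate shared
  by two automorphisms stays shared.\<close>

lemma coord_mult:
  assumes "u \<in> carrier (Aut C P)" "v \<in> carrier (Aut C P)"
  shows "left_coord (u \<otimes>\<^bsub>Aut C P\<^esub> v) = Comp C P P A (left_coord u) v"
    and "right_coord (u \<otimes>\<^bsub>Aut C P\<^esub> v) = Comp C P P B (right_coord u) v"
  using assms Aut_hom Comp_assoc objects projections unfolding Aut_mult by metis+

lemma words_0: "words 0 = {\<one>\<^bsub>Aut C P\<^esub>}"
  by (auto simp: alternation_words_def)

text \<open>
  Left multiplication by an element of \<open>left_auts\<close> (\<open>right_auts\<close>) changes \<open>v\<close> into an arbitrary
  automorphism with the same right (left) coordinate.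
\<close>

lemma words_Suc:
  "words (Suc n) = {u \<in> carrier (Aut C P).
     \<exists>v\<in>words n. left_coord u = left_coord v \<or> right_coord u = right_coord v}"
proof -
  let ?S = "left_auts C P B \<pi>\<^sub>B \<union> right_auts C P A \<pi>\<^sub>A"
  have S: "?S \<subseteq> carrier (Aut C P)"
    by (auto simp: left_auts_def right_auts_def)
  have foldr_closed: "foldr (mult (Aut C P)) xs \<one>\<^bsub>Aut C P\<^esub> \<in> carrier (Aut C P)"
    if "set xs \<subseteq> ?S" for xs
    using that S by (induction xs) auto
  show ?thesis
  proof (intro Set.equalityI subsetI)
    fix u assume "u \<in> words (Suc n)"
    then obtain xs where xs: "set xs \<subseteq> ?S" "length xs \<le> Suc n"
        "u = foldr (mult (Aut C P)) xs \<one>\<^bsub>Aut C P\<^esub>"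
      by (auto simp: alternation_words_def)
    have u: "u \<in> carrier (Aut C P)"
      using foldr_closed xs by blast
    show "u \<in> {u \<in> carrier (Aut C P).
        \<exists>v\<in>words n. left_coord u = left_coord v \<or> right_coord u = right_coord v}"
    proof (cases xs)
      case Nil
      have "\<one>\<^bsub>Aut C P\<^esub> \<in> words n"
        by (auto simp: alternation_words_def intro!: exI[of _ "[]"])
      then show ?thesis
        using Nil u xs by auto
    next
      case (Cons x ys)
      let ?v = "foldr (mult (Aut C P)) ys \<one>\<^bsub>Aut C P\<^esub>"
      have v: "?v \<in> words n"
        using Cons xs by (auto simp: alternation_words_def)
      have c: "?v \<in> carrier (Aut C P)" "x \<in> carrier (Aut C P)" "u = x \<otimes>\<^bsub>Aut C P\<^esub> ?v"
        using foldr_closed[of ys] Cons xs S by auto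
      have "left_coord x = \<pi>\<^sub>A \<or> right_coord x = \<pi>\<^sub>B"
        using Cons xs by (auto simp: left_auts_def right_auts_def)
      then have "left_coord u = left_coord ?v \<or> right_coord u = right_coord ?v"
        using coord_mult c by metis
      then show ?thesis
        using u v by blast
    qed
  next
    fix u assume "u \<in> {u \<in> carrier (Aut C P).
        \<exists>v\<in>words n. left_coord u = left_coord v \<or> right_coord u = right_coord v}"
    then obtain v where u: "u \<in> carrier (Aut C P)" and v: "v \<in> words n"
      and uv: "left_coord u = left_coord v \<or> right_coord u = right_coord v"
      by blast
    obtain xs where xs: "set xs \<subseteq> ?S" "length xs \<le> n"
        "v = foldr (mult (Aut C P)) xs \<one>\<^bsub>Aut C P\<^esub>"
      using v by (auto simp: alternation_words_def)
    have vc: "v \<in> carrier (Aut C P)"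
      using foldr_closed xs by blast
    \<comment> \<open>The quotient of \<open>u\<close> by \<open>v\<close> fixes the coordinate that
      they share, since precomposing that coordinate of \<open>v\<close> with the inverse of
      \<open>v\<close> gives the projection.\<close>
    define x where "x = u \<otimes>\<^bsub>Aut C P\<^esub> inv\<^bsub>Aut C P\<^esub> v"
    have x: "x \<in> carrier (Aut C P)"
      using u vc by (simp add: x_def)
    have *: "left_coord \<one>\<^bsub>Aut C P\<^esub> = Comp C P P A (left_coord v) (inv\<^bsub>Aut C P\<^esub> v)"
        "right_coord \<one>\<^bsub>Aut C P\<^esub> = Comp C P P B (right_coord v) (inv\<^bsub>Aut C P\<^esub> v)"
      using coord_mult[of v "inv\<^bsub>Aut C P\<^esub> v"] vc by simp_all
    have "left_coord x = \<pi>\<^sub>A \<or> right_coord x = \<pi>\<^sub>B"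
      using uv coord_mult[of u "inv\<^bsub>Aut C P\<^esub> v"] u vc * by (auto simp: x_def coord_one)
    then have "x \<in> ?S"
      using x by (auto simp: left_auts_def right_auts_def)
    moreover have "u = x \<otimes>\<^bsub>Aut C P\<^esub> v"
      using u vc by (simp add: x_def Aut.m_assoc)
    ultimately have "set (x # xs) \<subseteq> ?S" "length (x # xs) \<le> Suc n"
        "u = foldr (mult (Aut C P)) (x # xs) \<one>\<^bsub>Aut C P\<^esub>"
      using xs by auto
    then show "u \<in> words (Suc n)"
      unfolding alternation_words_def by blast
  qed
qed

lemma words_SucI:
  assumes "v \<in> words n" "u \<in> carrier (Aut C P)"
    and "left_coord u = left_coord v \<or> right_coord u = right_coord v"
  shows "u \<in> words (Suc n)"
  using assms unfolding words_Suc by blast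

text \<open>The chain from the identity through \<open>u\<close> and \<open>v\<close> to
  \<open>g\<close> moves by elements of \<open>G\<^sub>L\<close>, \<open>G\<^sub>R\<close>,
  \<open>G\<^sub>L\<close> in turn; what remains to be found is the common left coordinate of
  \<open>u\<close> and \<open>v\<close>.\<close>

lemma words_3I:
  assumes "g \<in> carrier (Aut C P)" "u \<in> carrier (Aut C P)" "v \<in> carrier (Aut C P)"
    and "right_coord u = \<pi>\<^sub>B" "left_coord u = left_coord v" "right_coord v = right_coord g"
  shows "g \<in> words 3"
proof -
  have "u \<in> words (Suc 0)"
    by (rule words_SucI[of "\<one>\<^bsub>Aut C P\<^esub>"]) (use assms in \<open>simp_all add: words_0 coord_one\<close>)
  then have "v \<in> words (Suc (Suc 0))"
    by (rule words_SucI) (use assms in simp_all)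
  then have "g \<in> words (Suc (Suc (Suc 0)))"
    by (rule words_SucI) (use assms in simp_all)
  then show ?thesis
    by (simp add: numeral_3_eq_3)
qed

text \<open>The chain starts with an element of \<open>G\<^sub>R\<close>; the variant below starts
  with \<open>G\<^sub>L\<close>. Both are needed for countable sets.\<close>

lemma words_4I_right:
  assumes "g \<in> carrier (Aut C P)" "u \<in> carrier (Aut C P)" "v \<in> carrier (Aut C P)"
    "w \<in> carrier (Aut C P)"
    and "left_coord u = \<pi>\<^sub>A" "right_coord u = right_coord v" "left_coord v = left_coord w"
      "right_coord w = right_coord g"
  shows "g \<in> words 4"
proof -
  have "u \<in> words (Suc 0)"
    by (rule words_SucI[of "\<one>\<^bsub>Aut C P\<^esub>"]) (use assms in \<open>simp_all add: words_0 coord_one\<close>)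
  then have "v \<in> words (Suc (Suc 0))"
    by (rule words_SucI) (use assms in simp_all)
  then have "w \<in> words (Suc (Suc (Suc 0)))"
    by (rule words_SucI) (use assms in simp_all)
  then have "g \<in> words (Suc (Suc (Suc (Suc 0))))"
    by (rule words_SucI) (use assms in simp_all)
  then show ?thesis
    by (simp add: eval_nat_numeral)
qed

lemma words_4I_left:
  assumes "g \<in> carrier (Aut C P)" "u \<in> carrier (Aut C P)" "v \<in> carrier (Aut C P)"
    "w \<in> carrier (Aut C P)"
    and "right_coord u = \<pi>\<^sub>B" "left_coord u = left_coord v" "right_coord v = right_coord w"
      "left_coord w = left_coord g"
  shows "g \<in> words 4"
proof -
  have "u \<in> words (Suc 0)"
    by (rule words_SucI[of "\<one>\<^bsub>Aut C P\<^esub>"]) (use assms in \<open>simp_all add: words_0 coord_one\<close>)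
  then have "v \<in> words (Suc (Suc 0))"
    by (rule words_SucI) (use assms in simp_all)
  then have "w \<in> words (Suc (Suc (Suc 0)))"
    by (rule words_SucI) (use assms in simp_all)
  then have "g \<in> words (Suc (Suc (Suc (Suc 0))))"
    by (rule words_SucI) (use assms in simp_all)
  then show ?thesis
    by (simp add: eval_nat_numeral)
qed

text \<open>Among the eight patterns of shared coordinates only the two alternating ones are
  genuine. In the others two consecutive steps merge, and the identity can serve as
  \<open>u\<close>, or as both \<open>u\<close> and \<open>v\<close>.\<close>

lemma words_3D:
  assumes "g \<in> words 3"
  shows "(\<exists>u\<in>carrier (Aut C P). \<exists>v\<in>carrier (Aut C P).
            right_coord u = \<pi>\<^sub>B \<and> left_coord u = left_coord v \<and> right_coord v = right_coord g)
       \<or> (\<exists>u\<in>carrier (Aut C P). \<exists>v\<in>carrier (Aut C P).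
            left_coord u = \<pi>\<^sub>A \<and> right_coord u = right_coord v \<and> left_coord v = left_coord g)"
proof -
  have "g \<in> words (Suc (Suc (Suc 0)))"
    using assms by (simp add: numeral_3_eq_3)
  then obtain u v where "g \<in> carrier (Aut C P)" "u \<in> carrier (Aut C P)" "v \<in> carrier (Aut C P)"
    and uv: "left_coord u = \<pi>\<^sub>A \<or> right_coord u = \<pi>\<^sub>B"
      "left_coord v = left_coord u \<or> right_coord v = right_coord u"
      "left_coord g = left_coord v \<or> right_coord g = right_coord v"
    by (auto simp: words_Suc words_0 coord_one)
  then show ?thesis
    using Aut.one_closed coord_one by metis
qed

end

text \<open>An automorphism one step away from both the identity and the swap would have two equal
  coordinates; composing with its inverse would identify the two projections.\<close>

lemma (in category) swap_notin_alternation_words_2: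
  assumes "is_product C A A P \<pi>\<^sub>1 \<pi>\<^sub>2" and "\<pi>\<^sub>1 \<noteq> \<pi>\<^sub>2"
  shows "\<not> carrier (Aut C P) \<subseteq> alternation_words C A A P \<pi>\<^sub>1 \<pi>\<^sub>2 2"
proof
  interpret product_object C A A P \<pi>\<^sub>1 \<pi>\<^sub>2
    using assms by unfold_locales
  assume le: "carrier (Aut C P) \<subseteq> words 2"
  obtain t where t: "t \<in> Hom C P P" "left_coord t = \<pi>\<^sub>2" "right_coord t = \<pi>\<^sub>1"
    using pairing_exists[of P] objects projections by meson
  have "Comp C P P P t t = Ident C P"
  proof (rule pairing_unique[of P])
    have "left_coord (Comp C P P P t t) = Comp C P P A (left_coord t) t"
      "right_coord (Comp C P P P t t) = Comp C P P A (right_coord t) t"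
      using Comp_assoc t objects projections by metis+
    then show "left_coord (Comp C P P P t t) = left_coord (Ident C P)"
      "right_coord (Comp C P P P t t) = right_coord (Ident C P)"
      using t coord_one by (simp_all add: Aut_one)
  qed (use t objects Comp_closed Ident_closed in auto)
  then have "t \<in> carrier (Aut C P)"
    using t by (auto simp: Aut_def)
  then have "t \<in> words (Suc (Suc 0))"
    using le by (auto simp: numeral_2_eq_2)
  then obtain u where u: "u \<in> carrier (Aut C P)" "left_coord u = \<pi>\<^sub>1 \<or> right_coord u = \<pi>\<^sub>2"
    "left_coord t = left_coord u \<or> right_coord t = right_coord u"
    by (auto simp: words_Suc words_0 coord_one)
  then have "left_coord u = right_coord u"
    using t assms(2) by metis
  then show False
    using coord_mult[of u "inv\<^bsub>Aut C P\<^esub> u"] u(1) assms(2) coord_one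
    by (metis Aut.inv_closed Aut.r_inv)
qed

section \<open>Coordinates on products of sets\<close>

text \<open>If every nonempty proper subfamily has a spare value, any value of one index may be
  withdrawn from the other sets. Otherwise some critical \<open>J\<close> has exactly
  \<open>card J\<close> values, and the family splits into \<open>J\<close> and the rest with those
  values deleted.\<close>

lemma hall:
  assumes "finite I" and "\<And>i. i \<in> I \<Longrightarrow> finite (S i)"
    and "\<And>J. J \<subseteq> I \<Longrightarrow> card J \<le> card (\<Union>(S ` J))"
  shows "\<exists>f. inj_on f I \<and> (\<forall>i\<in>I. f i \<in> S i)"
  using assms
proof (induction I arbitrary: S rule: finite_psubset_induct)
  case (psubset I)
  have finU: "finite (\<Union>(S ` J))" if "J \<subseteq> I" for J
    using that psubset.hyps psubset.prems(1) by (auto intro: finite_subset)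
  show ?case
  proof (cases "I = {}")
    case False
    then obtain i where i: "i \<in> I" by blast
    show ?thesis
    proof (cases "\<forall>J. J \<noteq> {} \<and> J \<subset> I \<longrightarrow> card J < card (\<Union>(S ` J))")
      case True
      have "card {i} \<le> card (S i)"
        using psubset.prems(2)[of "{i}"] i by simp
      then obtain x where x: "x \<in> S i" by fastforce
      have "\<exists>f. inj_on f (I - {i}) \<and> (\<forall>j\<in>I - {i}. f j \<in> S j - {x})"
      proof (rule psubset.IH)
        show "I - {i} \<subset> I" using i by blast
        show "finite (S j - {x})" if "j \<in> I - {i}" for j
          using that psubset.prems(1) by blast
        fix J assume J: "J \<subseteq> I - {i}"
        have U: "\<Union>((\<lambda>j. S j - {x}) ` J) = \<Union>(S ` J) - {x}" by blast
        show "card J \<le> card (\<Union>((\<lambda>j. S j - {x}) ` J))"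
        proof (cases "J = {}")
          case False
          then have "card J < card (\<Union>(S ` J))"
            using True J i by blast
          then show ?thesis
            unfolding U by (cases "x \<in> \<Union>(S ` J)") (auto simp: card_Diff_singleton)
        qed simp
      qed
      then obtain f where f: "inj_on f (I - {i})" "\<And>j. j \<in> I - {i} \<Longrightarrow> f j \<in> S j - {x}"
        by blast
      have "inj_on (f(i := x)) I"
        using f by (fastforce simp: inj_on_def)
      moreover have "\<forall>j\<in>I. (f(i := x)) j \<in> S j"
        using f x by auto
      ultimately show ?thesis by blast
    next
      case False
      then obtain J where J: "J \<noteq> {}" "J \<subset> I" "\<not> card J < card (\<Union>(S ` J))"
        by blast
      let ?U = "\<Union>(S ` J)"
      have eq: "card ?U = card J"
        using J(3) psubset.prems(2)[OF psubset_imp_subset[OF J(2)]] by linarith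
      have "\<exists>f. inj_on f J \<and> (\<forall>j\<in>J. f j \<in> S j)"
        by (rule psubset.IH) (use J psubset.prems in auto)
      then obtain f where f: "inj_on f J" "\<And>j. j \<in> J \<Longrightarrow> f j \<in> S j" by blast
      have "\<exists>f. inj_on f (I - J) \<and> (\<forall>j\<in>I - J. f j \<in> S j - ?U)"
      proof (rule psubset.IH)
        show "I - J \<subset> I" using J by blast
        show "finite (S j - ?U)" if "j \<in> I - J" for j
          using that psubset.prems(1) by blast
        fix L assume L: "L \<subseteq> I - J"
        let ?V = "\<Union>((\<lambda>j. S j - ?U) ` L)"
        have fin: "finite L" "finite J"
          using L J psubset.hyps finite_subset by blast+
        \<comment> \<open>Hall's condition for \<open>L \<union> J\<close>, minus the
          \<open>card J\<close> values that \<open>J\<close> occupies, is Hall's condition for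
          \<open>L\<close> in the reduced family.\<close>
        have "card L + card J = card (L \<union> J)"
          using L fin by (subst card_Un_disjoint) auto
        also have "\<dots> \<le> card (\<Union>(S ` (L \<union> J)))"
          using psubset.prems(2) L J by blast
        also have "\<Union>(S ` (L \<union> J)) = ?V \<union> ?U" by blast
        also have "card (?V \<union> ?U) = card ?V + card ?U"
          using finU[of L] finU[of J] L J
          by (subst card_Un_disjoint) (auto intro: finite_subset[OF _ finU[of L]])
        finally show "card L \<le> card ?V" using eq by simp
      qed
      then obtain g where g: "inj_on g (I - J)" "\<And>j. j \<in> I - J \<Longrightarrow> g j \<in> S j - ?U" by blast
      let ?h = "\<lambda>j. if j \<in> J then f j else g j"
      have "?h j \<noteq> ?h k" if "j \<in> J" "k \<in> I - J" for j k
        using f(2) g(2) that by fastforce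
      then have "inj_on ?h I"
        using f(1) g(1) unfolding inj_on_def by (metis DiffI)
      moreover have "\<forall>j\<in>I. ?h j \<in> S j"
        using f g by auto
      ultimately show ?thesis by blast
    qed
  qed simp
qed

lemma card_union_of_fibers:
  assumes "finite X" "finite J" "\<And>y. y \<in> J \<Longrightarrow> card {x \<in> X. b x = y} = m"
  shows "card {x \<in> X. b x \<in> J} = m * card J"
proof -
  have "{x \<in> X. b x \<in> J} = (\<Union>y\<in>J. {x \<in> X. b x = y})" by auto
  also have "card \<dots> = (\<Sum>y\<in>J. card {x \<in> X. b x = y})"
    using assms(1,2) by (intro card_UN_disjoint) auto
  finally show ?thesis using assms(3) by simp
qed

text \<open>An element \<open>x\<close> is an edge from \<open>b x\<close> to \<open>b' x\<close>
  between two copies of \<open>B\<close>, and \<open>m\<close> is the degree of every vertex.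
  Removing a perfect matching lowers all degrees by one.\<close>

lemma regular_bipartite_coloring:
  assumes "finite X" "finite B" "b \<in> X \<rightarrow> B" "b' \<in> X \<rightarrow> B"
    and "\<And>y. y \<in> B \<Longrightarrow> card {x \<in> X. b x = y} = m"
    and "\<And>y. y \<in> B \<Longrightarrow> card {x \<in> X. b' x = y} = m"
  shows "\<exists>s. \<forall>y\<in>B. bij_betw s {x \<in> X. b x = y} {..<m} \<and> bij_betw s {x \<in> X. b' x = y} {..<m}"
  using assms
proof (induction m arbitrary: X)
  case 0
  then show ?case by (auto simp: bij_betw_def inj_on_def)
next
  case (Suc m)
  have "\<exists>f. inj_on f B \<and> (\<forall>y\<in>B. f y \<in> b' ` {x \<in> X. b x = y})"
  proof (rule hall)
    fix J assume J: "J \<subseteq> B"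
    let ?U = "\<Union>((\<lambda>y. b' ` {x \<in> X. b x = y}) ` J)"
    have U: "?U \<subseteq> B" using Suc.prems(4) by auto
    have fin: "finite J" "finite ?U"
      using J U Suc.prems(2) finite_subset by blast+
    \<comment> \<open>Double counting: all \<open>Suc m * card J\<close> edges leaving
      \<open>J\<close> end in \<open>?U\<close>, which receives only \<open>Suc m * card ?U\<close>
      edges.\<close>
    have "Suc m * card J = card {x \<in> X. b x \<in> J}"
      by (intro card_union_of_fibers[symmetric]) (use Suc.prems J fin in auto)
    also have "\<dots> \<le> card {x \<in> X. b' x \<in> ?U}"
      using Suc.prems(1) by (intro card_mono) auto
    also have "\<dots> = Suc m * card ?U"
      by (intro card_union_of_fibers) (use Suc.prems U fin in auto)
    finally show "card J \<le> card ?U" by (simp only: Suc_mult_le_cancel1)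
  qed (use Suc.prems in auto)
  then obtain f where f: "inj_on f B" "\<And>y. y \<in> B \<Longrightarrow> \<exists>x\<in>X. b x = y \<and> b' x = f y"
    by fastforce
  then obtain t where t: "\<And>y. y \<in> B \<Longrightarrow> t y \<in> X \<and> b (t y) = y \<and> b' (t y) = f y"
    by metis
  \<comment> \<open>Finiteness of \<open>B\<close> makes the injection \<open>f\<close> onto, so the
    matching covers the vertices on the \<open>b'\<close> side as well.\<close>
  have "f ` B \<subseteq> B" using t Suc.prems(4) by (metis PiE image_subsetI)
  then have fB: "f ` B = B" using f(1) Suc.prems(2) by (simp add: endo_inj_surj)
  have surj: "\<exists>w. w \<in> B \<and> y = f w" if "y \<in> B" for y
  proof -
    have "y \<in> f ` B" unfolding fB by (rule that)
    then show ?thesis by (elim imageE) blast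
  qed
  let ?T = "t ` B"
  have fib: "{x \<in> X. b x = y} = insert (t y) {x \<in> X - ?T. b x = y}" if "y \<in> B" for y
    using t that by auto
  have fib': "{x \<in> X. b' x = f y} = insert (t y) {x \<in> X - ?T. b' x = f y}" if "y \<in> B" for y
    using t that f(1) by (auto dest: inj_onD)
  have "\<exists>s. \<forall>y\<in>B. bij_betw s {x \<in> X - ?T. b x = y} {..<m} \<and>
      bij_betw s {x \<in> X - ?T. b' x = y} {..<m}"
  proof (rule Suc.IH)
    show "card {x \<in> X - ?T. b x = y} = m" if "y \<in> B" for y
      using Suc.prems(5)[OF that] fib[OF that] Suc.prems(1) that by (auto simp: card_insert_if)
    show "card {x \<in> X - ?T. b' x = y} = m" if "y \<in> B" for y
    proof -
      obtain w where w: "w \<in> B" "y = f w" using surj[OF \<open>y \<in> B\<close>] by blast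
      show ?thesis
        using Suc.prems(6)[OF that] fib'[OF w(1)] Suc.prems(1) w by (auto simp: card_insert_if)
    qed
  qed (use Suc.prems in auto)
  then obtain s where s: "\<And>y. y \<in> B \<Longrightarrow> bij_betw s {x \<in> X - ?T. b x = y} {..<m}"
      "\<And>y. y \<in> B \<Longrightarrow> bij_betw s {x \<in> X - ?T. b' x = y} {..<m}"
    by blast
  \<comment> \<open>The matching receives the new colour \<open>m\<close>; every fibre of
    \<open>b\<close> and of \<open>b'\<close> contains exactly one of its edges.\<close>
  let ?s = "\<lambda>x. if x \<in> ?T then m else s x"
  have ext: "bij_betw ?s (insert x F) {..<Suc m}" if "bij_betw s F {..<m}" "x \<in> ?T" "F \<inter> ?T = {}" for x F
  proof -
    have "bij_betw ?s F {..<m}"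
      using that(1) by (rule bij_betw_cong[THEN iffD1, rotated]) (use that(3) in auto)
    moreover have "x \<notin> F" using that by blast
    ultimately show ?thesis
      using notIn_Un_bij_betw[of x F ?s "{..<m}"] that(2) by (simp add: lessThan_Suc)
  qed
  have "bij_betw ?s {x \<in> X. b x = y} {..<Suc m}" if "y \<in> B" for y
    unfolding fib[OF that] by (rule ext[OF s(1)[OF that]]) (use that in auto)
  moreover have "bij_betw ?s {x \<in> X. b' x = y} {..<Suc m}" if "y \<in> B" for y
  proof -
    obtain w where w: "w \<in> B" "y = f w" using surj[OF \<open>y \<in> B\<close>] by blast
    have "bij_betw s {x \<in> X - ?T. b' x = f w} {..<m}"
      using s(2)[OF that] w by simp
    then show ?thesis
      unfolding w(2) fib'[OF w(1)] by (rule ext) (use w in auto)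
  qed
  ultimately show ?case by blast
qed

text \<open>This is the link to colourings: completing \<open>b\<close> to a bijection onto the
  product means numbering each fibre of \<open>b\<close> by \<open>A\<close>, independently of the
  other fibres.\<close>

lemma bij_betw_pair_iff:
  "bij_betw (\<lambda>x. (s x, b x)) X (A \<times> B) \<longleftrightarrow>
     (\<lambda>x. (s x, b x)) \<in> X \<rightarrow> A \<times> B \<and> (\<forall>y\<in>B. bij_betw s {x \<in> X. b x = y} A)"
  (is "?l = ?r")
proof
  assume l: ?l
  have "bij_betw s {x \<in> X. b x = y} A" if "y \<in> B" for y
    unfolding bij_betw_def
  proof
    show "inj_on s {x \<in> X. b x = y}"
      using l by (auto simp: bij_betw_def inj_on_def)
    show "s ` {x \<in> X. b x = y} = A"
    proof
      show "s ` {x \<in> X. b x = y} \<subseteq> A"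
        using l by (auto simp: bij_betw_def)
      show "A \<subseteq> s ` {x \<in> X. b x = y}"
      proof
        fix u assume "u \<in> A"
        then have "(u, y) \<in> (\<lambda>x. (s x, b x)) ` X"
          using l that by (simp add: bij_betw_def)
        then show "u \<in> s ` {x \<in> X. b x = y}" by auto
      qed
    qed
  qed
  then show ?r using l by (auto simp: bij_betw_def)
next
  assume r: ?r
  show ?l
    unfolding bij_betw_def
  proof
    show "inj_on (\<lambda>x. (s x, b x)) X"
    proof (rule inj_onI)
      fix x z assume xz: "x \<in> X" "z \<in> X" "(s x, b x) = (s z, b z)"
      then have "inj_on s {w \<in> X. b w = b x}"
        using r by (auto simp: bij_betw_def)
      then show "x = z" using xz by (auto dest: inj_onD)
    qed
    show "(\<lambda>x. (s x, b x)) ` X = A \<times> B"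
    proof
      show "A \<times> B \<subseteq> (\<lambda>x. (s x, b x)) ` X"
      proof
        fix p assume p: "p \<in> A \<times> B"
        then have "fst p \<in> s ` {x \<in> X. b x = snd p}"
          using r by (auto simp: bij_betw_def)
        then obtain x where "x \<in> X" "b x = snd p" "fst p = s x" by blast
        then show "p \<in> (\<lambda>x. (s x, b x)) ` X"
          by (intro image_eqI[of _ _ x]) (auto simp: prod_eq_iff)
      qed
    qed (use r in auto)
  qed
qed

lemma bij_betw_pair_swapI:
  assumes "bij_betw (\<lambda>x. (f x, h x)) X (A \<times> B)"
  shows "bij_betw (\<lambda>x. (h x, f x)) X (B \<times> A)"
proof -
  have "bij_betw prod.swap (A \<times> B) (B \<times> A)"
    by (auto simp: bij_betw_def inj_on_def)
  from bij_betw_trans[OF assms this] show ?thesis by (simp add: comp_def)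
qed

lemma finite_common_coordinate:
  assumes "finite A" "finite B"
    and ab: "bij_betw (\<lambda>x. (a x, b x)) X (A \<times> B)" and ab': "bij_betw (\<lambda>x. (a' x, b' x)) X (A \<times> B)"
  shows "\<exists>s. bij_betw (\<lambda>x. (s x, b x)) X (A \<times> B) \<and> bij_betw (\<lambda>x. (s x, b' x)) X (A \<times> B)"
proof -
  have r: "b \<in> X \<rightarrow> B" "b' \<in> X \<rightarrow> B"
    "\<And>y. y \<in> B \<Longrightarrow> bij_betw a {x \<in> X. b x = y} A" "\<And>y. y \<in> B \<Longrightarrow> bij_betw a' {x \<in> X. b' x = y} A"
    using ab ab' unfolding bij_betw_pair_iff by auto
  have "finite X"
    using bij_betw_finite[OF ab] assms(1,2) by simp
  then have "\<exists>s. \<forall>y\<in>B. bij_betw s {x \<in> X. b x = y} {..<card A} \<and>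
      bij_betw s {x \<in> X. b' x = y} {..<card A}"
    using r bij_betw_same_card by (intro regular_bipartite_coloring) (use assms(2) in blast)+
  then obtain s where s: "\<And>y. y \<in> B \<Longrightarrow> bij_betw s {x \<in> X. b x = y} {..<card A}"
      "\<And>y. y \<in> B \<Longrightarrow> bij_betw s {x \<in> X. b' x = y} {..<card A}"
    by blast
  obtain e where e: "bij_betw e {..<card A} A"
    using ex_bij_betw_nat_finite[OF assms(1)] atLeast0LessThan by metis
  have es: "\<And>y. y \<in> B \<Longrightarrow> bij_betw (e \<circ> s) {x \<in> X. b x = y} A"
      "\<And>y. y \<in> B \<Longrightarrow> bij_betw (e \<circ> s) {x \<in> X. b' x = y} A"
    using s e bij_betw_trans by blast+
  then have "e (s x) \<in> A" if "x \<in> X" for x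
    using that r(1) by (fastforce simp: bij_betw_def)
  then have "bij_betw (\<lambda>x. ((e \<circ> s) x, b x)) X (A \<times> B) \<and> bij_betw (\<lambda>x. ((e \<circ> s) x, b' x)) X (A \<times> B)"
    unfolding bij_betw_pair_iff using es r by (auto simp: comp_def)
  then show ?thesis by blast
qed

section \<open>Back-and-forth for two infinite factors\<close>

text \<open>Elements of \<open>Z\<close> are candidates, and every key has to enumerate
  \<open>Y\<close> without repetition. The demands \<open>(k, y)\<close> are listed in one sequence
  and met one at a time by finite sets on which all keys are injective; injectivity passes to the
  increasing union.\<close>

lemma back_and_forth:
  fixes K :: "('z \<Rightarrow> 'y) set"
  assumes K: "countable K" and Y: "countable Y" and KZ: "\<And>k. k \<in> K \<Longrightarrow> k \<in> Z \<rightarrow> Y"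
    and ext: "\<And>E k y. \<lbrakk>finite E; E \<subseteq> Z; k \<in> K; y \<in> Y; y \<notin> k ` E\<rbrakk> \<Longrightarrow>
      \<exists>z\<in>Z. k z = y \<and> (\<forall>j\<in>K. j z \<notin> j ` E)"
  shows "\<exists>E\<subseteq>Z. \<forall>k\<in>K. bij_betw k E Y"
proof (cases "K \<times> Y = {}")
  case True
  then show ?thesis by (intro exI[of _ "{}"]) (auto simp: bij_betw_def)
next
  case False
  \<comment> \<open>The enumeration may repeat demands, which also covers finite
    \<open>K \<times> Y\<close>; a demand already met leaves the stage unchanged.\<close>
  define r where "r = from_nat_into (K \<times> Y)"
  have r: "range r = K \<times> Y"
    unfolding r_def using False K Y by (intro range_from_nat_into) auto
  have r_in: "fst (r n) \<in> K" "snd (r n) \<in> Y" for n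
    using r by (metis mem_Times_iff rangeI)+
  have "\<exists>E. \<forall>n. (finite (E n) \<and> E n \<subseteq> Z \<and> (\<forall>k\<in>K. inj_on k (E n))) \<and>
      (E n \<subseteq> E (Suc n) \<and> snd (r n) \<in> fst (r n) ` E (Suc n))"
  proof (rule dependent_nat_choice)
    show "\<exists>E. finite E \<and> E \<subseteq> Z \<and> (\<forall>k\<in>K. inj_on k E)"
      by (rule exI[of _ "{}"]) simp
    fix E n assume E: "finite E \<and> E \<subseteq> Z \<and> (\<forall>k\<in>K. inj_on k E)"
    show "\<exists>E'. (finite E' \<and> E' \<subseteq> Z \<and> (\<forall>k\<in>K. inj_on k E')) \<and>
        (E \<subseteq> E' \<and> snd (r n) \<in> fst (r n) ` E')"
    proof (cases "snd (r n) \<in> fst (r n) ` E")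
      case True
      then show ?thesis using E by blast
    next
      case False
      then obtain z where "z \<in> Z" "fst (r n) z = snd (r n)" "\<forall>j\<in>K. j z \<notin> j ` E"
        using ext[of E "fst (r n)" "snd (r n)"] E r_in by blast
      then show ?thesis
        using E by (intro exI[of _ "insert z E"]) auto
    qed
  qed
  then obtain E where E: "\<And>n. E n \<subseteq> Z" "\<And>n k. k \<in> K \<Longrightarrow> inj_on k (E n)"
      "\<And>n. E n \<subseteq> E (Suc n)" "\<And>n. snd (r n) \<in> fst (r n) ` E (Suc n)"
    by blast
  have mono: "E m \<subseteq> E n" if "m \<le> n" for m n
    using that E(3) by (rule lift_Suc_mono_le[rotated])
  have "bij_betw k (\<Union>(range E)) Y" if k: "k \<in> K" for k
    unfolding bij_betw_def
  proof
    show "inj_on k (\<Union>(range E))"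
    proof (rule inj_onI)
      fix z w assume zw: "z \<in> \<Union>(range E)" "w \<in> \<Union>(range E)" "k z = k w"
      then obtain m n where "z \<in> E m" "w \<in> E n" by blast
      then have "z \<in> E (max m n)" "w \<in> E (max m n)"
        using mono[of m "max m n"] mono[of n "max m n"] by auto
      then show "z = w" using E(2)[OF k] zw(3) by (auto dest: inj_onD)
    qed
    show "k ` \<Union>(range E) = Y"
    proof
      show "k ` \<Union>(range E) \<subseteq> Y" using KZ[OF k] E(1) by auto
      show "Y \<subseteq> k ` \<Union>(range E)"
      proof
        fix y assume "y \<in> Y"
        then obtain n where "r n = (k, y)" using r k by (metis SigmaI imageE)
        then show "y \<in> k ` \<Union>(range E)" using E(4)[of n] by auto
      qed
    qed
  qed
  then show ?thesis using E(1) by (intro exI[of _ "\<Union>(range E)"]) auto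
qed

text \<open>
  A triple \<open>(x, u, v)\<close> prescribes the new coordinates \<open>f x = u\<close> and \<open>h x = v\<close>. The four keys say that
  every \<open>x\<close> is assigned exactly once and that \<open>(a, h)\<close>, \<open>(f, h)\<close>, \<open>(f, b')\<close> are bijective. The
  hypothesis \<open>spread\<close> is what is needed to realise a missing value of \<open>(f, h)\<close>.
\<close>

lemma common_coordinates_back_and_forth:
  fixes a a' :: "'x \<Rightarrow> 'p" and b b' :: "'x \<Rightarrow> 'q"
  assumes cA: "countable A" and cB: "countable B" and iA: "infinite A" and iB: "infinite B"
    and ab: "bij_betw (\<lambda>x. (a x, b x)) X (A \<times> B)" and ab': "bij_betw (\<lambda>x. (a' x, b' x)) X (A \<times> B)"
    and spread: "\<And>F G. finite F \<Longrightarrow> finite G \<Longrightarrow> \<exists>x\<in>X. a x \<notin> F \<and> b' x \<notin> G"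
  shows "\<exists>f h. bij_betw (\<lambda>x. (a x, h x)) X (A \<times> B) \<and> bij_betw (\<lambda>x. (f x, h x)) X (A \<times> B) \<and>
    bij_betw (\<lambda>x. (f x, b' x)) X (A \<times> B)"
proof -
  define k1 where "k1 = (\<lambda>(x, u :: 'p, v :: 'q). (a x, b x))"
  define k2 where "k2 = (\<lambda>(x, u :: 'p, v :: 'q). (a x, v))"
  define k3 where "k3 = (\<lambda>(x :: 'x, u :: 'p, v :: 'q). (u, v))"
  define k4 where "k4 = (\<lambda>(x, u :: 'p, v :: 'q). (u, b' x))"
  note k_defs = k1_def k2_def k3_def k4_def
  let ?Z = "X \<times> A \<times> B" and ?K = "{k1, k2, k3, k4}"
  have ran: "a x \<in> A" "b x \<in> B" "b' x \<in> B" if "x \<in> X" for x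
    using ab ab' that by (auto simp: bij_betw_def)
  have inf_a: "infinite {x \<in> X. a x = u}" if "u \<in> A" for u
  proof -
    have "bij_betw b {x \<in> X. a x = u} B"
      using bij_betw_pair_swapI[OF ab] that unfolding bij_betw_pair_iff by blast
    then show ?thesis using iB bij_betw_finite by auto
  qed
  have inf_b': "infinite {x \<in> X. b' x = v}" if "v \<in> B" for v
  proof -
    have "bij_betw a' {x \<in> X. b' x = v} A"
      using ab' that unfolding bij_betw_pair_iff by blast
    then show ?thesis using iA bij_betw_finite by auto
  qed
  have "\<exists>E\<subseteq>?Z. \<forall>k\<in>?K. bij_betw k E (A \<times> B)"
  proof (rule back_and_forth)
    fix E k y
    assume E: "finite E" "E \<subseteq> ?Z" and k: "k \<in> ?K" and y: "y \<in> A \<times> B" "y \<notin> k ` E"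
    have fin: "finite (fst ` E)" "finite ((fst \<circ> snd) ` E)" "finite ((snd \<circ> snd) ` E)"
      using E(1) by simp_all
    obtain u0 where u0: "u0 \<in> A" "u0 \<notin> (fst \<circ> snd) ` E"
      using infinite_imp_nonempty[OF Diff_infinite_finite[OF fin(2) iA]] by blast
    obtain v0 where v0: "v0 \<in> B" "v0 \<notin> (snd \<circ> snd) ` E"
      using infinite_imp_nonempty[OF Diff_infinite_finite[OF fin(3) iB]] by blast
    obtain p q where pq: "y = (p, q)" "p \<in> A" "q \<in> B" using y(1) by auto
    have u0': "(x, u0, v) \<notin> E" and v0': "(x, u, v0) \<notin> E" for x u v
      using u0 v0 by force+
    have inj: "x = w" if "x \<in> X" "w \<in> X" "a x = a w" "b x = b w" for x w
      using ab that by (auto simp: bij_betw_def dest: inj_onD)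
    have k1: "k1 (x, u, v) \<notin> k1 ` E" if "x \<in> X" "x \<notin> fst ` E" for x u v
    proof
      assume "k1 (x, u, v) \<in> k1 ` E"
      then obtain w u' v' where w: "(w, u', v') \<in> E" "a x = a w" "b x = b w"
        by (auto simp: k1_def)
      then have "x = w" using inj that(1) E(2) by blast
      then show False using w(1) that(2) by force
    qed
    have k2: "k2 (x, u, v0) \<notin> k2 ` E" and k3: "k3 (x, u0, v) \<notin> k3 ` E" "k3 (x, u, v0) \<notin> k3 ` E"
      and k4: "k4 (x, u0, v) \<notin> k4 ` E" for x u v
      using u0' v0' by (auto simp: k_defs)
    have k2': "k2 (x, u, v) \<notin> k2 ` E" if "a x \<notin> a ` fst ` E" for x u v
      using that by (force simp: k2_def)
    have k4': "k4 (x, u, v) \<notin> k4 ` E" if "b' x \<notin> b' ` fst ` E" for x u v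
      using that by (force simp: k4_def)
    consider "k = k1" | "k = k2" | "k = k3" | "k = k4" using k by blast
    then show "\<exists>z\<in>?Z. k z = y \<and> (\<forall>j\<in>?K. j z \<notin> j ` E)"
    proof cases
      case 1
      have "y \<in> (\<lambda>x. (a x, b x)) ` X"
        using ab y(1) by (simp add: bij_betw_def)
      then obtain x where x: "x \<in> X" "y = (a x, b x)" by blast
      then have z: "k (x, u0, v0) = y" using 1 by (simp add: k1_def)
      then have "k1 (x, u0, v0) \<notin> k1 ` E" using y(2) 1 by simp
      with z show ?thesis
        using x(1) u0(1) v0(1) k2 k3 k4 by (intro bexI[of _ "(x, u0, v0)"]) simp_all
    next
      case 2
      obtain x where x: "x \<in> X" "a x = p" "x \<notin> fst ` E"
        using infinite_imp_nonempty[OF Diff_infinite_finite[OF fin(1) inf_a[OF pq(2)]]] by blast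
      then have z: "k (x, u0, q) = y" using 2 pq(1) by (simp add: k2_def)
      then have "k2 (x, u0, q) \<notin> k2 ` E" using y(2) 2 by simp
      with z show ?thesis
        using x u0(1) pq(3) k1 k3 k4 by (intro bexI[of _ "(x, u0, q)"]) simp_all
    next
      case 3
      \<comment> \<open>Both new values are prescribed here, so \<open>x\<close> alone must make
        \<open>k1\<close>, \<open>k2\<close> and \<open>k4\<close> new: \<open>a x\<close> and
        \<open>b' x\<close> have to avoid everything used so far.\<close>
      obtain x where x: "x \<in> X" "a x \<notin> a ` fst ` E" "b' x \<notin> b' ` fst ` E"
        using spread[of "a ` fst ` E" "b' ` fst ` E"] fin by blast
      have z: "k (x, p, q) = y" using 3 pq(1) by (simp add: k3_def)
      then have "k3 (x, p, q) \<notin> k3 ` E" using y(2) 3 by simp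
      moreover have "x \<notin> fst ` E" using x(2) by blast
      ultimately show ?thesis
        using z x(1) pq(2,3) k1 k2'[OF x(2)] k4'[OF x(3)] by (intro bexI[of _ "(x, p, q)"]) simp_all
    next
      case 4
      obtain x where x: "x \<in> X" "b' x = q" "x \<notin> fst ` E"
        using infinite_imp_nonempty[OF Diff_infinite_finite[OF fin(1) inf_b'[OF pq(3)]]] by blast
      then have z: "k (x, p, v0) = y" using 4 pq(1) by (simp add: k4_def)
      then have "k4 (x, p, v0) \<notin> k4 ` E" using y(2) 4 by simp
      with z show ?thesis
        using x v0(1) pq(2) k1 k2 k3 by (intro bexI[of _ "(x, p, v0)"]) simp_all
    qed
  qed (use cA cB ran in \<open>auto simp: k_defs\<close>)
  then obtain E where E: "E \<subseteq> ?Z" "bij_betw k1 E (A \<times> B)" "bij_betw k2 E (A \<times> B)"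
      "bij_betw k3 E (A \<times> B)" "bij_betw k4 E (A \<times> B)"
    by auto
  \<comment> \<open>Since \<open>k1\<close> is bijective on \<open>E\<close>, each \<open>x\<close>
    occurs in exactly one triple; \<open>c x\<close> is that triple, and its other entries are the
    new coordinates of \<open>x\<close>.\<close>
  define c where "c = inv_into E k1 \<circ> (\<lambda>x. (a x, b x))"
  have c: "bij_betw c X E"
    unfolding c_def using ab bij_betw_inv_into[OF E(2)] by (rule bij_betw_trans)
  have fst_c: "fst (c x) = x" if "x \<in> X" for x
  proof -
    have "c x \<in> E" using c that by (auto simp: bij_betw_def)
    moreover have "k1 (c x) = (a x, b x)"
      unfolding c_def comp_def using ran that E(2) by (intro f_inv_into_f) (auto simp: bij_betw_def)
    ultimately show ?thesis
      using ab E(1) that by (auto simp: k1_def bij_betw_def dest: inj_onD split: prod.splits)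
  qed
  have *: "bij_betw (\<lambda>x. k (c x)) X (A \<times> B)" if "bij_betw k E (A \<times> B)" for k
    using bij_betw_trans[OF c that] by (simp add: comp_def)
  let ?f = "\<lambda>x. fst (snd (c x))" and ?h = "\<lambda>x. snd (snd (c x))"
  have "bij_betw (\<lambda>x. (a x, ?h x)) X (A \<times> B)"
    by (rule bij_betw_cong[THEN iffD1, OF _ *[OF E(3)]]) (simp add: k2_def fst_c case_prod_unfold)
  moreover have "bij_betw (\<lambda>x. (?f x, ?h x)) X (A \<times> B)"
    by (rule bij_betw_cong[THEN iffD1, OF _ *[OF E(4)]]) (simp add: k3_def fst_c case_prod_unfold)
  moreover have "bij_betw (\<lambda>x. (?f x, b' x)) X (A \<times> B)"
    by (rule bij_betw_cong[THEN iffD1, OF _ *[OF E(5)]]) (simp add: k4_def fst_c case_prod_unfold)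
  ultimately show ?thesis
    by (intro exI[of _ ?f] exI[of _ ?h] conjI)
qed


section \<open>One finite and one infinite factor\<close>

text \<open>A greedy choice suffices: the state pairs the finite set of values used so far with the
  latest one, and an infinite set always offers a value outside it.\<close>

lemma infinite_distinct_representatives:
  fixes S :: "nat \<Rightarrow> 'y set"
  assumes "\<And>n. infinite (S n)"
  shows "\<exists>y. inj y \<and> (\<forall>n. y n \<in> S n)"
proof -
  have "\<exists>p. \<forall>n. (finite (fst (p n)) \<and> snd (p n) \<in> fst (p n) \<and> snd (p n) \<in> S n) \<and>
      (fst (p n) \<subseteq> fst (p (Suc n)) \<and> snd (p (Suc n)) \<notin> fst (p n))"
  proof (rule dependent_nat_choice)
    obtain v where "v \<in> S 0"
      using assms[of 0] by (metis ex_in_conv finite.emptyI)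
    then show "\<exists>p. finite (fst p) \<and> snd p \<in> fst p \<and> snd p \<in> S 0"
      by (intro exI[of _ "({v}, v)"]) simp
    fix p :: "'y set \<times> 'y" and n
    assume p: "finite (fst p) \<and> snd p \<in> fst p \<and> snd p \<in> S n"
    obtain v where "v \<in> S (Suc n)" "v \<notin> fst p"
      using infinite_imp_nonempty[OF Diff_infinite_finite[OF _ assms]] p by blast
    then show "\<exists>q. (finite (fst q) \<and> snd q \<in> fst q \<and> snd q \<in> S (Suc n)) \<and>
        (fst p \<subseteq> fst q \<and> snd q \<notin> fst p)"
      using p by (intro exI[of _ "(insert v (fst p), v)"]) auto
  qed
  then obtain p where p: "\<And>n. snd (p n) \<in> fst (p n)" "\<And>n. snd (p n) \<in> S n"
      "\<And>n. fst (p n) \<subseteq> fst (p (Suc n))" "\<And>n. snd (p (Suc n)) \<notin> fst (p n)"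
    by blast
  have mono: "fst (p m) \<subseteq> fst (p n)" if "m \<le> n" for m n
    using that p(3) by (rule lift_Suc_mono_le[of "\<lambda>n. fst (p n)", rotated])
  have "snd (p m) \<noteq> snd (p n)" if "m < n" for m n
  proof -
    obtain k where k: "n = Suc k" "m \<le> k" using \<open>m < n\<close> by (cases n) auto
    then show ?thesis using mono[OF k(2)] p(1)[of m] p(4)[of k] by auto
  qed
  then have "inj (\<lambda>n. snd (p n))"
    by (metis linorder_injI)
  then show ?thesis using p(2) by (intro exI[of _ "\<lambda>n. snd (p n)"]) simp
qed

lemma countable_infinite_bij_betw:
  assumes "countable S" "infinite S" "countable T" "infinite T"
  shows "\<exists>f. bij_betw f S T"
  using bij_betw_trans[OF to_nat_on_infinite[OF assms(1,2)] bij_betw_from_nat_into[OF assms(3,4)]]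
  by blast

lemma add_mod_left_cancel:
  fixes c i j m :: nat
  assumes "(c + i) mod m = (c + j) mod m" "i < m" "j < m"
  shows "i = j"
proof -
  \<comment> \<open>Only one inequality is shown, because subtraction on \<open>nat\<close>
    truncates; the other follows by exchanging the arguments.\<close>
  have *: "k \<le> l" if "(c + l) mod m = (c + k) mod m" "k < m" "l < m" for k l
  proof (rule ccontr)
    assume "\<not> k \<le> l"
    then have "m dvd k - l"
      using mod_eq_dvd_iff_nat[of "c + l" "c + k" m] that(1) by simp
    then show False
      using \<open>\<not> k \<le> l\<close> that(2) by (auto dest: dvd_imp_le)
  qed
  show ?thesis
    using *[of j i] *[of i j] assms by simp
qed

text \<open>The Latin square \<open>i + j mod card A\<close> distributes the cells \<open>p = i, q = j\<close> over \<open>B\<close>.\<close>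

lemma common_complementary_coordinate:
  assumes A: "finite A" and B: "countable B" "infinite B" and X: "countable X"
    and pq: "p \<in> X \<rightarrow> A" "q \<in> X \<rightarrow> A"
    and cells: "\<And>i j. i \<in> A \<Longrightarrow> j \<in> A \<Longrightarrow> infinite {x \<in> X. p x = i \<and> q x = j}"
  shows "\<exists>h. bij_betw (\<lambda>x. (p x, h x)) X (A \<times> B) \<and> bij_betw (\<lambda>x. (q x, h x)) X (A \<times> B)"
proof (cases "A = {}")
  case True
  then have "X = {}" using pq by auto
  then show ?thesis using True by (simp add: bij_betw_def)
next
  case False
  let ?m = "card A"
  have m: "?m > 0" using A False by (simp add: card_gt_0_iff)
  obtain e where e: "bij_betw e A {..<?m}"
    using ex_bij_betw_finite_nat[OF A] atLeast0LessThan by metis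
  have "infinite ({..<?m} \<times> (UNIV :: nat set))"
    using m by (auto simp: finite_cartesian_product_iff)
  then obtain \<phi> where \<phi>: "bij_betw \<phi> ({..<?m} \<times> (UNIV :: nat set)) B"
    using countable_infinite_bij_betw B by (metis countableI_type)
  \<comment> \<open>Numbers each cell separately by the natural numbers; the cell is the one that
    contains \<open>x\<close>.\<close>
  define \<nu> where "\<nu> x = to_nat_on {w \<in> X. p w = p x \<and> q w = q x} x" for x
  have \<nu>: "bij_betw \<nu> {x \<in> X. p x = i \<and> q x = j} UNIV" if "i \<in> A" "j \<in> A" for i j
  proof -
    have "bij_betw (to_nat_on {x \<in> X. p x = i \<and> q x = j}) {x \<in> X. p x = i \<and> q x = j} UNIV"
      using cells[OF that] by (intro to_nat_on_infinite countable_subset[OF _ X]) auto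
    then show ?thesis
      by (rule bij_betw_cong[THEN iffD1, rotated]) (auto simp: \<nu>_def)
  qed
  have e_lt: "e i < ?m" if "i \<in> A" for i
    using e that by (auto simp: bij_betw_def)
  \<comment> \<open>Stated for a pair \<open>(r, s)\<close> so that it serves for
    \<open>(p, q)\<close> and \<open>(q, p)\<close>: the sum is symmetric and the cells are the
    same. In the row \<open>r x = i\<close> each residue belongs to exactly one cell, so residue and
    \<open>\<nu>\<close> together are a bijective label.\<close>
  have half: "bij_betw (\<lambda>x. (r x, \<phi> ((e (r x) + e (s x)) mod ?m, \<nu> x))) X (A \<times> B)"
    if r: "r \<in> X \<rightarrow> A" and s: "s \<in> X \<rightarrow> A"
      and \<nu>: "\<And>i j. i \<in> A \<Longrightarrow> j \<in> A \<Longrightarrow> bij_betw \<nu> {x \<in> X. r x = i \<and> s x = j} UNIV" for r s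
  proof -
    have "bij_betw (\<lambda>x. \<phi> ((e (r x) + e (s x)) mod ?m, \<nu> x)) {x \<in> X. r x = i} B" if i: "i \<in> A" for i
    proof -
      let ?l = "\<lambda>x. (e (r x) + e (s x)) mod ?m"
      have "bij_betw \<nu> {x \<in> {x \<in> X. r x = i}. ?l x = k} UNIV" if k: "k < ?m" for k
      proof -
        \<comment> \<open>The residue of \<open>k - e i\<close>, written with
          \<open>?m - e i\<close> to avoid truncated subtraction; it is the label of the column that
          carries residue \<open>k\<close> in row \<open>i\<close>.\<close>
        let ?k = "(k + (?m - e i)) mod ?m"
        have "?k \<in> e ` A"
          using e m by (auto simp: bij_betw_def)
        then obtain j where j: "j \<in> A" "e j = ?k" by auto
        have "(e i + e j) mod ?m = (e i + (k + (?m - e i))) mod ?m"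
          unfolding j(2) by (simp add: mod_add_right_eq)
        also have "e i + (k + (?m - e i)) = k + ?m"
          using e_lt[OF i] by simp
        finally have ij: "(e i + e j) mod ?m = k"
          using k by simp
        have uniq: "j' = j" if "j' \<in> A" "(e i + e j') mod ?m = k" for j'
        proof -
          have "e j' = e j"
            using add_mod_left_cancel[of "e i" "e j'" ?m "e j"] ij that(2) e_lt[OF j(1)] e_lt[OF that(1)]
            by simp
          then show ?thesis
            using e j(1) that(1) by (auto simp: bij_betw_def dest: inj_onD)
        qed
        have "{x \<in> {x \<in> X. r x = i}. ?l x = k} = {x \<in> X. r x = i \<and> s x = j}"
          using ij uniq s by auto
        then show ?thesis using \<nu>[OF i j(1)] by simp
      qed
      then have "bij_betw (\<lambda>x. (\<nu> x, ?l x)) {x \<in> X. r x = i} (UNIV \<times> {..<?m})"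
        unfolding bij_betw_pair_iff using m by auto
      then have "bij_betw (\<lambda>x. (?l x, \<nu> x)) {x \<in> X. r x = i} ({..<?m} \<times> UNIV)"
        by (rule bij_betw_pair_swapI)
      from bij_betw_trans[OF this \<phi>] show ?thesis by (simp add: comp_def)
    qed
    note fibers = this
    have "\<phi> ((e (r x) + e (s x)) mod ?m, \<nu> x) \<in> B" if "x \<in> X" for x
      using \<phi> m by (auto simp: bij_betw_def)
    then have "bij_betw (\<lambda>x. (\<phi> ((e (r x) + e (s x)) mod ?m, \<nu> x), r x)) X (B \<times> A)"
      unfolding bij_betw_pair_iff using fibers r by auto
    then show ?thesis by (rule bij_betw_pair_swapI)
  qed
  have "bij_betw \<nu> {x \<in> X. q x = i \<and> p x = j} UNIV" if "i \<in> A" "j \<in> A" for i j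
    using \<nu>[OF that(2,1)] by (simp add: conj_commute)
  then have "bij_betw (\<lambda>x. (q x, \<phi> ((e (q x) + e (p x)) mod ?m, \<nu> x))) X (A \<times> B)"
    using half pq by blast
  then show ?thesis
    using half[OF pq \<nu>] by (auto simp: add.commute)
qed

text \<open>A transposition of the target corrects a single value.\<close>

lemma bij_betw_prescribed_value:
  assumes "bij_betw c F A" "x \<in> F" "u \<in> A"
  shows "\<exists>c. bij_betw c F A \<and> c x = u"
proof -
  have "bij_betw (transpose (c x) u) A A"
    using assms by (intro bij_betw_transpose_iff) (auto simp: bij_betw_def)
  then have "bij_betw (transpose (c x) u \<circ> c) F A"
    using assms(1) bij_betw_trans by blast
  then show ?thesis by (intro exI[of _ "transpose (c x) u \<circ> c"]) simp
qed

text \<open>It suffices to find \<open>f\<close> complementary to \<open>b'\<close> for which all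
  cells \<open>a = i\<close>, \<open>f = j\<close> are infinite; the Latin square then gives
  \<open>h\<close>. The freedom lies in the finite fibres of \<open>b'\<close>, each of which may be
  numbered by \<open>A\<close> at will. A sequence of fibres, each fixing the value of
  \<open>f\<close> at one point, fills every cell.\<close>

lemma common_coordinates_half_finite:
  assumes A: "finite A" and B: "countable B" "infinite B"
    and ab: "bij_betw (\<lambda>x. (a x, b x)) X (A \<times> B)" and ab': "bij_betw (\<lambda>x. (a' x, b' x)) X (A \<times> B)"
  shows "\<exists>f h. bij_betw (\<lambda>x. (a x, h x)) X (A \<times> B) \<and> bij_betw (\<lambda>x. (f x, h x)) X (A \<times> B) \<and>
    bij_betw (\<lambda>x. (f x, b' x)) X (A \<times> B)"
proof (cases "A = {}")
  case True
  then show ?thesis using ab by (simp add: bij_betw_def)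
next
  case False
  have ran: "a \<in> X \<rightarrow> A" "b' \<in> X \<rightarrow> B"
    using ab ab' unfolding bij_betw_pair_iff by auto
  have fib: "bij_betw a' {x \<in> X. b' x = v} A" if "v \<in> B" for v
    using ab' that unfolding bij_betw_pair_iff by blast
  \<comment> \<open>A row is infinite while every fibre of \<open>b'\<close> is finite, so the row
    meets infinitely many fibres.\<close>
  have infS: "infinite (b' ` {x \<in> X. a x = u})" if "u \<in> A" for u
  proof
    assume fin: "finite (b' ` {x \<in> X. a x = u})"
    have "bij_betw b {x \<in> X. a x = u} B"
      using bij_betw_pair_swapI[OF ab] that unfolding bij_betw_pair_iff by blast
    then have "infinite {x \<in> X. a x = u}"
      using B(2) bij_betw_finite by auto
    then obtain w where w: "w \<in> {x \<in> X. a x = u}"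
        "infinite {x \<in> {x \<in> X. a x = u}. b' x = b' w}"
      using pigeonhole_infinite[OF _ fin] by blast
    have "finite {x \<in> X. b' x = b' w}"
      using bij_betw_finite[OF fib[of "b' w"]] A w(1) ran by auto
    moreover have "{x \<in> {x \<in> X. a x = u}. b' x = b' w} \<subseteq> {x \<in> X. b' x = b' w}"
      by blast
    ultimately show False
      using w(2) finite_subset by blast
  qed
  \<comment> \<open>A sequence of demands in which every pair of \<open>A \<times> A\<close> recurs
    infinitely often, since \<open>prod_decode\<close> takes each first component infinitely
    often.\<close>
  define t where "t n = from_nat_into (A \<times> A) (fst (prod_decode n))" for n
  have t_range: "range (from_nat_into (A \<times> A)) = A \<times> A"
    using A False by (intro range_from_nat_into) (auto simp: countable_finite)
  have t_in: "t n \<in> A \<times> A" for n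
    using t_range unfolding t_def by blast
  have t_inf: "infinite {n. t n = p}" if "p \<in> A \<times> A" for p
  proof -
    obtain i where i: "from_nat_into (A \<times> A) i = p"
      using t_range \<open>p \<in> A \<times> A\<close> by (metis imageE)
    have "inj (\<lambda>j. prod_encode (i, j))"
      by (auto simp: inj_def)
    then have "infinite (range (\<lambda>j. prod_encode (i, j)))"
      by (simp add: finite_image_iff)
    moreover have "range (\<lambda>j. prod_encode (i, j)) \<subseteq> {n. t n = p}"
      using i by (auto simp: t_def)
    ultimately show ?thesis using finite_subset by blast
  qed
  have "\<exists>y. inj y \<and> (\<forall>n. y n \<in> b' ` {x \<in> X. a x = fst (t n)})"
  proof (rule infinite_distinct_representatives)
    show "infinite (b' ` {x \<in> X. a x = fst (t n)})" for n
      by (rule infS) (use t_in[of n] in \<open>simp add: mem_Times_iff\<close>)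
  qed
  then obtain y where y: "inj y" "\<And>n. y n \<in> b' ` {x \<in> X. a x = fst (t n)}"
    by blast
  have "\<forall>n. \<exists>x. x \<in> X \<and> a x = fst (t n) \<and> b' x = y n"
  proof
    show "\<exists>x. x \<in> X \<and> a x = fst (t n) \<and> b' x = y n" for n
      using y(2)[of n] by auto
  qed
  then obtain z where z: "\<And>n. z n \<in> X" "\<And>n. a (z n) = fst (t n)" "\<And>n. b' (z n) = y n"
    by metis
  \<comment> \<open>Injectivity of \<open>y\<close> ensures that no fibre carries two demands, so
    one prescribed value per fibre is enough.\<close>
  have "\<exists>c. bij_betw c {x \<in> X. b' x = v} A \<and> (\<forall>n. y n = v \<longrightarrow> c (z n) = snd (t n))"
    if v: "v \<in> B" for v
  proof (cases "v \<in> range y")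
    case True
    then obtain n where n: "y n = v" by blast
    obtain c where c: "bij_betw c {x \<in> X. b' x = v} A" "c (z n) = snd (t n)"
      using bij_betw_prescribed_value[OF fib[OF v], of "z n" "snd (t n)"] z n t_in[of n]
      by (auto simp: mem_Times_iff)
    moreover have "k = n" if "y k = v" for k
      using that n y(1) by (auto dest: injD)
    ultimately show ?thesis by blast
  next
    case False
    then show ?thesis using fib[OF v] by blast
  qed
  then obtain c where c: "\<And>v. v \<in> B \<Longrightarrow> bij_betw (c v) {x \<in> X. b' x = v} A"
      "\<And>n. y n \<in> B \<Longrightarrow> c (y n) (z n) = snd (t n)"
    by metis
  define f where "f x = c (b' x) x" for x
  have f_fib: "bij_betw f {x \<in> X. b' x = v} A" if "v \<in> B" for v
    using c(1)[OF that] by (rule bij_betw_cong[THEN iffD1, rotated]) (simp add: f_def)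
  have f_ran: "f \<in> X \<rightarrow> A"
    using f_fib ran(2) by (fastforce simp: bij_betw_def)
  have fb': "bij_betw (\<lambda>x. (f x, b' x)) X (A \<times> B)"
    unfolding bij_betw_pair_iff using f_fib f_ran ran(2) by auto
  have cells: "infinite {x \<in> X. a x = i \<and> f x = j}" if "i \<in> A" "j \<in> A" for i j
  proof -
    have "inj z"
      using y(1) z(3) by (metis injD injI)
    then have "infinite (z ` {n. t n = (i, j)})"
      using t_inf[of "(i, j)"] that by (simp add: finite_image_iff inj_on_subset[OF _ subset_UNIV])
    moreover have "y n \<in> B" for n
      using z ran(2) by (metis PiE)
    then have "z ` {n. t n = (i, j)} \<subseteq> {x \<in> X. a x = i \<and> f x = j}"
      using z c(2) by (auto simp: f_def)
    ultimately show ?thesis using finite_subset by blast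
  qed
  have "countable X"
    by (rule countable_image_inj_on[OF _ bij_betw_imp_inj_on[OF ab]])
      (use A B(1) in \<open>simp add: bij_betw_imp_surj_on[OF ab] countable_finite\<close>)
  then show ?thesis
    using common_complementary_coordinate[OF A B _ ran(1) f_ran cells] fb' by blast
qed

text \<open>
  For infinite \<open>A\<close>, \<open>B\<close>, if \<open>spread\<close> failed for \<open>(a, b')\<close> and for \<open>(b, a')\<close>, then outside finitely many
  rows and columns the map \<open>(a', b')\<close> would take only finitely many values.
\<close>

lemma countable_common_coordinates:
  assumes cA: "countable A" and cB: "countable B"
    and ab: "bij_betw (\<lambda>x. (a x, b x)) X (A \<times> B)" and ab': "bij_betw (\<lambda>x. (a' x, b' x)) X (A \<times> B)"
  shows "(\<exists>f h. bij_betw (\<lambda>x. (a x, h x)) X (A \<times> B) \<and> bij_betw (\<lambda>x. (f x, h x)) X (A \<times> B) \<and>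
      bij_betw (\<lambda>x. (f x, b' x)) X (A \<times> B)) \<or>
    (\<exists>f h. bij_betw (\<lambda>x. (f x, b x)) X (A \<times> B) \<and> bij_betw (\<lambda>x. (f x, h x)) X (A \<times> B) \<and>
      bij_betw (\<lambda>x. (a' x, h x)) X (A \<times> B))" (is "?R \<or> ?L")
proof -
  note ba = bij_betw_pair_swapI[OF ab] and ba' = bij_betw_pair_swapI[OF ab']
  \<comment> \<open>Exchanging the factors turns the first alternative into the second, with
    \<open>f\<close> and \<open>h\<close> trading places.\<close>
  have L: ?L if "\<exists>f h. bij_betw (\<lambda>x. (b x, h x)) X (B \<times> A) \<and> bij_betw (\<lambda>x. (f x, h x)) X (B \<times> A) \<and>
      bij_betw (\<lambda>x. (f x, a' x)) X (B \<times> A)"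
    using that bij_betw_pair_swapI by blast
  consider "finite A" "finite B" | "finite A" "infinite B" | "infinite A" "finite B"
    | "infinite A" "infinite B" by blast
  then show ?thesis
  proof cases
    case 1
    \<comment> \<open>The second alternative holds with \<open>h = b'\<close>; its last bijection is
      then \<open>ab'\<close>.\<close>
    then show ?thesis using finite_common_coordinate[OF _ _ ab ab'] ab' by blast
  next
    case 2
    then show ?thesis using common_coordinates_half_finite[OF _ cB _ ab ab'] by blast
  next
    case 3
    then show ?thesis using common_coordinates_half_finite[OF _ cA _ ba ba'] L by blast
  next
    case 4
    show ?thesis
    proof (rule ccontr)
      assume no: "\<not> ?thesis"
      have "\<not> (\<forall>F G. finite F \<longrightarrow> finite G \<longrightarrow> (\<exists>x\<in>X. a x \<notin> F \<and> b' x \<notin> G))"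
        using common_coordinates_back_and_forth[OF cA cB 4 ab ab'] no by blast
      then obtain F G where FG: "finite F" "finite G" "\<And>x. x \<in> X \<Longrightarrow> a x \<notin> F \<Longrightarrow> b' x \<in> G"
        by blast
      have "\<not> (\<forall>F G. finite F \<longrightarrow> finite G \<longrightarrow> (\<exists>x\<in>X. b x \<notin> F \<and> a' x \<notin> G))"
        using common_coordinates_back_and_forth[OF cB cA 4(2,1) ba ba'] no L by blast
      then obtain F' G' where FG': "finite F'" "finite G'"
          "\<And>x. x \<in> X \<Longrightarrow> b x \<notin> F' \<Longrightarrow> a' x \<in> G'"
        by blast
      let ?D = "{x \<in> X. a x \<notin> F \<and> b x \<notin> F'}"
      have "(\<lambda>x. (a' x, b' x)) ` ?D \<subseteq> G' \<times> G" "inj_on (\<lambda>x. (a' x, b' x)) ?D"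
        using FG FG' ab' by (auto simp: bij_betw_def intro: inj_on_subset)
      then have "finite ?D"
        using FG FG' by (meson finite_SigmaI inj_on_finite)
      then have "finite ((\<lambda>x. (a x, b x)) ` ?D)" by simp
      moreover have "(A - F) \<times> (B - F') \<subseteq> (\<lambda>x. (a x, b x)) ` ?D"
      proof
        fix p assume p: "p \<in> (A - F) \<times> (B - F')"
        then have "p \<in> (\<lambda>x. (a x, b x)) ` X"
          using ab by (auto simp: bij_betw_def)
        then show "p \<in> (\<lambda>x. (a x, b x)) ` ?D" using p by auto
      qed
      ultimately have "finite ((A - F) \<times> (B - F'))"
        using finite_subset by blast
      moreover have "infinite (A - F)" "infinite (B - F')"
        using 4 FG FG' by simp_all
      ultimately show False
        by (metis finite.emptyI finite_cartesian_product_iff)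
    qed
  qed
qed

section \<open>Finite and countable sets\<close>

lemma sets_category_simps:
  "Ob (sets_category U) = U" "Hom (sets_category U) X Y = X \<rightarrow>\<^sub>E Y"
  "Comp (sets_category U) X Y Z g f = compose X g f" "Ident (sets_category U) X = (\<lambda>x\<in>X. x)"
  by (simp_all add: sets_category_def)

lemma carrier_Aut_sets: "carrier (Aut (sets_category U) X) = {g \<in> X \<rightarrow>\<^sub>E X. bij_betw g X X}"
proof (intro Set.equalityI subsetI)
  fix g assume "g \<in> carrier (Aut (sets_category U) X)"
  then obtain h where g: "g \<in> X \<rightarrow>\<^sub>E X" and h: "h \<in> X \<rightarrow>\<^sub>E X"
      "compose X g h = (\<lambda>x\<in>X. x)" "compose X h g = (\<lambda>x\<in>X. x)"
    by (auto simp: Aut_def sets_category_simps)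
  have "g (h x) = x" "h (g x) = x" if "x \<in> X" for x
    using fun_cong[OF h(2), of x] fun_cong[OF h(3), of x] that by (simp_all add: compose_def)
  then have "bij_betw g X X"
    using g h(1) by (intro bij_betw_byWitness[of _ h]) auto
  then show "g \<in> {g \<in> X \<rightarrow>\<^sub>E X. bij_betw g X X}" using g by simp
next
  fix g assume "g \<in> {g \<in> X \<rightarrow>\<^sub>E X. bij_betw g X X}"
  then have g: "g \<in> X \<rightarrow>\<^sub>E X" "bij_betw g X X" by auto
  let ?h = "\<lambda>x\<in>X. inv_into X g x"
  have "?h \<in> X \<rightarrow>\<^sub>E X"
    using bij_betw_inv_into[OF g(2)] by (auto simp: bij_betw_def)
  moreover have "compose X g ?h = (\<lambda>x\<in>X. x)" "compose X ?h g = (\<lambda>x\<in>X. x)"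
    using g by (auto simp: compose_def fun_eq_iff bij_betw_inv_into_right bij_betw_inv_into_left
        dest: bij_betwE)
  ultimately show "g \<in> carrier (Aut (sets_category U) X)"
    using g(1) unfolding Aut_def sets_category_simps by (simp only: partial_object.simps) blast
qed

text \<open>Points are morphisms from a one-point object. Uniqueness of the pairing gives
  injectivity and existence gives surjectivity, which is why singletons must be objects.\<close>

lemma sets_product_bij:
  assumes U: "\<And>x. {x} \<in> U" and prod: "is_product (sets_category U) A B P \<pi>\<^sub>A \<pi>\<^sub>B"
  shows "bij_betw (\<lambda>x. (\<pi>\<^sub>A x, \<pi>\<^sub>B x)) P (A \<times> B)"
proof -
  interpret product_object "sets_category U" A B P \<pi>\<^sub>A \<pi>\<^sub>B
    using prod by (simp add: product_object_def category_sets_category product_object_axioms_def)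
  have proj: "\<pi>\<^sub>A \<in> P \<rightarrow>\<^sub>E A" "\<pi>\<^sub>B \<in> P \<rightarrow>\<^sub>E B"
    using prod by (auto simp: is_product_def sets_category_simps)
  show ?thesis
    unfolding bij_betw_def
  proof
    show "inj_on (\<lambda>x. (\<pi>\<^sub>A x, \<pi>\<^sub>B x)) P"
    proof (rule inj_onI)
      fix x y assume xy: "x \<in> P" "y \<in> P" "(\<pi>\<^sub>A x, \<pi>\<^sub>B x) = (\<pi>\<^sub>A y, \<pi>\<^sub>B y)"
      have "(\<lambda>z\<in>{x}. x) = (\<lambda>z\<in>{x}. y)"
        by (rule pairing_unique[of "{x}"])
          (use U xy in \<open>auto simp: sets_category_simps compose_def fun_eq_iff\<close>)
      then show "x = y"
        by (metis restrict_apply' singletonI)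
    qed
    show "(\<lambda>x. (\<pi>\<^sub>A x, \<pi>\<^sub>B x)) ` P = A \<times> B"
    proof
      show "A \<times> B \<subseteq> (\<lambda>x. (\<pi>\<^sub>A x, \<pi>\<^sub>B x)) ` P"
      proof
        fix p assume p: "p \<in> A \<times> B"
        let ?x = "undefined :: 'a"
        have "(\<lambda>z\<in>{?x}. fst p) \<in> {?x} \<rightarrow>\<^sub>E A" "(\<lambda>z\<in>{?x}. snd p) \<in> {?x} \<rightarrow>\<^sub>E B"
          using p by auto
        then obtain h where h: "h \<in> {?x} \<rightarrow>\<^sub>E P"
            "compose {?x} \<pi>\<^sub>A h = (\<lambda>z\<in>{?x}. fst p)" "compose {?x} \<pi>\<^sub>B h = (\<lambda>z\<in>{?x}. snd p)"
          using pairing_exists[of "{?x}"] U[of ?x] unfolding sets_category_simps by meson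
        have "\<pi>\<^sub>A (h ?x) = fst p" "\<pi>\<^sub>B (h ?x) = snd p"
          using fun_cong[OF h(2), of ?x] fun_cong[OF h(3), of ?x] by (simp_all add: compose_def)
        moreover have "h ?x \<in> P"
          using h(1) by auto
        ultimately show "p \<in> (\<lambda>x. (\<pi>\<^sub>A x, \<pi>\<^sub>B x)) ` P"
          by (intro image_eqI[of _ _ "h ?x"]) (simp_all add: prod_eq_iff)
      qed
    qed (use proj in auto)
  qed
qed

lemma sets_product_of_bij:
  assumes "A \<in> U" "B \<in> U" "P \<in> U" and proj: "\<pi>\<^sub>A \<in> P \<rightarrow>\<^sub>E A" "\<pi>\<^sub>B \<in> P \<rightarrow>\<^sub>E B"
    and bij: "bij_betw (\<lambda>x. (\<pi>\<^sub>A x, \<pi>\<^sub>B x)) P (A \<times> B)"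
  shows "is_product (sets_category U) A B P \<pi>\<^sub>A \<pi>\<^sub>B"
proof -
  have "\<exists>!h. h \<in> X \<rightarrow>\<^sub>E P \<and> compose X \<pi>\<^sub>A h = f \<and> compose X \<pi>\<^sub>B h = g"
    if f: "f \<in> X \<rightarrow>\<^sub>E A" and g: "g \<in> X \<rightarrow>\<^sub>E B" for X f g
  proof (rule ex_ex1I)
    let ?i = "inv_into P (\<lambda>x. (\<pi>\<^sub>A x, \<pi>\<^sub>B x))"
    let ?h = "\<lambda>x\<in>X. ?i (f x, g x)"
    have i: "?i (f x, g x) \<in> P" "\<pi>\<^sub>A (?i (f x, g x)) = f x" "\<pi>\<^sub>B (?i (f x, g x)) = g x" if "x \<in> X" for x
    proof -
      have "(f x, g x) \<in> A \<times> B" using f g that by auto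
      then show "?i (f x, g x) \<in> P" "\<pi>\<^sub>A (?i (f x, g x)) = f x" "\<pi>\<^sub>B (?i (f x, g x)) = g x"
        using bij_betw_inv_into_right[OF bij, of "(f x, g x)"] bij_betwE[OF bij_betw_inv_into[OF bij]]
        by simp_all
    qed
    have "compose X \<pi>\<^sub>A ?h = restrict f X" "compose X \<pi>\<^sub>B ?h = restrict g X"
      unfolding compose_def by (rule restrict_ext, simp add: i)+
    moreover have "restrict f X = f" "restrict g X = g"
      using f g by (auto intro: extensional_restrict)
    moreover have "?h \<in> X \<rightarrow>\<^sub>E P" using i(1) by simp
    ultimately have "?h \<in> X \<rightarrow>\<^sub>E P \<and> compose X \<pi>\<^sub>A ?h = f \<and> compose X \<pi>\<^sub>B ?h = g" by simp
    then show "\<exists>h. h \<in> X \<rightarrow>\<^sub>E P \<and> compose X \<pi>\<^sub>A h = f \<and> compose X \<pi>\<^sub>B h = g"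
      by (rule exI[of _ ?h])
    fix h k
    assume h: "h \<in> X \<rightarrow>\<^sub>E P \<and> compose X \<pi>\<^sub>A h = f \<and> compose X \<pi>\<^sub>B h = g"
      and k: "k \<in> X \<rightarrow>\<^sub>E P \<and> compose X \<pi>\<^sub>A k = f \<and> compose X \<pi>\<^sub>B k = g"
    have "h x = k x" if "x \<in> X" for x
    proof -
      have "\<pi>\<^sub>A (h x) = \<pi>\<^sub>A (k x)" "\<pi>\<^sub>B (h x) = \<pi>\<^sub>B (k x)"
        using h k that by (metis compose_eq)+
      then show ?thesis
        using bij h k that by (auto simp: bij_betw_def dest: inj_onD)
    qed
    then show "h = k"
      using h k by (intro PiE_ext[of h X "\<lambda>_. P"]) auto
  qed
  then show ?thesis
    using assms unfolding is_product_def sets_category_simps by (intro conjI ballI)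
qed

text \<open>Translates bijections onto the product into automorphisms: follow \<open>(f, h)\<close>
  by the inverse of the pair of projections. The restrictions appear because morphisms are
  \<open>undefined\<close> outside their domain.\<close>

lemma sets_aut_with_coordinates:
  assumes "bij_betw (\<lambda>x. (\<pi>\<^sub>A x, \<pi>\<^sub>B x)) P (A \<times> B)" "bij_betw (\<lambda>x. (f x, h x)) P (A \<times> B)"
  shows "\<exists>u\<in>carrier (Aut (sets_category U) P).
    compose P \<pi>\<^sub>A u = restrict f P \<and> compose P \<pi>\<^sub>B u = restrict h P"
proof -
  let ?i = "inv_into P (\<lambda>x. (\<pi>\<^sub>A x, \<pi>\<^sub>B x))"
  let ?u = "\<lambda>x\<in>P. ?i (f x, h x)"
  have fh: "(f x, h x) \<in> A \<times> B" if "x \<in> P" for x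
    using bij_betwE[OF assms(2)] that by blast
  have "bij_betw (?i \<circ> (\<lambda>x. (f x, h x))) P P"
    using assms(2) bij_betw_inv_into[OF assms(1)] by (rule bij_betw_trans)
  then have "bij_betw ?u P P"
    by (rule bij_betw_cong[THEN iffD1, rotated]) simp
  then have "?u \<in> carrier (Aut (sets_category U) P)"
    unfolding carrier_Aut_sets by (auto simp: bij_betw_def)
  moreover have "\<pi>\<^sub>A (?i (f x, h x)) = f x" "\<pi>\<^sub>B (?i (f x, h x)) = h x" if "x \<in> P" for x
    using bij_betw_inv_into_right[OF assms(1) fh[OF that]] by simp_all
  then have "compose P \<pi>\<^sub>A ?u = restrict f P \<and> compose P \<pi>\<^sub>B ?u = restrict h P"
    by (auto simp: compose_def fun_eq_iff)
  ultimately show ?thesis by blast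
qed

locale sets_product =
  fixes U :: "'a set set" and A B P \<pi>\<^sub>A \<pi>\<^sub>B
  assumes singletons: "\<And>x. {x} \<in> U"
    and sets_product: "is_product (sets_category U) A B P \<pi>\<^sub>A \<pi>\<^sub>B"
begin

sublocale product_object "sets_category U" A B P \<pi>\<^sub>A \<pi>\<^sub>B
  using sets_product by (simp add: product_object_def category_sets_category product_object_axioms_def)

lemmas product_bij = sets_product_bij[OF singletons sets_product]

lemma projections_extensional: "restrict \<pi>\<^sub>A P = \<pi>\<^sub>A" "restrict \<pi>\<^sub>B P = \<pi>\<^sub>B"
  using projections by (auto simp: sets_category_simps intro!: extensional_restrict)

lemma coord_eq: "left_coord u = compose P \<pi>\<^sub>A u" "right_coord u = compose P \<pi>\<^sub>B u"
  by (simp_all add: sets_category_simps)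

lemma aut_with_coordinates:
  assumes "bij_betw (\<lambda>x. (f x, h x)) P (A \<times> B)"
  obtains u where "u \<in> carrier (Aut (sets_category U) P)"
    "left_coord u = restrict f P" "right_coord u = restrict h P"
  using sets_aut_with_coordinates[OF product_bij assms, of U] unfolding coord_eq by blast

lemma coordinates_bij:
  assumes "u \<in> carrier (Aut (sets_category U) P)"
  shows "bij_betw (\<lambda>x. (\<pi>\<^sub>A (u x), \<pi>\<^sub>B (u x))) P (A \<times> B)"
proof -
  have "bij_betw u P P" using assms by (simp add: carrier_Aut_sets)
  from bij_betw_trans[OF this product_bij] show ?thesis by (simp add: comp_def)
qed

lemma finite_alternation_words:
  assumes "finite A" "finite B"
  shows "carrier (Aut (sets_category U) P) \<subseteq> words 3"
proof
  fix g assume g: "g \<in> carrier (Aut (sets_category U) P)"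
  obtain s where s: "bij_betw (\<lambda>x. (s x, \<pi>\<^sub>B x)) P (A \<times> B)"
      "bij_betw (\<lambda>x. (s x, \<pi>\<^sub>B (g x))) P (A \<times> B)"
    using finite_common_coordinate[OF assms product_bij coordinates_bij[OF g]] by blast
  have g_coord: "right_coord g = (\<lambda>x\<in>P. \<pi>\<^sub>B (g x))"
    by (simp add: coord_eq compose_def)
  obtain u where "u \<in> carrier (Aut (sets_category U) P)" "left_coord u = restrict s P"
      "right_coord u = restrict \<pi>\<^sub>B P"
    using aut_with_coordinates[OF s(1)] .
  moreover obtain v where "v \<in> carrier (Aut (sets_category U) P)"
      "left_coord v = restrict s P" "right_coord v = (\<lambda>x\<in>P. \<pi>\<^sub>B (g x))"
    using aut_with_coordinates[OF s(2)] .
  ultimately show "g \<in> words 3"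
    using words_3I[OF g, of u v] by (simp only: projections_extensional g_coord)
qed

lemma countable_alternation_words:
  assumes "countable A" "countable B"
  shows "carrier (Aut (sets_category U) P) \<subseteq> words 4"
proof
  fix g assume g: "g \<in> carrier (Aut (sets_category U) P)"
  have g_coord: "left_coord g = (\<lambda>x\<in>P. \<pi>\<^sub>A (g x))" "right_coord g = (\<lambda>x\<in>P. \<pi>\<^sub>B (g x))"
    by (simp_all add: coord_eq compose_def)
  from countable_common_coordinates[OF assms product_bij coordinates_bij[OF g]]
  consider f h where "bij_betw (\<lambda>x. (\<pi>\<^sub>A x, h x)) P (A \<times> B)" "bij_betw (\<lambda>x. (f x, h x)) P (A \<times> B)"
      "bij_betw (\<lambda>x. (f x, \<pi>\<^sub>B (g x))) P (A \<times> B)"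
    | f h where "bij_betw (\<lambda>x. (f x, \<pi>\<^sub>B x)) P (A \<times> B)" "bij_betw (\<lambda>x. (f x, h x)) P (A \<times> B)"
      "bij_betw (\<lambda>x. (\<pi>\<^sub>A (g x), h x)) P (A \<times> B)"
    by blast
  then show "g \<in> words 4"
  proof cases
    case 1
    obtain u where "u \<in> carrier (Aut (sets_category U) P)" "left_coord u = restrict \<pi>\<^sub>A P"
        "right_coord u = restrict h P"
      using aut_with_coordinates[OF 1(1)] .
    moreover obtain v where "v \<in> carrier (Aut (sets_category U) P)"
        "left_coord v = restrict f P" "right_coord v = restrict h P"
      using aut_with_coordinates[OF 1(2)] .
    moreover obtain w where "w \<in> carrier (Aut (sets_category U) P)"
        "left_coord w = restrict f P" "right_coord w = (\<lambda>x\<in>P. \<pi>\<^sub>B (g x))"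
      using aut_with_coordinates[OF 1(3)] .
    ultimately show ?thesis
      using words_4I_right[OF g, of u v w] by (simp only: projections_extensional g_coord)
  next
    case 2
    obtain u where "u \<in> carrier (Aut (sets_category U) P)" "left_coord u = restrict f P"
        "right_coord u = restrict \<pi>\<^sub>B P"
      using aut_with_coordinates[OF 2(1)] .
    moreover obtain v where "v \<in> carrier (Aut (sets_category U) P)"
        "left_coord v = restrict f P" "right_coord v = restrict h P"
      using aut_with_coordinates[OF 2(2)] .
    moreover obtain w where "w \<in> carrier (Aut (sets_category U) P)"
        "left_coord w = (\<lambda>x\<in>P. \<pi>\<^sub>A (g x))" "right_coord w = restrict h P"
      using aut_with_coordinates[OF 2(3)] .
    ultimately show ?thesis
      using words_4I_left[OF g, of u v w] by (simp only: projections_extensional g_coord)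
  qed
qed

end

section \<open>Lower bounds for sets\<close>

text \<open>The fibre \<open>b = y\<close> lies in the fibre \<open>b' = y'\<close>, and
  \<open>z\<close> is an extra point of the latter. As \<open>s\<close> already takes all values of
  \<open>A\<close> on the smaller fibre, it repeats one at \<open>z\<close>.\<close>

lemma no_common_coordinate:
  assumes "bij_betw (\<lambda>x. (s x, b x)) X (A \<times> B)" "bij_betw (\<lambda>x. (s x, b' x)) X (A \<times> B)"
    and "y \<in> B" "\<And>x. \<lbrakk>x \<in> X; b x = y\<rbrakk> \<Longrightarrow> b' x = y'"
    and "z \<in> X" "b' z = y'" "b z \<noteq> y"
  shows False
proof -
  have "(s z, y) \<in> A \<times> B"
    using bij_betwE[OF assms(1)] assms(3,5) by blast
  then have "(s z, y) \<in> (\<lambda>x. (s x, b x)) ` X"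
    using assms(1) by (simp add: bij_betw_def)
  then obtain x where x: "x \<in> X" "s x = s z" "b x = y" by auto
  then have "(s x, b' x) = (s z, b' z)" using assms(4,6) by simp
  then have "x = z" using x(1) assms(2,5) by (auto simp: bij_betw_def dest: inj_onD)
  then show False using x assms(7) by simp
qed

text \<open>
  The shift maps the row \<open>n = 0\<close> together with \<open>(1, 1)\<close> onto that row, and the column \<open>m = 0\<close>
  together with \<open>(2, 2)\<close> onto that column. So it is a product of three factors in neither order.
\<close>

definition row_column_shift :: "nat \<times> nat \<Rightarrow> nat \<times> nat" where
  "row_column_shift = (\<lambda>(m, n).
     if m = n then (if n = 0 then (0, 0) else if n = 1 then (1, 0) else if n = 2 then (0, 1)
       else (n - 2, n - 2))
     else if n = 0 then (m + 1, 0) else if m = 0 then (0, n + 1) else (m, n))"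

lemma bij_row_column_shift: "bij row_column_shift"
proof (rule o_bij)
  \<comment> \<open>The row and the column absorb the points \<open>(1, 1)\<close> and
    \<open>(2, 2)\<close>; the rest of the diagonal closes the gap by moving down two places, which
    \<open>n + 2\<close> undoes.\<close>
  let ?inv = "\<lambda>(m, n). if m = n then (if n = 0 then (0, 0) else (n + 2, n + 2))
     else if n = 0 then (if m = 1 then (1, 1) else (m - 1, 0))
     else if m = 0 then (if n = 1 then (2, 2) else (0, n - 1)) else (m, n :: nat)"
  show "?inv \<circ> row_column_shift = id"
    by (auto simp: row_column_shift_def fun_eq_iff)
  show "row_column_shift \<circ> ?inv = id"
    by (auto simp: row_column_shift_def fun_eq_iff)
qed

text \<open>The examples are described on natural numbers, while objects are sets of atoms; an
  embedding \<open>e\<close> carries them over.\<close>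

lemma transported_sets_product:
  fixes e :: "nat \<Rightarrow> 'a"
  assumes e: "inj e" and U: "e ` I \<in> U" "e ` J \<in> U" "e ` K \<in> U"
    and c: "bij_betw (\<lambda>n. (c1 n, c2 n)) K (I \<times> J)"
  shows "is_product (sets_category U) (e ` I) (e ` J) (e ` K)
    (\<lambda>x\<in>e ` K. e (c1 (inv_into UNIV e x))) (\<lambda>x\<in>e ` K. e (c2 (inv_into UNIV e x)))"
proof (rule sets_product_of_bij)
  have e2: "bij_betw (map_prod e e) (I \<times> J) (e ` I \<times> e ` J)"
    using e by (auto simp: bij_betw_def inj_on_def)
  have e': "bij_betw (inv_into UNIV e) (e ` K) K"
    using e by (auto simp: bij_betw_def inj_on_def)
  have "bij_betw (map_prod e e \<circ> ((\<lambda>n. (c1 n, c2 n)) \<circ> inv_into UNIV e)) (e ` K) (e ` I \<times> e ` J)"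
    by (rule bij_betw_trans[OF bij_betw_trans[OF e' c] e2])
  then show "bij_betw (\<lambda>x. ((\<lambda>x\<in>e ` K. e (c1 (inv_into UNIV e x))) x, (\<lambda>x\<in>e ` K. e (c2 (inv_into UNIV e x))) x))
      (e ` K) (e ` I \<times> e ` J)"
    by (rule bij_betw_cong[THEN iffD1, rotated]) simp
  have "c1 n \<in> I" "c2 n \<in> J" if "n \<in> K" for n
    using bij_betwE[OF c] that by auto
  then show "(\<lambda>x\<in>e ` K. e (c1 (inv_into UNIV e x))) \<in> e ` K \<rightarrow>\<^sub>E e ` I"
    "(\<lambda>x\<in>e ` K. e (c2 (inv_into UNIV e x))) \<in> e ` K \<rightarrow>\<^sub>E e ` J"
    using e by auto
qed (use U in auto)

theorem alternation_diameter_finite_sets: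
  assumes "infinite (UNIV :: 'a set)"
  shows "alternation_diameter (finite_sets :: ('a set, 'a \<Rightarrow> 'a) category_data) = Some 3"
proof -
  obtain e :: "nat \<Rightarrow> 'a" where e: "inj e"
    using infinite_countable_subset[OF assms] by blast
  let ?C = "finite_sets :: ('a set, 'a \<Rightarrow> 'a) category_data"
  \<comment> \<open>Two points suffice for a square with distinct projections, so the product needs
    four atoms.\<close>
  obtain c where "bij_betw c {..<4 :: nat} ({..<2 :: nat} \<times> {..<2 :: nat})"
    using finite_same_card_bij[of "{..<4 :: nat}" "{..<2 :: nat} \<times> {..<2 :: nat}"] by auto
  then have c: "bij_betw (\<lambda>n. (fst (c n), snd (c n))) {..<4} ({..<2} \<times> {..<2})"
    by simp
  define A where "A = e ` {..<2}"
  define P where "P = e ` {..<4}"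
  define \<pi>1 where "\<pi>1 = (\<lambda>x\<in>P. e (fst (c (inv_into UNIV e x))))"
  define \<pi>2 where "\<pi>2 = (\<lambda>x\<in>P. e (snd (c (inv_into UNIV e x))))"
  have prod: "is_product ?C A A P \<pi>1 \<pi>2"
    unfolding finite_sets_def A_def P_def \<pi>1_def \<pi>2_def
    by (rule transported_sets_product[OF e _ _ _ c]) auto
  have "\<pi>1 \<noteq> \<pi>2"
  proof
    assume eq: "\<pi>1 = \<pi>2"
    have "bij_betw (\<lambda>x. (\<pi>1 x, \<pi>2 x)) P (A \<times> A)"
      by (rule sets_product_bij[OF _ prod[unfolded finite_sets_def]]) simp
    moreover have "(e 0, e 1) \<in> A \<times> A" by (auto simp: A_def)
    ultimately have "(e 0, e 1) \<in> (\<lambda>x. (\<pi>1 x, \<pi>2 x)) ` P"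
      by (simp add: bij_betw_def)
    then have "e 0 = e 1" using eq by auto
    then show False using e by (auto dest: injD)
  qed
  then have lower: "\<not> carrier (Aut ?C P) \<subseteq> alternation_words ?C A A P \<pi>1 \<pi>2 2"
    using category.swap_notin_alternation_words_2[OF category_finite_sets prod] by blast
  have "alternation_diameter ?C = Some (enat (Suc 2))"
  proof (rule alternation_diameter_eqI[OF category_finite_sets _ prod lower])
    fix A B P :: "'a set" and \<pi>\<^sub>A \<pi>\<^sub>B
    assume p: "is_product ?C A B P \<pi>\<^sub>A \<pi>\<^sub>B"
    then interpret sets_product "{X :: 'a set. finite X}" A B P \<pi>\<^sub>A \<pi>\<^sub>B
      by unfold_locales (auto simp: finite_sets_def)
    have "finite A" "finite B"
      using objects by (auto simp: sets_category_simps)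
    then show "carrier (Aut ?C P) \<subseteq> alternation_words ?C A B P \<pi>\<^sub>A \<pi>\<^sub>B (Suc 2)"
      using finite_alternation_words by (simp add: finite_sets_def numeral_3_eq_3 numeral_2_eq_2)
  qed
  then show ?thesis by (simp add: numeral_eq_enat)
qed

theorem alternation_diameter_countable_sets:
  assumes "infinite (UNIV :: 'a set)"
  shows "alternation_diameter (countable_sets :: ('a set, 'a \<Rightarrow> 'a) category_data) = Some 4"
proof -
  obtain e :: "nat \<Rightarrow> 'a" where e: "inj e"
    using infinite_countable_subset[OF assms] by blast
  let ?C = "countable_sets :: ('a set, 'a \<Rightarrow> 'a) category_data"
  have c: "bij_betw (\<lambda>n. (fst (prod_decode n), snd (prod_decode n))) UNIV (UNIV \<times> UNIV)"
    using bij_prod_decode by simp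
  \<comment> \<open>One countably infinite object serves as both factors and, through the pairing
    function on \<open>nat\<close>, as their product.\<close>
  define P where "P = range e"
  define \<pi>1 where "\<pi>1 = (\<lambda>x\<in>P. e (fst (prod_decode (inv_into UNIV e x))))"
  define \<pi>2 where "\<pi>2 = (\<lambda>x\<in>P. e (snd (prod_decode (inv_into UNIV e x))))"
  have prod: "is_product ?C P P P \<pi>1 \<pi>2"
    unfolding countable_sets_def P_def \<pi>1_def \<pi>2_def
    by (rule transported_sets_product[OF e _ _ _ c]) auto
  interpret sets_product "{X :: 'a set. countable X}" P P P \<pi>1 \<pi>2
    using prod by unfold_locales (auto simp: countable_sets_def)
  define pt where "pt p = e (prod_encode p)" for p
  have pt: "pt p \<in> P" "\<pi>1 (pt p) = e (fst p)" "\<pi>2 (pt p) = e (snd p)" for p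
    using e by (simp_all add: pt_def P_def \<pi>1_def \<pi>2_def)
  have pt_bij: "bij_betw pt UNIV P"
    unfolding pt_def P_def using bij_betw_trans[OF bij_prod_encode, of e "range e"] e
    by (simp add: comp_def bij_betw_def)
  have pt_ex: "\<exists>p. x = pt p" if "x \<in> P" for x
    using that pt_bij by (auto simp: bij_betw_def)
  define g where "g = (\<lambda>x\<in>P. pt (row_column_shift (inv_into UNIV pt x)))"
  have g_pt: "g (pt p) = pt (row_column_shift p)" for p
    using pt(1) pt_bij by (simp add: g_def bij_betw_def)
  have "bij_betw (pt \<circ> (row_column_shift \<circ> inv_into UNIV pt)) P P"
    using bij_betw_trans[OF bij_betw_trans[OF bij_betw_inv_into[OF pt_bij] bij_row_column_shift] pt_bij] .
  then have "bij_betw g P P"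
    by (rule bij_betw_cong[THEN iffD1, rotated]) (simp add: g_def)
  then have g: "g \<in> carrier (Aut ?C P)"
    unfolding countable_sets_def carrier_Aut_sets by (auto simp: g_def pt)
  have e_eq: "e m = e n \<longleftrightarrow> m = n" for m n
    using e by (auto dest: injD)
  have "g \<notin> words 3"
  proof
    assume "g \<in> words 3"
    from words_3D[OF this] show False
    proof (elim disjE bexE conjE)
      fix u v
      assume uv: "u \<in> carrier (Aut (sets_category {X. countable X}) P)"
          "v \<in> carrier (Aut (sets_category {X. countable X}) P)"
        and eqs: "right_coord u = \<pi>2" "left_coord u = left_coord v" "right_coord v = right_coord g"
      have *: "\<pi>2 (u x) = \<pi>2 x" "\<pi>1 (u x) = \<pi>1 (v x)" "\<pi>2 (v x) = \<pi>2 (g x)" if "x \<in> P" for x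
        using eqs that unfolding coord_eq by (metis compose_eq)+
      have 1: "bij_betw (\<lambda>x. (\<pi>1 (u x), \<pi>2 x)) P (P \<times> P)"
        by (rule bij_betw_cong[THEN iffD1, OF _ coordinates_bij[OF uv(1)]]) (simp add: *)
      have 2: "bij_betw (\<lambda>x. (\<pi>1 (u x), \<pi>2 (g x))) P (P \<times> P)"
        by (rule bij_betw_cong[THEN iffD1, OF _ coordinates_bij[OF uv(2)]]) (simp add: *)
      show False
      \<comment> \<open>The row with second coordinate 0 stays in itself, while the shift sends
        \<open>(1, 1)\<close> to \<open>(1, 0)\<close>.\<close>
      proof (rule no_common_coordinate[OF 1 2, of "e 0" "e 0" "pt (1, 1)"])
        fix x assume x: "x \<in> P" "\<pi>2 x = e 0"
        then obtain p where "x = pt p" using pt_ex by blast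
        then show "\<pi>2 (g x) = e 0"
          using x(2) by (cases p) (auto simp: g_pt pt e_eq row_column_shift_def)
      qed (auto simp: P_def pt[unfolded P_def] g_pt pt e_eq row_column_shift_def)
    next
      fix u v
      assume uv: "u \<in> carrier (Aut (sets_category {X. countable X}) P)"
          "v \<in> carrier (Aut (sets_category {X. countable X}) P)"
        and eqs: "left_coord u = \<pi>1" "right_coord u = right_coord v" "left_coord v = left_coord g"
      have *: "\<pi>1 (u x) = \<pi>1 x" "\<pi>2 (u x) = \<pi>2 (v x)" "\<pi>1 (v x) = \<pi>1 (g x)" if "x \<in> P" for x
        using eqs that unfolding coord_eq by (metis compose_eq)+
      have 1: "bij_betw (\<lambda>x. (\<pi>1 x, \<pi>2 (u x))) P (P \<times> P)"
        by (rule bij_betw_cong[THEN iffD1, OF _ coordinates_bij[OF uv(1)]]) (simp add: *)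
      have 2: "bij_betw (\<lambda>x. (\<pi>1 (g x), \<pi>2 (u x))) P (P \<times> P)"
        by (rule bij_betw_cong[THEN iffD1, OF _ coordinates_bij[OF uv(2)]]) (simp add: *)
      show False
      \<comment> \<open>The same with the factors exchanged: the column with first coordinate 0
        stays in itself, and \<open>(2, 2)\<close> goes to \<open>(0, 1)\<close>.\<close>
      proof (rule no_common_coordinate[OF bij_betw_pair_swapI[OF 1] bij_betw_pair_swapI[OF 2],
            of "e 0" "e 0" "pt (2, 2)"])
        fix x assume x: "x \<in> P" "\<pi>1 x = e 0"
        then obtain p where "x = pt p" using pt_ex by blast
        then show "\<pi>1 (g x) = e 0"
          using x(2) by (cases p) (auto simp: g_pt pt e_eq row_column_shift_def)
      qed (auto simp: P_def pt[unfolded P_def] g_pt pt e_eq row_column_shift_def)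
    qed
  qed
  then have lower: "\<not> carrier (Aut ?C P) \<subseteq> alternation_words ?C P P P \<pi>1 \<pi>2 3"
    using g unfolding countable_sets_def by blast
  have "alternation_diameter ?C = Some (enat (Suc 3))"
  proof (rule alternation_diameter_eqI[OF category_countable_sets _ prod lower])
    fix A B P :: "'a set" and \<pi>\<^sub>A \<pi>\<^sub>B
    assume p: "is_product ?C A B P \<pi>\<^sub>A \<pi>\<^sub>B"
    then interpret p: sets_product "{X :: 'a set. countable X}" A B P \<pi>\<^sub>A \<pi>\<^sub>B
      by unfold_locales (auto simp: countable_sets_def)
    have "countable A" "countable B"
      using p.objects by (auto simp: sets_category_simps)
    then show "carrier (Aut ?C P) \<subseteq> alternation_words ?C A B P \<pi>\<^sub>A \<pi>\<^sub>B (Suc 3)"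
      using p.countable_alternation_words by (simp add: countable_sets_def eval_nat_numeral)
  qed
  then show ?thesis by (simp add: numeral_eq_enat)
qed

section \<open>Finite-dimensional vector spaces\<close>

lemma module_homI:
  assumes "\<And>x. x \<in> carrier M \<Longrightarrow> f x \<in> carrier N"
    and "\<And>x y. \<lbrakk>x \<in> carrier M; y \<in> carrier M\<rbrakk> \<Longrightarrow> f (x \<oplus>\<^bsub>M\<^esub> y) = f x \<oplus>\<^bsub>N\<^esub> f y"
    and "\<And>r x. \<lbrakk>r \<in> carrier R; x \<in> carrier M\<rbrakk> \<Longrightarrow> f (r \<odot>\<^bsub>M\<^esub> x) = r \<odot>\<^bsub>N\<^esub> f x"
  shows "f \<in> module_hom R M N"
  using assms by (auto simp: module_hom_def)

lemma module_homD:
  assumes "f \<in> module_hom R M N"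
  shows "x \<in> carrier M \<Longrightarrow> f x \<in> carrier N"
    and "\<lbrakk>x \<in> carrier M; y \<in> carrier M\<rbrakk> \<Longrightarrow> f (x \<oplus>\<^bsub>M\<^esub> y) = f x \<oplus>\<^bsub>N\<^esub> f y"
    and "\<lbrakk>r \<in> carrier R; x \<in> carrier M\<rbrakk> \<Longrightarrow> f (r \<odot>\<^bsub>M\<^esub> x) = r \<odot>\<^bsub>N\<^esub> f x"
  using assms by (auto simp: module_hom_def)

context
  fixes K :: "('k, 'r) ring_scheme" and V :: "('k, 'v, 's) module_scheme" and W :: "('k, 'w, 't) module_scheme"
  assumes V: "vectorspace K V" and W: "vectorspace K W"
begin

interpretation V: vectorspace K V by (rule V)
interpretation W: vectorspace K W by (rule W)

lemma mod_hom_vectorspaceI: "f \<in> module_hom K V W \<Longrightarrow> mod_hom K V W f"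
  by (intro mod_hom.intro mod_hom_axioms.intro V.module_axioms W.module_axioms)

lemma module_hom_zero: "f \<in> module_hom K V W \<Longrightarrow> f \<zero>\<^bsub>V\<^esub> = \<zero>\<^bsub>W\<^esub>"
  using mod_hom.f0_is_0 mod_hom_vectorspaceI by blast

lemma kernel_submodule:
  "f \<in> module_hom K V W \<Longrightarrow>
    LinearCombinations.submodule K {x \<in> carrier V. f x = \<zero>\<^bsub>W\<^esub>} V"
  using mod_hom.ker_is_submodule[OF mod_hom_vectorspaceI] mod_hom.ker_def[OF mod_hom_vectorspaceI]
  by metis

lemma image_submodule:
  "f \<in> module_hom K V W \<Longrightarrow> LinearCombinations.submodule K (f ` carrier V) W"
  using mod_hom.im_is_submodule[OF mod_hom_vectorspaceI] mod_hom.im_def[OF mod_hom_vectorspaceI]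
  by metis

lemma module_hom_inj_onI:
  assumes f: "f \<in> module_hom K V W" and ker: "\<And>x. \<lbrakk>x \<in> carrier V; f x = \<zero>\<^bsub>W\<^esub>\<rbrakk> \<Longrightarrow> x = \<zero>\<^bsub>V\<^esub>"
  shows "inj_on f (carrier V)"
proof -
  interpret linear_map K V W f
    using mod_hom_vectorspaceI[OF f] V W by (intro linear_map.intro)
  have "carrier (V.vs kerT) = {\<zero>\<^bsub>V\<^esub>}"
    using ker by (auto simp: mod_hom.ker_def)
  then show ?thesis by (rule Ke0_imp_inj)
qed

end

section \<open>Dimension arguments by chains of submodules\<close>

context vectorspace
begin

text \<open>Each strict inclusion supplies a vector outside the span of those chosen before. All
  finiteness arguments below end here, by exhibiting a chain of \<open>Suc dim\<close> strict
  inclusions.\<close>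

lemma submodule_chain_le_dim:
  assumes fd: "fin_dim"
    and sub: "\<And>i. i \<le> n \<Longrightarrow> LinearCombinations.submodule K (W i) V"
    and strict: "\<And>i. i < n \<Longrightarrow> W i \<subset> W (Suc i)"
  shows "n \<le> dim"
proof -
  have W: "W i \<subseteq> carrier V" if "i \<le> n" for i
    using sub[OF that] by (simp add: LinearCombinations.submodule_def)
  have "\<exists>S. S \<subseteq> W i \<and> finite S \<and> card S = i \<and> lin_indpt S" if "i \<le> n" for i
    using that
  proof (induction i)
    case 0
    show ?case by (rule exI[of _ "{}"]) (auto simp: lin_dep_def)
  next
    case (Suc i)
    then obtain S where S: "S \<subseteq> W i" "finite S" "card S = i" "lin_indpt S" by auto
    obtain w where w: "w \<in> W (Suc i)" "w \<notin> W i"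
      using strict[of i] Suc.prems by auto
    have "span S \<subseteq> W i"
      using span_is_subset[OF S(1)] sub[of i] Suc.prems by simp
    then have "w \<notin> span S" using w(2) by blast
    moreover have "w \<notin> S" using w(2) S(1) by blast
    moreover have "S \<subseteq> carrier V" "w \<in> carrier V"
      using S(1) w(1) W[of i] W[of "Suc i"] Suc.prems by auto
    ultimately have "lin_indpt (S \<union> {w})"
      using lin_dep_iff_in_span S(4) by blast
    moreover have "S \<union> {w} \<subseteq> W (Suc i)"
      using S(1) w(1) strict[of i] Suc.prems by auto
    moreover have "card (S \<union> {w}) = Suc i" "finite (S \<union> {w})"
      using S \<open>w \<notin> S\<close> by simp_all
    ultimately show ?case by blast
  qed
  from this[of n] obtain S where S: "S \<subseteq> W n" "card S = n" "lin_indpt S" by blast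
  then have "S \<subseteq> carrier V" using W[of n] by auto
  then show ?thesis
    using li_le_dim(2)[OF fd _ S(3)] S(2) by simp
qed

lemma funpow_module_hom:
  assumes "T \<in> module_hom K V V"
  shows "T ^^ n \<in> module_hom K V V"
proof (induction n)
  case 0
  show ?case by (rule module_homI) simp_all
next
  case (Suc n)
  show ?case
    by (rule module_homI) (use Suc assms in \<open>simp_all add: module_homD\<close>)
qed

text \<open>If \<open>u\<close> is missed, the images of the powers of \<open>T\<close> shrink
  forever: \<open>(T ^^ k) u\<close> lies in the image of \<open>T ^^ k\<close> but, by injectivity,
  not in the next one.\<close>

lemma inj_endo_surj:
  assumes fd: "fin_dim" and T: "T \<in> module_hom K V V" and inj: "inj_on T (carrier V)"
  shows "T ` carrier V = carrier V"
proof (rule ccontr)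
  assume "\<not> ?thesis"
  then obtain u where u: "u \<in> carrier V" "u \<notin> T ` carrier V"
    using module_homD(1)[OF T] by blast
  have closed: "(T ^^ k) x \<in> carrier V" if "x \<in> carrier V" for k x
    using module_homD(1)[OF funpow_module_hom[OF T] that] .
  have inj_pow: "inj_on (T ^^ k) (carrier V)" for k
  proof (induction k)
    case (Suc k)
    have "inj_on T ((T ^^ k) ` carrier V)"
      using closed by (intro inj_on_subset[OF inj]) auto
    then show ?case
      using comp_inj_on[OF Suc] by (simp only: funpow.simps)
  qed simp
  have step: "(T ^^ Suc k) ` carrier V \<subset> (T ^^ k) ` carrier V" for k
  proof
    show "(T ^^ Suc k) ` carrier V \<subseteq> (T ^^ k) ` carrier V"
      using module_homD(1)[OF T] by (auto simp: funpow_swap1)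
    have "(T ^^ k) u \<notin> (T ^^ Suc k) ` carrier V"
    proof
      assume "(T ^^ k) u \<in> (T ^^ Suc k) ` carrier V"
      then obtain y where y: "y \<in> carrier V" "(T ^^ k) u = (T ^^ k) (T y)"
        by (auto simp: funpow_swap1)
      then have "u = T y"
        using inj_onD[OF inj_pow] u(1) module_homD(1)[OF T] by blast
      then show False using u(2) y(1) by blast
    qed
    then show "(T ^^ Suc k) ` carrier V \<noteq> (T ^^ k) ` carrier V"
      using u(1) by blast
  qed
  \<comment> \<open>Counting exponents down from \<open>?n\<close> turns the decreasing images into
    an increasing chain.\<close>
  let ?n = "Suc dim"
  have "?n \<le> dim"
  proof (rule submodule_chain_le_dim[OF fd, where W = "\<lambda>i. (T ^^ (?n - i)) ` carrier V"])
    show "LinearCombinations.submodule K ((T ^^ (?n - i)) ` carrier V) V" for i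
      by (rule image_submodule[OF vectorspace_axioms vectorspace_axioms funpow_module_hom[OF T]])
    show "(T ^^ (?n - i)) ` carrier V \<subset> (T ^^ (?n - Suc i)) ` carrier V" if "i < ?n" for i
      using step[of "?n - Suc i"] that by (simp only: Suc_diff_Suc)
  qed
  then show False by simp
qed

text \<open>Dual to the previous argument, with kernels of powers: a preimage of
  \<open>v \<noteq> 0\<close> under \<open>T ^^ i\<close> lies in the kernel of the next power
  only.\<close>

lemma surj_endo_inj:
  assumes fd: "fin_dim" and T: "T \<in> module_hom K V V" and surj: "T ` carrier V = carrier V"
    and v: "v \<in> carrier V" "T v = \<zero>\<^bsub>V\<^esub>"
  shows "v = \<zero>\<^bsub>V\<^esub>"
proof (rule ccontr)
  assume v0: "v \<noteq> \<zero>\<^bsub>V\<^esub>"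
  have T0: "T \<zero>\<^bsub>V\<^esub> = \<zero>\<^bsub>V\<^esub>"
    by (rule module_hom_zero[OF vectorspace_axioms vectorspace_axioms T])
  have surj_pow: "(T ^^ k) ` carrier V = carrier V" for k
    by (induction k) (simp, simp only: funpow.simps image_comp[symmetric] surj)
  let ?W = "\<lambda>i. {x \<in> carrier V. (T ^^ i) x = \<zero>\<^bsub>V\<^esub>}"
  have "Suc dim \<le> dim"
  proof (rule submodule_chain_le_dim[OF fd, where W = ?W])
    show "LinearCombinations.submodule K (?W i) V" for i
      by (rule kernel_submodule[OF vectorspace_axioms vectorspace_axioms funpow_module_hom[OF T]])
    show "?W i \<subset> ?W (Suc i)" for i
    proof
      show "?W i \<subseteq> ?W (Suc i)" using T0 by auto
      have "v \<in> (T ^^ i) ` carrier V" using surj_pow v(1) by simp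
      then obtain w where w: "w \<in> carrier V" "v = (T ^^ i) w" by blast
      then have "w \<in> ?W (Suc i)" "w \<notin> ?W i" using v(2) v0 by auto
      then show "?W i \<noteq> ?W (Suc i)" by blast
    qed
  qed
  then show False by simp
qed

text \<open>Extend \<open>w\<close> to a basis and read off the coordinate at
  \<open>w\<close>.\<close>

lemma linear_functional_exists:
  assumes fd: "fin_dim" and w: "w \<in> carrier V" "w \<noteq> \<zero>\<^bsub>V\<^esub>"
  obtains \<phi> where "\<And>x. x \<in> carrier V \<Longrightarrow> \<phi> x \<in> carrier K"
    "\<And>x y. \<lbrakk>x \<in> carrier V; y \<in> carrier V\<rbrakk> \<Longrightarrow> \<phi> (x \<oplus>\<^bsub>V\<^esub> y) = \<phi> x \<oplus>\<^bsub>K\<^esub> \<phi> y"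
    "\<And>c x. \<lbrakk>c \<in> carrier K; x \<in> carrier V\<rbrakk> \<Longrightarrow> \<phi> (c \<odot>\<^bsub>V\<^esub> x) = c \<otimes>\<^bsub>K\<^esub> \<phi> x"
    "\<phi> w = \<one>\<^bsub>K\<^esub>"
proof -
  have "w \<notin> span {}" using w(2) span_empty by blast
  moreover have "lin_indpt {}" by (auto simp: lin_dep_def)
  ultimately have "lin_indpt {w}"
    using lin_dep_iff_in_span[of "{}" w] w(1) by simp
  then have "\<exists>S. finite S \<and> maximal S (\<lambda>S. S \<subseteq> carrier V \<and> lin_indpt S \<and> w \<in> S)"
    using li_le_dim[OF fd] w(1) by (intro maximal_exists[where N = dim and B = "{w}"]) auto
  then obtain S where S: "finite S" "maximal S (\<lambda>S. S \<subseteq> carrier V \<and> lin_indpt S \<and> w \<in> S)"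
    by blast
  then have wS: "w \<in> S" and SV: "S \<subseteq> carrier V" by (auto simp: maximal_def)
  \<comment> \<open>Any independent set above \<open>S\<close> still contains \<open>w\<close>, so
    maximality among the sets through \<open>w\<close> is maximality among all independent
    sets.\<close>
  have "maximal S (\<lambda>S. S \<subseteq> carrier V \<and> lin_indpt S)"
    using S(2) unfolding maximal_def by blast
  then have "basis S" by (rule max_li_is_basis)
  then have uniq: "\<exists>!a. a \<in> S \<rightarrow>\<^sub>E carrier K \<and> lincomb a S = x" if "x \<in> carrier V" for x
    using basis_criterion[OF S(1) SV] that by blast
  define co where "co x = (THE a. a \<in> S \<rightarrow>\<^sub>E carrier K \<and> lincomb a S = x)" for x
  have co: "co x \<in> S \<rightarrow>\<^sub>E carrier K" "lincomb (co x) S = x" if "x \<in> carrier V" for x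
    using theI'[OF uniq[OF that]] unfolding co_def by blast+
  \<comment> \<open>Uniqueness of coordinates holds for extensional families; restricting
    \<open>a\<close> to \<open>S\<close> makes the comparison possible without changing the linear
    combination.\<close>
  have co_eq: "co x w = a w" if "x \<in> carrier V" "a \<in> S \<rightarrow> carrier K" "lincomb a S = x" for x a
  proof -
    have "restrict a S \<in> S \<rightarrow>\<^sub>E carrier K \<and> lincomb (restrict a S) S = x"
      using that SV by (auto intro: lincomb_cong[THEN trans])
    then have "co x = restrict a S"
      unfolding co_def using uniq[OF that(1)] by (intro the1_equality)
    then show ?thesis using wS by simp
  qed
  have co_in: "co x \<in> S \<rightarrow> carrier K" if "x \<in> carrier V" for x
    using co(1)[OF that] by auto
  show thesis
  proof
    show "co x w \<in> carrier K" if "x \<in> carrier V" for x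
      using co_in[OF that] wS by blast
    show "co (x \<oplus>\<^bsub>V\<^esub> y) w = co x w \<oplus>\<^bsub>K\<^esub> co y w" if "x \<in> carrier V" "y \<in> carrier V" for x y
      using co_in[OF that(1)] co_in[OF that(2)] lincomb_sum[OF S(1) SV co_in[OF that(1)] co_in[OF that(2)]]
        co(2) that by (intro co_eq) auto
    show "co (c \<odot>\<^bsub>V\<^esub> x) w = c \<otimes>\<^bsub>K\<^esub> co x w" if "c \<in> carrier K" "x \<in> carrier V" for c x
      using co_in[OF that(2)] lincomb_smult[OF SV co_in[OF that(2)] that(1)] co(2) that
      by (intro co_eq) auto
    let ?e = "\<lambda>v. if v = w then \<one>\<^bsub>K\<^esub> else \<zero>\<^bsub>K\<^esub>"
    have "lincomb ?e S = ?e w \<odot>\<^bsub>V\<^esub> w \<oplus>\<^bsub>V\<^esub> lincomb ?e (S - {w})"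
      using S(1) SV wS by (intro lincomb_del2) auto
    also have "lincomb ?e (S - {w}) = lincomb (\<lambda>_. \<zero>\<^bsub>K\<^esub>) (S - {w})"
      using SV by (intro lincomb_cong) auto
    also have "\<dots> = \<zero>\<^bsub>V\<^esub>"
      using SV by (intro lincomb_zero) auto
    finally have "lincomb ?e S = w" using w(1) by simp
    then have "co w w = ?e w" using w(1) by (intro co_eq) auto
    then show "co w w = \<one>\<^bsub>K\<^esub>" by simp
  qed
qed

end


section \<open>The stable range condition\<close>

text \<open>
  Choose \<open>u\<close> outside the image of \<open>a + \<beta> c\<close> and a functional \<open>\<phi>\<close> with \<open>\<phi> (c v) = 1\<close>; the update is
  \<open>\<beta>' = \<beta> + u \<phi>\<close>.
\<close>

lemma kernel_shrinking_update:
  assumes A: "vectorspace K A" "vectorspace.fin_dim K A" and B: "vectorspace K B" "vectorspace.fin_dim K B"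
    and a: "a \<in> module_hom K A A" and c: "c \<in> module_hom K A B"
    and ker: "\<And>x. \<lbrakk>x \<in> carrier A; a x = \<zero>\<^bsub>A\<^esub>; c x = \<zero>\<^bsub>B\<^esub>\<rbrakk> \<Longrightarrow> x = \<zero>\<^bsub>A\<^esub>"
    and \<beta>: "\<beta> \<in> module_hom K B A"
    and v: "v \<in> carrier A" "a v \<oplus>\<^bsub>A\<^esub> \<beta> (c v) = \<zero>\<^bsub>A\<^esub>" "v \<noteq> \<zero>\<^bsub>A\<^esub>"
  shows "\<exists>\<beta>'\<in>module_hom K B A.
    {x \<in> carrier A. a x \<oplus>\<^bsub>A\<^esub> \<beta>' (c x) = \<zero>\<^bsub>A\<^esub>} \<subset> {x \<in> carrier A. a x \<oplus>\<^bsub>A\<^esub> \<beta> (c x) = \<zero>\<^bsub>A\<^esub>}"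
proof -
  interpret A: vectorspace K A by (rule A)
  interpret B: vectorspace K B by (rule B)
  note homs = module_homD[OF a] module_homD[OF c] module_homD[OF \<beta>]
  define T where "T x = a x \<oplus>\<^bsub>A\<^esub> \<beta> (c x)" for x
  have T: "T \<in> module_hom K A A"
    by (rule module_homI) (simp_all add: T_def homs A.a_ac A.smult_r_distr)
  note T_simps = module_homD[OF T]
  \<comment> \<open>The kernel of \<open>T\<close> is not zero, hence in finite dimension
    \<open>T\<close> is not onto.\<close>
  have "\<not> carrier A \<subseteq> T ` carrier A"
    using A.surj_endo_inj[OF A(2) T _ v(1)] v T_simps(1) unfolding T_def by blast
  then obtain u where u: "u \<in> carrier A" "u \<notin> T ` carrier A" by blast
  have u0: "u \<noteq> \<zero>\<^bsub>A\<^esub>"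
    using u(2) module_hom_zero[OF A(1) A(1) T] A.zero_closed by (metis image_eqI)
  have cv: "c v \<noteq> \<zero>\<^bsub>B\<^esub>"
  proof
    assume "c v = \<zero>\<^bsub>B\<^esub>"
    then have "a v = \<zero>\<^bsub>A\<^esub>"
      using v(1,2) module_hom_zero[OF B(1) A(1) \<beta>] homs(1) by simp
    then show False using ker v(1,3) \<open>c v = \<zero>\<^bsub>B\<^esub>\<close> by blast
  qed
  obtain \<phi> where \<phi>: "\<And>x. x \<in> carrier B \<Longrightarrow> \<phi> x \<in> carrier K"
    "\<And>x y. \<lbrakk>x \<in> carrier B; y \<in> carrier B\<rbrakk> \<Longrightarrow> \<phi> (x \<oplus>\<^bsub>B\<^esub> y) = \<phi> x \<oplus>\<^bsub>K\<^esub> \<phi> y"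
    "\<And>k x. \<lbrakk>k \<in> carrier K; x \<in> carrier B\<rbrakk> \<Longrightarrow> \<phi> (k \<odot>\<^bsub>B\<^esub> x) = k \<otimes>\<^bsub>K\<^esub> \<phi> x"
    "\<phi> (c v) = \<one>\<^bsub>K\<^esub>"
    by (rule B.linear_functional_exists[OF B(2) homs(4)[OF v(1)] cv]) blast
  define \<beta>' where "\<beta>' y = \<beta> y \<oplus>\<^bsub>A\<^esub> \<phi> y \<odot>\<^bsub>A\<^esub> u" for y
  have \<beta>'_hom: "\<beta>' \<in> module_hom K B A"
    by (rule module_homI)
      (simp_all add: \<beta>'_def homs \<phi> u A.a_ac A.smult_r_distr A.smult_l_distr A.smult_assoc1)
  have T': "a x \<oplus>\<^bsub>A\<^esub> \<beta>' (c x) = T x \<oplus>\<^bsub>A\<^esub> \<phi> (c x) \<odot>\<^bsub>A\<^esub> u" if "x \<in> carrier A" for x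
    using that by (simp add: \<beta>'_def T_def homs \<phi> u A.a_assoc)
  \<comment> \<open>The kernel does not grow: if the coefficient of \<open>u\<close> were
    invertible, solving for \<open>u\<close> would place it in the image of
    \<open>T\<close>.\<close>
  have sub: "T x = \<zero>\<^bsub>A\<^esub>" if x: "x \<in> carrier A" "T x \<oplus>\<^bsub>A\<^esub> \<phi> (c x) \<odot>\<^bsub>A\<^esub> u = \<zero>\<^bsub>A\<^esub>" for x
  proof (cases "\<phi> (c x) = \<zero>\<^bsub>K\<^esub>")
    case True
    then show ?thesis using x T_simps u by simp
  next
    case False
    let ?k = "\<phi> (c x)"
    have k: "?k \<in> carrier K" "inv\<^bsub>K\<^esub> ?k \<in> carrier K" "inv\<^bsub>K\<^esub> ?k \<otimes>\<^bsub>K\<^esub> ?k = \<one>\<^bsub>K\<^esub>"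
      using False \<phi>(1) homs(4) x(1) A.field.field_Units by auto
    have ku: "?k \<odot>\<^bsub>A\<^esub> u \<in> carrier A" "T x \<in> carrier A"
      using x(1) k(1) u(1) T_simps(1) by simp_all
    then have "?k \<odot>\<^bsub>A\<^esub> u \<oplus>\<^bsub>A\<^esub> T x = \<zero>\<^bsub>A\<^esub>"
      using x(2) A.a_comm by simp
    then have "?k \<odot>\<^bsub>A\<^esub> u = \<ominus>\<^bsub>A\<^esub> T x"
      using A.minus_equality ku by simp
    also have "\<dots> = T (\<ominus>\<^bsub>A\<^esub> x)"
      using x(1) mod_hom.f_neg[OF mod_hom_vectorspaceI[OF A(1) A(1) T]] by simp
    finally have "u = T (inv\<^bsub>K\<^esub> ?k \<odot>\<^bsub>A\<^esub> (\<ominus>\<^bsub>A\<^esub> x))"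
      using k u x(1) T_simps(3) A.smult_assoc1[of "inv\<^bsub>K\<^esub> ?k" ?k u] by simp
    then show ?thesis using u(2) k x(1) by blast
  qed
  \<comment> \<open>The kernel loses \<open>v\<close>, on which the new map takes the value
    \<open>u \<noteq> 0\<close> because \<open>T v = 0\<close> and
    \<open>\<phi> (c v) = 1\<close>.\<close>
  have "v \<notin> {x \<in> carrier A. a x \<oplus>\<^bsub>A\<^esub> \<beta>' (c x) = \<zero>\<^bsub>A\<^esub>}"
    using T'[OF v(1)] v \<phi>(4) u u0 by (simp add: T_def)
  moreover have "{x \<in> carrier A. a x \<oplus>\<^bsub>A\<^esub> \<beta>' (c x) = \<zero>\<^bsub>A\<^esub>}
      \<subseteq> {x \<in> carrier A. a x \<oplus>\<^bsub>A\<^esub> \<beta> (c x) = \<zero>\<^bsub>A\<^esub>}"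
    using sub T' unfolding T_def by auto
  ultimately show ?thesis
    using v(1,2) \<beta>'_hom by blast
qed

text \<open>The update can be repeated as long as the kernel is nonzero, and finite dimension stops
  it.\<close>

lemma stable_range:
  assumes A: "vectorspace K A" "vectorspace.fin_dim K A" and B: "vectorspace K B" "vectorspace.fin_dim K B"
    and a: "a \<in> module_hom K A A" and c: "c \<in> module_hom K A B"
    and ker: "\<And>x. \<lbrakk>x \<in> carrier A; a x = \<zero>\<^bsub>A\<^esub>; c x = \<zero>\<^bsub>B\<^esub>\<rbrakk> \<Longrightarrow> x = \<zero>\<^bsub>A\<^esub>"
  obtains \<beta> where "\<beta> \<in> module_hom K B A"
    "\<And>x. \<lbrakk>x \<in> carrier A; a x \<oplus>\<^bsub>A\<^esub> \<beta> (c x) = \<zero>\<^bsub>A\<^esub>\<rbrakk> \<Longrightarrow> x = \<zero>\<^bsub>A\<^esub>"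
proof -
  interpret A: vectorspace K A by (rule A)
  interpret B: vectorspace K B by (rule B)
  let ?ker = "\<lambda>\<beta>. {x \<in> carrier A. a x \<oplus>\<^bsub>A\<^esub> \<beta> (c x) = \<zero>\<^bsub>A\<^esub>}"
  have ker_sub: "LinearCombinations.submodule K (?ker \<beta>) A" if \<beta>: "\<beta> \<in> module_hom K B A" for \<beta>
  proof -
    have "(\<lambda>x. a x \<oplus>\<^bsub>A\<^esub> \<beta> (c x)) \<in> module_hom K A A"
      by (rule module_homI)
        (simp_all add: module_homD[OF a] module_homD[OF c] module_homD[OF \<beta>] A.a_ac A.smult_r_distr)
    then show ?thesis by (rule kernel_submodule[OF A(1) A(1)])
  qed
  have "\<exists>\<beta>\<in>module_hom K B A. \<forall>x\<in>?ker \<beta>. x = \<zero>\<^bsub>A\<^esub>"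
  proof (rule ccontr)
    assume no: "\<not> ?thesis"
    \<comment> \<open>The newest and smallest kernel is kept at \<open>W 0\<close>, so every update
      prepends one term to the increasing chain.\<close>
    have "\<exists>\<beta> W. \<beta> \<in> module_hom K B A \<and> (\<forall>i\<le>n. LinearCombinations.submodule K (W i) A) \<and>
        (\<forall>i<n. W i \<subset> W (Suc i)) \<and> W 0 = ?ker \<beta>" for n
    proof (induction n)
      case 0
      have z: "(\<lambda>_. \<zero>\<^bsub>A\<^esub>) \<in> module_hom K B A" by (rule module_homI) simp_all
      show ?case
        by (rule exI[of _ "\<lambda>_. \<zero>\<^bsub>A\<^esub>"], rule exI[of _ "\<lambda>_. ?ker (\<lambda>_. \<zero>\<^bsub>A\<^esub>)"])
          (use z ker_sub[OF z] in simp)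
    next
      case (Suc n)
      then obtain \<beta> W where \<beta>: "\<beta> \<in> module_hom K B A"
        and W: "\<And>i. i \<le> n \<Longrightarrow> LinearCombinations.submodule K (W i) A"
          "\<And>i. i < n \<Longrightarrow> W i \<subset> W (Suc i)" "W 0 = ?ker \<beta>"
        by blast
      obtain v where v: "v \<in> carrier A" "a v \<oplus>\<^bsub>A\<^esub> \<beta> (c v) = \<zero>\<^bsub>A\<^esub>" "v \<noteq> \<zero>\<^bsub>A\<^esub>"
        using no \<beta> by blast
      obtain \<beta>' where \<beta>': "\<beta>' \<in> module_hom K B A" "?ker \<beta>' \<subset> ?ker \<beta>"
        using kernel_shrinking_update[OF A B a c ker \<beta> v] by blast
      let ?W = "\<lambda>i. case i of 0 \<Rightarrow> ?ker \<beta>' | Suc j \<Rightarrow> W j"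
      have "LinearCombinations.submodule K (?W i) A" if "i \<le> Suc n" for i
        using that W(1) ker_sub[OF \<beta>'(1)] by (cases i) auto
      moreover have "?W i \<subset> ?W (Suc i)" if "i < Suc n" for i
        using that W(2) \<beta>'(2) W(3) by (cases i) auto
      ultimately show ?case
        using \<beta>'(1) by (intro exI[of _ \<beta>'] exI[of _ ?W]) simp
    qed
    from this[of "Suc A.dim"] obtain W where "\<forall>i\<le>Suc A.dim. LinearCombinations.submodule K (W i) A"
        "\<forall>i<Suc A.dim. W i \<subset> W (Suc i)"
      by blast
    then have "Suc A.dim \<le> A.dim"
      by (intro A.submodule_chain_le_dim[OF A(2), of _ W]) auto
    then show False by simp
  qed
  then show thesis using that by blast
qed

lemma vector_spaces_simps:
  "Ob (fin_dim_vector_spaces K) = {V. vectorspace K V \<and> vectorspace.fin_dim K V}"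
  "Hom (fin_dim_vector_spaces K) V W = module_hom K V W \<inter> extensional (carrier V)"
  "Comp (fin_dim_vector_spaces K) V W X g f = compose (carrier V) g f"
  "Ident (fin_dim_vector_spaces K) V = (\<lambda>v\<in>carrier V. v)"
  by (simp_all add: fin_dim_vector_spaces_def)

lemma module_hom_cong:
  assumes "vectorspace K V" "f \<in> module_hom K V W" "\<And>x. x \<in> carrier V \<Longrightarrow> g x = f x"
  shows "g \<in> module_hom K V W"
proof -
  interpret vectorspace K V by (rule assms(1))
  show ?thesis
    by (rule module_homI) (simp_all add: assms(3) module_homD[OF assms(2)])
qed

lemma module_hom_comp:
  assumes "f \<in> module_hom K U V" "g \<in> module_hom K V W"
  shows "(\<lambda>x. g (f x)) \<in> module_hom K U W"
  by (rule module_homI) (simp_all add: module_homD[OF assms(1)] module_homD[OF assms(2)])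

lemma module_hom_add:
  assumes "vectorspace K W" "f \<in> module_hom K V W" "g \<in> module_hom K V W"
  shows "(\<lambda>x. f x \<oplus>\<^bsub>W\<^esub> g x) \<in> module_hom K V W"
proof -
  interpret vectorspace K W by (rule assms(1))
  show ?thesis
    by (rule module_homI)
      (simp_all add: module_homD[OF assms(2)] module_homD[OF assms(3)] a_ac smult_r_distr)
qed

lemma module_hom_inverse:
  assumes V: "vectorspace K V" and f: "f \<in> module_hom K V W" "bij_betw f (carrier V) (carrier W)"
  shows "inv_into (carrier V) f \<in> module_hom K W V"
proof -
  interpret vectorspace K V by (rule V)
  let ?g = "inv_into (carrier V) f"
  have g: "?g y \<in> carrier V" "f (?g y) = y" if "y \<in> carrier W" for y
    using that bij_betw_inv_into_right[OF f(2)] bij_betwE[OF bij_betw_inv_into[OF f(2)]] by auto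
  have eq: "?g y = x" if "x \<in> carrier V" "f x = y" for x y
    using bij_betw_inv_into_left[OF f(2)] that by blast
  show ?thesis
    by (rule module_homI) (auto intro!: eq simp: g module_homD[OF f(1)])
qed

text \<open>In finite dimension invertibility can be tested on the kernel alone, which is how all
  automorphisms of a product are produced below.\<close>

lemma inj_endo_in_Aut:
  assumes V: "vectorspace K V" "vectorspace.fin_dim K V"
    and T: "T \<in> module_hom K V V" "T \<in> extensional (carrier V)" "inj_on T (carrier V)"
  shows "T \<in> carrier (Aut (fin_dim_vector_spaces K) V)"
proof -
  have bij: "bij_betw T (carrier V) (carrier V)"
    using vectorspace.inj_endo_surj[OF V T(1,3)] T(3) by (simp add: bij_betw_def)
  let ?h = "restrict (inv_into (carrier V) T) (carrier V)"
  have "?h \<in> module_hom K V V"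
    by (rule module_hom_cong[OF V(1) module_hom_inverse[OF V(1) T(1) bij]]) simp
  moreover have "compose (carrier V) T ?h = (\<lambda>v\<in>carrier V. v)"
    using bij_betw_inv_into_right[OF bij] by (auto simp: compose_def fun_eq_iff)
  moreover have "T x \<in> carrier V" if "x \<in> carrier V" for x
    using module_homD(1)[OF T(1) that] .
  then have "compose (carrier V) ?h T = (\<lambda>v\<in>carrier V. v)"
    using bij_betw_inv_into_left[OF bij] by (auto simp: compose_def fun_eq_iff)
  ultimately show ?thesis
    unfolding Aut_def vector_spaces_simps
    using T(1,2) by (simp only: partial_object.simps) (blast intro: restrict_extensional)
qed

section \<open>Products of vector spaces and their automorphisms\<close>

locale vector_space_product =
  fixes K :: "('k, 'r) ring_scheme" and A B P :: "('k, 'v) module" and \<pi>\<^sub>A \<pi>\<^sub>B :: "'v \<Rightarrow> 'v"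
  assumes vector_space_product: "is_product (fin_dim_vector_spaces K) A B P \<pi>\<^sub>A \<pi>\<^sub>B"
begin

sublocale product_object "fin_dim_vector_spaces K" A B P \<pi>\<^sub>A \<pi>\<^sub>B
  using vector_space_product
  by (simp add: product_object_def category_fin_dim_vector_spaces product_object_axioms_def)

lemma spaces: "vectorspace K A" "vectorspace K B" "vectorspace K P"
  and fin_dims: "vectorspace.fin_dim K A" "vectorspace.fin_dim K B" "vectorspace.fin_dim K P"
  using objects by (auto simp: vector_spaces_simps)

sublocale A: vectorspace K A by (rule spaces)
sublocale B: vectorspace K B by (rule spaces)
sublocale P: vectorspace K P by (rule spaces)

lemma projection_homs: "\<pi>\<^sub>A \<in> module_hom K P A" "\<pi>\<^sub>B \<in> module_hom K P B"
  and projections_extensional: "restrict \<pi>\<^sub>A (carrier P) = \<pi>\<^sub>A" "restrict \<pi>\<^sub>B (carrier P) = \<pi>\<^sub>B"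
  using projections by (auto simp: vector_spaces_simps intro: extensional_restrict)

lemma pairing:
  fixes X :: "('k, 'v) module"
  assumes X: "vectorspace K X" "vectorspace.fin_dim K X"
    and f: "f \<in> module_hom K X A" and h: "h \<in> module_hom K X B"
  obtains u where "u \<in> module_hom K X P" "u \<in> extensional (carrier X)"
    "\<And>x. x \<in> carrier X \<Longrightarrow> \<pi>\<^sub>A (u x) = f x" "\<And>x. x \<in> carrier X \<Longrightarrow> \<pi>\<^sub>B (u x) = h x"
proof -
  have "restrict f (carrier X) \<in> module_hom K X A" "restrict h (carrier X) \<in> module_hom K X B"
    using f h by (auto intro: module_hom_cong[OF X(1)])
  then obtain u where u: "u \<in> module_hom K X P" "u \<in> extensional (carrier X)"
      and c: "compose (carrier X) \<pi>\<^sub>A u = restrict f (carrier X)"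
        "compose (carrier X) \<pi>\<^sub>B u = restrict h (carrier X)"
    using pairing_exists[of X "restrict f (carrier X)" "restrict h (carrier X)"] X
    unfolding vector_spaces_simps by auto
  have "\<pi>\<^sub>A (u x) = f x" "\<pi>\<^sub>B (u x) = h x" if "x \<in> carrier X" for x
    using fun_cong[OF c(1), of x] fun_cong[OF c(2), of x] that by (simp_all add: compose_def)
  then show thesis using that u by blast
qed

lemma left_inclusion:
  obtains i where "i \<in> module_hom K A P"
    "\<And>x. x \<in> carrier A \<Longrightarrow> \<pi>\<^sub>A (i x) = x" "\<And>x. x \<in> carrier A \<Longrightarrow> \<pi>\<^sub>B (i x) = \<zero>\<^bsub>B\<^esub>"
proof (rule pairing[OF spaces(1) fin_dims(1)])
  show "(\<lambda>x. x) \<in> module_hom K A A" by (rule module_homI) simp_all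
  show "(\<lambda>_. \<zero>\<^bsub>B\<^esub>) \<in> module_hom K A B" by (rule module_homI) simp_all
qed (use that in blast)

lemma right_inclusion:
  obtains i where "i \<in> module_hom K B P"
    "\<And>x. x \<in> carrier B \<Longrightarrow> \<pi>\<^sub>A (i x) = \<zero>\<^bsub>A\<^esub>" "\<And>x. x \<in> carrier B \<Longrightarrow> \<pi>\<^sub>B (i x) = x"
proof (rule pairing[OF spaces(2) fin_dims(2)])
  show "(\<lambda>_. \<zero>\<^bsub>A\<^esub>) \<in> module_hom K B A" by (rule module_homI) simp_all
  show "(\<lambda>x. x) \<in> module_hom K B B" by (rule module_homI) simp_all
qed (use that in blast)

text \<open>Uniqueness in the universal property gives \<open>i\<^sub>A \<circ> \<pi>\<^sub>A + i\<^sub>B \<circ> \<pi>\<^sub>B = id\<close>.\<close>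

lemma inclusions_decompose:
  assumes iA: "i \<in> module_hom K A P" "\<And>x. x \<in> carrier A \<Longrightarrow> \<pi>\<^sub>A (i x) = x"
      "\<And>x. x \<in> carrier A \<Longrightarrow> \<pi>\<^sub>B (i x) = \<zero>\<^bsub>B\<^esub>"
    and iB: "j \<in> module_hom K B P" "\<And>x. x \<in> carrier B \<Longrightarrow> \<pi>\<^sub>A (j x) = \<zero>\<^bsub>A\<^esub>"
      "\<And>x. x \<in> carrier B \<Longrightarrow> \<pi>\<^sub>B (j x) = x"
    and x: "x \<in> carrier P"
  shows "i (\<pi>\<^sub>A x) \<oplus>\<^bsub>P\<^esub> j (\<pi>\<^sub>B x) = x"
proof -
  note homs = module_homD[OF iA(1)] module_homD[OF iB(1)]
    module_homD[OF projection_homs(1)] module_homD[OF projection_homs(2)]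
  let ?h = "\<lambda>x\<in>carrier P. i (\<pi>\<^sub>A x) \<oplus>\<^bsub>P\<^esub> j (\<pi>\<^sub>B x)"
  have "(\<lambda>x. i (\<pi>\<^sub>A x) \<oplus>\<^bsub>P\<^esub> j (\<pi>\<^sub>B x)) \<in> module_hom K P P"
    by (rule module_hom_add[OF spaces(3) module_hom_comp[OF projection_homs(1) iA(1)]
      module_hom_comp[OF projection_homs(2) iB(1)]])
  then have h: "?h \<in> module_hom K P P"
    by (rule module_hom_cong[OF spaces(3)]) simp
  have h_coords: "\<pi>\<^sub>A (i (\<pi>\<^sub>A x) \<oplus>\<^bsub>P\<^esub> j (\<pi>\<^sub>B x)) = \<pi>\<^sub>A x" "\<pi>\<^sub>B (i (\<pi>\<^sub>A x) \<oplus>\<^bsub>P\<^esub> j (\<pi>\<^sub>B x)) = \<pi>\<^sub>B x"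
    if "x \<in> carrier P" for x
    using that iA iB by (simp_all add: homs)
  have "?h = Ident (fin_dim_vector_spaces K) P"
  proof (rule pairing_unique[of P])
    show "?h \<in> Hom (fin_dim_vector_spaces K) P P"
      using h by (simp add: vector_spaces_simps)
    show "left_coord ?h = left_coord (Ident (fin_dim_vector_spaces K) P)"
      "right_coord ?h = right_coord (Ident (fin_dim_vector_spaces K) P)"
      unfolding vector_spaces_simps compose_def by (rule restrict_ext, simp add: h_coords)+
  qed (use objects Ident_closed in simp_all)
  from fun_cong[OF this, of x] show ?thesis
    using x by (simp add: vector_spaces_simps)
qed

lemma coordinates_eq_zero:
  assumes "x \<in> carrier P" "\<pi>\<^sub>A x = \<zero>\<^bsub>A\<^esub>" "\<pi>\<^sub>B x = \<zero>\<^bsub>B\<^esub>"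
  shows "x = \<zero>\<^bsub>P\<^esub>"
proof -
  obtain i where i: "i \<in> module_hom K A P"
    "\<And>x. x \<in> carrier A \<Longrightarrow> \<pi>\<^sub>A (i x) = x" "\<And>x. x \<in> carrier A \<Longrightarrow> \<pi>\<^sub>B (i x) = \<zero>\<^bsub>B\<^esub>"
    by (rule left_inclusion) blast
  obtain j where j: "j \<in> module_hom K B P"
    "\<And>x. x \<in> carrier B \<Longrightarrow> \<pi>\<^sub>A (j x) = \<zero>\<^bsub>A\<^esub>" "\<And>x. x \<in> carrier B \<Longrightarrow> \<pi>\<^sub>B (j x) = x"
    by (rule right_inclusion) blast
  show ?thesis
    using inclusions_decompose[OF i j assms(1)] assms(2,3)
      module_hom_zero[OF spaces(1,3) i(1)] module_hom_zero[OF spaces(2,3) j(1)] by simp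
qed

lemma aut_with_coordinates:
  assumes f: "f \<in> module_hom K P A" and h: "h \<in> module_hom K P B"
    and ker: "\<And>x. \<lbrakk>x \<in> carrier P; f x = \<zero>\<^bsub>A\<^esub>; h x = \<zero>\<^bsub>B\<^esub>\<rbrakk> \<Longrightarrow> x = \<zero>\<^bsub>P\<^esub>"
  obtains u where "u \<in> carrier (Aut (fin_dim_vector_spaces K) P)"
    "left_coord u = restrict f (carrier P)" "right_coord u = restrict h (carrier P)"
proof -
  obtain u where u: "u \<in> module_hom K P P" "u \<in> extensional (carrier P)"
    "\<And>x. x \<in> carrier P \<Longrightarrow> \<pi>\<^sub>A (u x) = f x" "\<And>x. x \<in> carrier P \<Longrightarrow> \<pi>\<^sub>B (u x) = h x"
    by (rule pairing[OF spaces(3) fin_dims(3) f h]) blast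
  have "inj_on u (carrier P)"
  proof (rule module_hom_inj_onI[OF spaces(3,3) u(1)])
    fix x assume x: "x \<in> carrier P" "u x = \<zero>\<^bsub>P\<^esub>"
    then have "f x = \<zero>\<^bsub>A\<^esub>" "h x = \<zero>\<^bsub>B\<^esub>"
      using u(3,4)[OF x(1)] module_hom_zero[OF spaces(3,1) projection_homs(1)]
        module_hom_zero[OF spaces(3,2) projection_homs(2)] by simp_all
    then show "x = \<zero>\<^bsub>P\<^esub>" using ker x(1) by blast
  qed
  then have "u \<in> carrier (Aut (fin_dim_vector_spaces K) P)"
    by (intro inj_endo_in_Aut spaces fin_dims u)
  moreover have "left_coord u = restrict f (carrier P)" "right_coord u = restrict h (carrier P)"
    using u(3,4) by (auto simp: vector_spaces_simps compose_def fun_eq_iff)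
  ultimately show thesis using that by blast
qed

text \<open>Points with \<open>\<pi>\<^sub>B (g x) = 0\<close> are those of the form
  \<open>g' (i z)\<close> with \<open>z\<close> in \<open>A\<close>. So
  \<open>s = \<pi>\<^sub>A + \<beta> \<circ> \<pi>\<^sub>B\<close> complements
  \<open>\<pi>\<^sub>B \<circ> g\<close> as soon as \<open>s \<circ> g' \<circ> i\<close> is
  injective on \<open>A\<close>. This is the stable range condition for the two coordinates of
  \<open>g' \<circ> i\<close>, whose common kernel vanishes because \<open>g' \<circ> i\<close> is
  injective.\<close>

lemma alternation_words_3: "carrier (Aut (fin_dim_vector_spaces K) P) \<subseteq> words 3"
proof
  fix g assume g: "g \<in> carrier (Aut (fin_dim_vector_spaces K) P)"
  then obtain g' where gh: "g \<in> module_hom K P P" "g' \<in> module_hom K P P"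
    and inv: "compose (carrier P) g g' = (\<lambda>v\<in>carrier P. v)" "compose (carrier P) g' g = (\<lambda>v\<in>carrier P. v)"
    by (auto simp: Aut_def vector_spaces_simps)
  have gg': "g (g' x) = x" "g' (g x) = x" if "x \<in> carrier P" for x
    using fun_cong[OF inv(1), of x] fun_cong[OF inv(2), of x] that by (simp_all add: compose_def)
  obtain i where i: "i \<in> module_hom K A P"
    "\<And>x. x \<in> carrier A \<Longrightarrow> \<pi>\<^sub>A (i x) = x" "\<And>x. x \<in> carrier A \<Longrightarrow> \<pi>\<^sub>B (i x) = \<zero>\<^bsub>B\<^esub>"
    by (rule left_inclusion) blast
  obtain j where j: "j \<in> module_hom K B P"
    "\<And>x. x \<in> carrier B \<Longrightarrow> \<pi>\<^sub>A (j x) = \<zero>\<^bsub>A\<^esub>" "\<And>x. x \<in> carrier B \<Longrightarrow> \<pi>\<^sub>B (j x) = x"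
    by (rule right_inclusion) blast
  note \<pi>_closed = module_homD(1)[OF projection_homs(1)] module_homD(1)[OF projection_homs(2)]
  note closed = module_homD(1)[OF gh(1)] module_homD(1)[OF gh(2)] module_homD(1)[OF i(1)]
  note zeros = module_hom_zero[OF spaces(3,3) gh(1)] module_hom_zero[OF spaces(1,3) i(1)]
    module_hom_zero[OF spaces(2,3) j(1)] module_hom_zero[OF spaces(3,3) gh(2)]
  have g'i: "(\<lambda>x. g' (i x)) \<in> module_hom K A P"
    by (rule module_hom_comp[OF i(1) gh(2)])
  obtain \<beta> where \<beta>: "\<beta> \<in> module_hom K B A"
    "\<And>x. \<lbrakk>x \<in> carrier A; \<pi>\<^sub>A (g' (i x)) \<oplus>\<^bsub>A\<^esub> \<beta> (\<pi>\<^sub>B (g' (i x))) = \<zero>\<^bsub>A\<^esub>\<rbrakk> \<Longrightarrow> x = \<zero>\<^bsub>A\<^esub>"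
  proof (rule stable_range[OF spaces(1) fin_dims(1) spaces(2) fin_dims(2)
        module_hom_comp[OF g'i projection_homs(1)] module_hom_comp[OF g'i projection_homs(2)]])
    fix x assume x: "x \<in> carrier A" "\<pi>\<^sub>A (g' (i x)) = \<zero>\<^bsub>A\<^esub>" "\<pi>\<^sub>B (g' (i x)) = \<zero>\<^bsub>B\<^esub>"
    then have "g' (i x) = \<zero>\<^bsub>P\<^esub>"
      using coordinates_eq_zero closed by blast
    then have "i x = \<zero>\<^bsub>P\<^esub>"
      using gg'(1)[of "i x"] closed(3)[OF x(1)] zeros(1) by simp
    then show "x = \<zero>\<^bsub>A\<^esub>"
      using i(2)[OF x(1)] module_hom_zero[OF spaces(3,1) projection_homs(1)] by simp
  qed blast
  define s where "s x = \<pi>\<^sub>A x \<oplus>\<^bsub>A\<^esub> \<beta> (\<pi>\<^sub>B x)" for x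
  have s: "s \<in> module_hom K P A"
    unfolding s_def
    by (rule module_hom_add[OF spaces(1) projection_homs(1) module_hom_comp[OF projection_homs(2) \<beta>(1)]])
  have \<pi>g: "(\<lambda>x. \<pi>\<^sub>B (g x)) \<in> module_hom K P B"
    by (rule module_hom_comp[OF gh(1) projection_homs(2)])
  obtain u where u: "u \<in> carrier (Aut (fin_dim_vector_spaces K) P)"
    "left_coord u = restrict s (carrier P)" "right_coord u = restrict \<pi>\<^sub>B (carrier P)"
  \<comment> \<open>The map with coordinates \<open>s\<close> and \<open>\<pi>\<^sub>B\<close> is a
    shear, hence injective for every \<open>\<beta>\<close>.\<close>
  proof (rule aut_with_coordinates[OF s projection_homs(2)])
    fix x assume x: "x \<in> carrier P" "s x = \<zero>\<^bsub>A\<^esub>" "\<pi>\<^sub>B x = \<zero>\<^bsub>B\<^esub>"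
    then have "\<pi>\<^sub>A x = \<zero>\<^bsub>A\<^esub>"
      using module_hom_zero[OF spaces(2,1) \<beta>(1)] \<pi>_closed(1) by (simp add: s_def)
    then show "x = \<zero>\<^bsub>P\<^esub>" using coordinates_eq_zero x by blast
  qed blast
  obtain v where v: "v \<in> carrier (Aut (fin_dim_vector_spaces K) P)"
    "left_coord v = restrict s (carrier P)" "right_coord v = (\<lambda>x\<in>carrier P. \<pi>\<^sub>B (g x))"
  proof (rule aut_with_coordinates[OF s \<pi>g])
    fix x assume x: "x \<in> carrier P" "s x = \<zero>\<^bsub>A\<^esub>" "\<pi>\<^sub>B (g x) = \<zero>\<^bsub>B\<^esub>"
    let ?z = "\<pi>\<^sub>A (g x)"
    have z: "?z \<in> carrier A" using closed \<pi>_closed x(1) by blast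
    have "i ?z = g x"
      using inclusions_decompose[OF i j, of "g x"] closed(1)[OF x(1)] x(3) zeros(3) closed(3)[OF z]
      by simp
    then have "g' (i ?z) = x" using gg'(2)[OF x(1)] by simp
    then have "?z = \<zero>\<^bsub>A\<^esub>" using \<beta>(2)[OF z] x(2) by (simp add: s_def)
    then show "x = \<zero>\<^bsub>P\<^esub>"
      using \<open>g' (i ?z) = x\<close> zeros by simp
  qed blast
  have "right_coord g = (\<lambda>x\<in>carrier P. \<pi>\<^sub>B (g x))"
    by (simp add: vector_spaces_simps compose_def)
  then show "g \<in> words 3"
    using words_3I[OF g u(1) v(1)] u v by (simp only: projections_extensional)
qed

end


section \<open>A plane as a product of two lines\<close>

lemma vector_space_product_of_bij:
  assumes objs: "A \<in> Ob (fin_dim_vector_spaces K)" "B \<in> Ob (fin_dim_vector_spaces K)"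
      "P \<in> Ob (fin_dim_vector_spaces K)"
    and proj: "\<pi>\<^sub>A \<in> Hom (fin_dim_vector_spaces K) P A" "\<pi>\<^sub>B \<in> Hom (fin_dim_vector_spaces K) P B"
    and bij: "bij_betw (\<lambda>x. (\<pi>\<^sub>A x, \<pi>\<^sub>B x)) (carrier P) (carrier A \<times> carrier B)"
  shows "is_product (fin_dim_vector_spaces K) A B P \<pi>\<^sub>A \<pi>\<^sub>B"
proof -
  interpret A: vectorspace K A using objs(1) by (simp add: vector_spaces_simps)
  interpret B: vectorspace K B using objs(2) by (simp add: vector_spaces_simps)
  interpret P: vectorspace K P using objs(3) by (simp add: vector_spaces_simps)
  have hom: "\<pi>\<^sub>A \<in> module_hom K P A" "\<pi>\<^sub>B \<in> module_hom K P B"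
    using proj by (simp_all add: vector_spaces_simps)
  note homs = module_homD[OF hom(1)] module_homD[OF hom(2)]
  have eqI: "x = y" if "x \<in> carrier P" "y \<in> carrier P" "\<pi>\<^sub>A x = \<pi>\<^sub>A y" "\<pi>\<^sub>B x = \<pi>\<^sub>B y" for x y
    using bij that by (auto simp: bij_betw_def dest: inj_onD)
  have "\<exists>!h. h \<in> Hom (fin_dim_vector_spaces K) X P \<and>
      Comp (fin_dim_vector_spaces K) X P A \<pi>\<^sub>A h = f \<and> Comp (fin_dim_vector_spaces K) X P B \<pi>\<^sub>B h = g"
    if X: "X \<in> Ob (fin_dim_vector_spaces K)" and f: "f \<in> Hom (fin_dim_vector_spaces K) X A"
      and g: "g \<in> Hom (fin_dim_vector_spaces K) X B" for X f g
  proof (rule ex_ex1I)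
    interpret X: vectorspace K X using X by (simp add: vector_spaces_simps)
    have fg: "f \<in> module_hom K X A" "g \<in> module_hom K X B"
        "restrict f (carrier X) = f" "restrict g (carrier X) = g"
      using f g by (auto simp: vector_spaces_simps intro: extensional_restrict)
    note fg_homs = module_homD[OF fg(1)] module_homD[OF fg(2)]
    let ?i = "inv_into (carrier P) (\<lambda>x. (\<pi>\<^sub>A x, \<pi>\<^sub>B x))"
    have i: "?i (p, q) \<in> carrier P" "\<pi>\<^sub>A (?i (p, q)) = p" "\<pi>\<^sub>B (?i (p, q)) = q"
      if "p \<in> carrier A" "q \<in> carrier B" for p q
      using bij_betw_inv_into_right[OF bij, of "(p, q)"] bij_betwE[OF bij_betw_inv_into[OF bij]] that
      by simp_all
    let ?h = "\<lambda>x\<in>carrier X. ?i (f x, g x)"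
    have "(\<lambda>x. ?i (f x, g x)) \<in> module_hom K X P"
    proof (rule module_homI)
      show "?i (f x, g x) \<in> carrier P" if "x \<in> carrier X" for x
        using i(1) fg_homs that by simp
      show "?i (f (x \<oplus>\<^bsub>X\<^esub> y), g (x \<oplus>\<^bsub>X\<^esub> y)) = ?i (f x, g x) \<oplus>\<^bsub>P\<^esub> ?i (f y, g y)"
        if "x \<in> carrier X" "y \<in> carrier X" for x y
        by (rule eqI) (use that i in \<open>simp_all add: homs fg_homs\<close>)
      show "?i (f (r \<odot>\<^bsub>X\<^esub> x), g (r \<odot>\<^bsub>X\<^esub> x)) = r \<odot>\<^bsub>P\<^esub> ?i (f x, g x)"
        if "r \<in> carrier K" "x \<in> carrier X" for r x
        by (rule eqI) (use that i in \<open>simp_all add: homs fg_homs\<close>)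
    qed
    then have "?h \<in> module_hom K X P"
      by (rule module_hom_cong[OF X.vectorspace_axioms]) simp
    moreover have "compose (carrier X) \<pi>\<^sub>A ?h = restrict f (carrier X)"
        "compose (carrier X) \<pi>\<^sub>B ?h = restrict g (carrier X)"
      unfolding compose_def by (rule restrict_ext, simp add: i fg_homs)+
    ultimately show "\<exists>h. h \<in> Hom (fin_dim_vector_spaces K) X P \<and>
        Comp (fin_dim_vector_spaces K) X P A \<pi>\<^sub>A h = f \<and> Comp (fin_dim_vector_spaces K) X P B \<pi>\<^sub>B h = g"
      unfolding vector_spaces_simps fg(3,4) by (intro exI[of _ ?h]) simp
    fix h k
    assume h: "h \<in> Hom (fin_dim_vector_spaces K) X P \<and>
        Comp (fin_dim_vector_spaces K) X P A \<pi>\<^sub>A h = f \<and> Comp (fin_dim_vector_spaces K) X P B \<pi>\<^sub>B h = g"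
      and k: "k \<in> Hom (fin_dim_vector_spaces K) X P \<and>
        Comp (fin_dim_vector_spaces K) X P A \<pi>\<^sub>A k = f \<and> Comp (fin_dim_vector_spaces K) X P B \<pi>\<^sub>B k = g"
    have hk: "h \<in> module_hom K X P" "k \<in> module_hom K X P" "h \<in> extensional (carrier X)"
        "k \<in> extensional (carrier X)"
      using h k by (simp_all add: vector_spaces_simps)
    show "h = k"
    proof (rule extensionalityI[OF hk(3,4)])
      fix x assume x: "x \<in> carrier X"
      have "\<pi>\<^sub>A (h x) = \<pi>\<^sub>A (k x)" "\<pi>\<^sub>B (h x) = \<pi>\<^sub>B (k x)"
        using h k x unfolding vector_spaces_simps by (metis compose_eq)+
      then show "h x = k x"
        using x module_homD(1)[OF hk(1)] module_homD(1)[OF hk(2)] eqI by blast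
    qed
  qed
  then show ?thesis
    using objs proj unfolding is_product_def by (intro conjI ballI)
qed

text \<open>Coordinate spaces consist of functions, while objects must have vectors of type
  \<open>'v\<close>; this copies the structure along an injection.\<close>

definition transported_module :: "('w \<Rightarrow> 'v) \<Rightarrow> ('k, 'w) module \<Rightarrow> ('k, 'v) module" where
  "transported_module \<iota> M = (let j = inv_into (carrier M) \<iota> in
     \<lparr>carrier = \<iota> ` carrier M, mult = (\<lambda>_ _. \<iota> \<zero>\<^bsub>M\<^esub>), one = \<iota> \<zero>\<^bsub>M\<^esub>, zero = \<iota> \<zero>\<^bsub>M\<^esub>,
      add = (\<lambda>x y. \<iota> (j x \<oplus>\<^bsub>M\<^esub> j y)), smult = (\<lambda>c x. \<iota> (c \<odot>\<^bsub>M\<^esub> j x))\<rparr>)"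

lemma transported_module_simps:
  "carrier (transported_module \<iota> M) = \<iota> ` carrier M"
  "\<zero>\<^bsub>transported_module \<iota> M\<^esub> = \<iota> \<zero>\<^bsub>M\<^esub>"
  "x \<oplus>\<^bsub>transported_module \<iota> M\<^esub> y = \<iota> (inv_into (carrier M) \<iota> x \<oplus>\<^bsub>M\<^esub> inv_into (carrier M) \<iota> y)"
  "c \<odot>\<^bsub>transported_module \<iota> M\<^esub> x = \<iota> (c \<odot>\<^bsub>M\<^esub> inv_into (carrier M) \<iota> x)"
  by (simp_all add: transported_module_def Let_def)

lemma transported_module_props:
  assumes M: "vectorspace K M" and inj: "inj_on \<iota> (carrier M)"
  shows "vectorspace K (transported_module \<iota> M)"
    and "\<iota> \<in> module_hom K M (transported_module \<iota> M)"
    and "bij_betw \<iota> (carrier M) (carrier (transported_module \<iota> M))"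
    and "vectorspace.fin_dim K M \<Longrightarrow>
      vectorspace.fin_dim K (transported_module \<iota> M)"
proof -
  interpret M: vectorspace K M by (rule M)
  let ?T = "transported_module \<iota> M"
  note simps = transported_module_simps inv_into_f_f[OF inj]
  show T: "vectorspace K ?T"
  proof (rule vs_criteria)
    show "field K" by (rule M.field_axioms)
    show "\<forall>v\<in>carrier ?T. \<exists>w\<in>carrier ?T. v \<oplus>\<^bsub>?T\<^esub> w = \<zero>\<^bsub>?T\<^esub>"
    proof
      fix v assume "v \<in> carrier ?T"
      then obtain x where "x \<in> carrier M" "v = \<iota> x" by (auto simp: simps)
      then show "\<exists>w\<in>carrier ?T. v \<oplus>\<^bsub>?T\<^esub> w = \<zero>\<^bsub>?T\<^esub>"
        by (intro bexI[of _ "\<iota> (\<ominus>\<^bsub>M\<^esub> x)"]) (simp_all add: simps M.r_neg)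
    qed
  qed (auto simp: simps M.a_ac M.smult_assoc1 M.smult_l_distr M.smult_r_distr)
  show hom: "\<iota> \<in> module_hom K M ?T"
    by (rule module_homI) (simp_all add: simps)
  show bij: "bij_betw \<iota> (carrier M) (carrier ?T)"
    using inj by (simp add: bij_betw_def simps)
  assume fd: "vectorspace.fin_dim K M"
  interpret linear_map K M ?T \<iota>
    using M T mod_hom_vectorspaceI[OF M T hom] by (intro linear_map.intro)
  show "vectorspace.fin_dim K ?T"
    by (rule surj_fin_dim[OF fd]) (simp add: simps)
qed

text \<open>The unit vectors \<open>e j\<close> span; the induction is on a finite set
  \<open>T\<close> containing the support of the function.\<close>

lemma func_space_fin_dim:
  assumes K: "field K" and S: "finite (S :: 'i set)"
  shows "vectorspace K (ring.func_space K S)" "vectorspace.fin_dim K (ring.func_space K S)"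
proof -
  interpret K: field K by (rule K)
  let ?V = "K.func_space S"
  have mod: "module K ?V" by (rule K.func_space_is_module)
  show V: "vectorspace K ?V"
    by (rule vectorspace.intro[OF mod K])
  interpret V: vectorspace K ?V by (rule V)
  define e where "e j = (\<lambda>i\<in>S. if i = j then \<one>\<^bsub>K\<^esub> else \<zero>\<^bsub>K\<^esub>)" for j
  have V_simps: "carrier ?V = S \<rightarrow>\<^sub>E carrier K" "\<zero>\<^bsub>?V\<^esub> = (\<lambda>i\<in>S. \<zero>\<^bsub>K\<^esub>)"
      "f \<oplus>\<^bsub>?V\<^esub> g = (\<lambda>i\<in>S. f i \<oplus>\<^bsub>K\<^esub> g i)" "c \<odot>\<^bsub>?V\<^esub> f = (\<lambda>i\<in>S. c \<otimes>\<^bsub>K\<^esub> f i)" for f g c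
    by (simp_all add: K.func_space_def)
  have e_closed: "e ` S \<subseteq> carrier ?V"
    by (auto simp: e_def V_simps)
  have "LinearCombinations.submodule K (V.span (e ` S)) ?V"
    using e_closed by (rule V.span_is_submodule)
  note sub = LinearCombinations.submodule.zero_closed[OF this]
    LinearCombinations.submodule.m_closed[OF this] LinearCombinations.submodule.smult_closed[OF this]
  have "f \<in> V.span (e ` S)"
    if "finite T" "T \<subseteq> S" "f \<in> S \<rightarrow>\<^sub>E carrier K" "\<forall>i\<in>S - T. f i = \<zero>\<^bsub>K\<^esub>" for f T
    using that
  proof (induction T arbitrary: f rule: finite_induct)
    case empty
    then have "f = \<zero>\<^bsub>?V\<^esub>"
      by (intro PiE_ext[of f S "\<lambda>_. carrier K"]) (auto simp: V_simps)
    then show ?case using sub(1) by simp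
  next
    case (insert j T)
    let ?f = "\<lambda>i\<in>S. if i = j then \<zero>\<^bsub>K\<^esub> else f i"
    have "?f \<in> V.span (e ` S)"
      by (rule insert.IH) (use insert.prems in auto)
    moreover have "f j \<odot>\<^bsub>?V\<^esub> e j \<in> V.span (e ` S)"
      using V.span_mem[OF e_closed] insert.prems(1,2) by (intro sub(3)) auto
    ultimately have "f j \<odot>\<^bsub>?V\<^esub> e j \<oplus>\<^bsub>?V\<^esub> ?f \<in> V.span (e ` S)"
      by (intro sub(2))
    moreover have f_mem: "f i \<in> carrier K" if "i \<in> S" for i
      using insert.prems(2) that by (rule PiE_mem)
    have "f j \<odot>\<^bsub>?V\<^esub> e j \<oplus>\<^bsub>?V\<^esub> ?f = f"
      by (rule PiE_ext[of _ S "\<lambda>_. carrier K"]) (use insert.prems f_mem in \<open>auto simp: V_simps e_def\<close>)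
    ultimately show ?case by simp
  qed
  from this[OF S] have "carrier ?V \<subseteq> V.span (e ` S)"
    by (auto simp: V_simps)
  moreover have "V.span (e ` S) \<subseteq> carrier ?V"
    using e_closed V.span_closed by blast
  ultimately show "V.fin_dim"
    unfolding V.fin_dim_def using e_closed S by blast
qed

theorem alternation_diameter_vector_spaces:
  fixes K :: "('k, 'r) ring_scheme"
  assumes K: "field K" and large: "\<And>n. \<exists>\<iota> :: (nat \<Rightarrow> 'k) \<Rightarrow> 'v. inj_on \<iota> ({..<n} \<rightarrow>\<^sub>E carrier K)"
  shows "alternation_diameter (fin_dim_vector_spaces K :: (('k, 'v) module, 'v \<Rightarrow> 'v) category_data)
    = Some 3"
proof -
  interpret K: field K by (rule K)
  let ?C = "fin_dim_vector_spaces K :: (('k, 'v) module, 'v \<Rightarrow> 'v) category_data"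
  let ?F = "\<lambda>n :: nat. K.func_space {..<n}"
  have F_simps: "carrier (?F n) = {..<n} \<rightarrow>\<^sub>E carrier K"
    "f \<oplus>\<^bsub>?F n\<^esub> g = (\<lambda>i\<in>{..<n}. f i \<oplus>\<^bsub>K\<^esub> g i)" "c \<odot>\<^bsub>?F n\<^esub> f = (\<lambda>i\<in>{..<n}. c \<otimes>\<^bsub>K\<^esub> f i)" for n f g c
    by (simp_all add: K.func_space_def)
  note F = func_space_fin_dim[OF K finite_lessThan]
  obtain \<iota>1 :: "(nat \<Rightarrow> 'k) \<Rightarrow> 'v" where \<iota>1: "inj_on \<iota>1 (carrier (?F 1))"
    using large[of 1] by (auto simp: F_simps)
  obtain \<iota>2 :: "(nat \<Rightarrow> 'k) \<Rightarrow> 'v" where \<iota>2: "inj_on \<iota>2 (carrier (?F 2))"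
    using large[of 2] by (auto simp: F_simps)
  define A where "A = transported_module \<iota>1 (?F 1)"
  define P where "P = transported_module \<iota>2 (?F 2)"
  note A_props = transported_module_props[OF F(1) \<iota>1, folded A_def]
  note P_props = transported_module_props[OF F(1) \<iota>2, folded P_def]
  \<comment> \<open>The two coordinate maps from the plane to the line, both indexed by
    \<open>{..<1}\<close> on the target side.\<close>
  define c where "c j f = (\<lambda>i\<in>{..<1 :: nat}. f j :: 'k)" for j :: nat and f
  have c_hom: "c j \<in> module_hom K (?F 2) (?F 1)" if "j < 2" for j
    by (rule module_homI) (use that in \<open>auto simp: c_def F_simps fun_eq_iff\<close>)
  define \<pi> where "\<pi> j = (\<lambda>x\<in>carrier P. \<iota>1 (c j (inv_into (carrier (?F 2)) \<iota>2 x)))" for j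
  have \<pi>_ext: "\<pi> j \<in> extensional (carrier P)" for j
    unfolding \<pi>_def by (rule restrict_extensional)
  have \<pi>_hom: "\<pi> j \<in> module_hom K P A" if "j < 2" for j
    by (rule module_hom_cong[OF P_props(1) module_hom_comp[OF module_hom_comp[OF
          module_hom_inverse[OF F(1) P_props(2,3)] c_hom[OF that]] A_props(2)]]) (simp add: \<pi>_def)
  have objs: "A \<in> Ob ?C" "P \<in> Ob ?C"
    using A_props P_props F by (simp_all add: vector_spaces_simps)
  have "bij_betw (\<lambda>f. (c 0 f, c 1 f)) (carrier (?F 2)) (carrier (?F 1) \<times> carrier (?F 1))"
    unfolding bij_betw_def
  proof
    show "inj_on (\<lambda>f. (c 0 f, c 1 f)) (carrier (?F 2))"
    proof (rule inj_onI)
      fix f g assume fg: "f \<in> carrier (?F 2)" "g \<in> carrier (?F 2)" "(c 0 f, c 1 f) = (c 0 g, c 1 g)"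
      have "c 0 f 0 = c 0 g 0" "c 1 f 0 = c 1 g 0"
        using fg(3) by simp_all
      then have "f 0 = g 0" "f 1 = g 1"
        by (simp_all add: c_def)
      then have "f i = g i" if "i < 2" for i
        using less_2_cases[OF that] by auto
      then show "f = g"
        by (intro PiE_ext[OF fg(1,2)[unfolded F_simps]]) simp
    qed
    have "c 0 f \<in> carrier (?F 1)" "c 1 f \<in> carrier (?F 1)" if "f \<in> carrier (?F 2)" for f
      using module_homD(1)[OF c_hom that] by simp_all
    moreover have "(f, g) \<in> (\<lambda>f. (c 0 f, c 1 f)) ` carrier (?F 2)"
      if fg: "f \<in> carrier (?F 1)" "g \<in> carrier (?F 1)" for f g
    proof -
      let ?h = "\<lambda>i\<in>{..<2 :: nat}. if i = 0 then f 0 else g 0"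
      have "f 0 \<in> carrier K" "g 0 \<in> carrier K"
        using PiE_mem[OF fg(1)[unfolded F_simps], of 0] PiE_mem[OF fg(2)[unfolded F_simps], of 0]
        by simp_all
      then have "?h \<in> carrier (?F 2)"
        by (simp add: F_simps)
      moreover have "c 0 ?h = restrict f {..<1}" "c 1 ?h = restrict g {..<1}"
        unfolding c_def by (rule restrict_ext, simp)+
      moreover have "restrict f {..<1} = f" "restrict g {..<1} = g"
        using fg unfolding F_simps by (metis PiE_restrict)+
      ultimately show ?thesis
        by (intro image_eqI[of _ _ ?h]) simp_all
    qed
    ultimately show "(\<lambda>f. (c 0 f, c 1 f)) ` carrier (?F 2) = carrier (?F 1) \<times> carrier (?F 1)"
      by blast
  qed
  note c_bij = this
  have "bij_betw (map_prod \<iota>1 \<iota>1) (carrier (?F 1) \<times> carrier (?F 1)) (carrier A \<times> carrier A)"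
    using bij_betw_map_prod[OF A_props(3) A_props(3)] .
  from bij_betw_trans[OF bij_betw_trans[OF bij_betw_inv_into[OF P_props(3)] c_bij] this]
  have bij: "bij_betw (\<lambda>x. (\<pi> 0 x, \<pi> 1 x)) (carrier P) (carrier A \<times> carrier A)"
    by (rule bij_betw_cong[THEN iffD1, rotated]) (simp add: \<pi>_def)
  have prod: "is_product ?C A A P (\<pi> 0) (\<pi> 1)"
    by (rule vector_space_product_of_bij[OF objs(1,1,2) _ _ bij])
      (use \<pi>_hom \<pi>_ext in \<open>simp_all add: vector_spaces_simps\<close>)
  have "\<pi> 0 \<noteq> \<pi> 1"
  proof
    assume eq: "\<pi> 0 = \<pi> 1"
    \<comment> \<open>Equal projections would put only diagonal pairs in the product, but the
      vectors 0 and 1 of the line differ because \<open>K\<close> is a field.\<close>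
    let ?u = "\<iota>1 (\<lambda>i\<in>{..<1}. \<zero>\<^bsub>K\<^esub>)" and ?v = "\<iota>1 (\<lambda>i\<in>{..<1}. \<one>\<^bsub>K\<^esub>)"
    have mem: "(\<lambda>i\<in>{..<1 :: nat}. \<zero>\<^bsub>K\<^esub>) \<in> carrier (?F 1)" "(\<lambda>i\<in>{..<1 :: nat}. \<one>\<^bsub>K\<^esub>) \<in> carrier (?F 1)"
      by (auto simp: F_simps)
    then have "(?u, ?v) \<in> carrier A \<times> carrier A"
      by (auto simp: A_def transported_module_simps)
    then have "(?u, ?v) \<in> (\<lambda>x. (\<pi> 0 x, \<pi> 1 x)) ` carrier P"
      using bij by (simp add: bij_betw_def)
    then have "?u = ?v" using eq by auto
    then have "(\<lambda>i\<in>{..<1 :: nat}. \<zero>\<^bsub>K\<^esub>) = (\<lambda>i\<in>{..<1}. \<one>\<^bsub>K\<^esub>)"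
      using inj_onD[OF \<iota>1 _ mem] by blast
    from fun_cong[OF this, of 0] show False by simp
  qed
  then have lower: "\<not> carrier (Aut ?C P) \<subseteq> alternation_words ?C A A P (\<pi> 0) (\<pi> 1) 2"
    using category.swap_notin_alternation_words_2[OF category_fin_dim_vector_spaces prod] by blast
  have "alternation_diameter ?C = Some (enat (Suc 2))"
  proof (rule alternation_diameter_eqI[OF category_fin_dim_vector_spaces _ prod lower])
    fix A B P :: "('k, 'v) module" and \<pi>\<^sub>A \<pi>\<^sub>B
    assume "is_product ?C A B P \<pi>\<^sub>A \<pi>\<^sub>B"
    then interpret vector_space_product K A B P \<pi>\<^sub>A \<pi>\<^sub>B
      by unfold_locales
    show "carrier (Aut ?C P) \<subseteq> alternation_words ?C A B P \<pi>\<^sub>A \<pi>\<^sub>B (Suc 2)"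
      using alternation_words_3 by (simp add: numeral_3_eq_3 numeral_2_eq_2)
  qed
  then show ?thesis by (simp add: numeral_eq_enat)
qed

theorem theorem1:
  fixes K :: "('k, 'r) ring_scheme"
  assumes "infinite (UNIV :: 'a set)"
    and "field K"
    and "\<And>n. \<exists>\<iota> :: (nat \<Rightarrow> 'k) \<Rightarrow> 'v. inj_on \<iota> ({..<n} \<rightarrow>\<^sub>E carrier K)"
  shows "alternation_diameter (finite_sets :: ('a set, 'a \<Rightarrow> 'a) category_data) = Some 3
    \<and> alternation_diameter (countable_sets :: ('a set, 'a \<Rightarrow> 'a) category_data) = Some 4
    \<and> alternation_diameter
         (fin_dim_vector_spaces K :: (('k, 'v) module, 'v \<Rightarrow> 'v) category_data) = Some 3"
  using alternation_diameter_finite_sets[OF assms(1)] alternation_diameter_countable_sets[OF assms(1)]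
    alternation_diameter_vector_spaces[OF assms(2,3)]
  by blast

end
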